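(* Let $F$ be a field of characteristic not $2$, let $(V,B)$ be a finite-dimensional symplectic vector space over $F$, and let $l_1,\ldots,l_n$ ($n\ge3$) be Lagrangian subspaces of $V$, indexed by $\mathbb Z/n\mathbb Z$. Let $P$ be the associated sheaf on the filled $n$-gon $D$ and let $$\cup:\mathrm{Sym}^2H^1(D,P)\to H^2(D,j_{U,!}F_U)=F$$ be the pairing induced by the symplectic form. Then $H^1(D,P)=T_{1,2,\ldots,n}$, the pairing $\cup$ is non-degenerate, and under this identification $\cup$ equals $-q_{1,2,\ldots,n}$.
   Context: The quadratic space $T_{1,\ldots,n}$: $K_{1,\ldots,n}=\{w\in\bigoplus_{i\in\mathbb Z/n\mathbb Z} l_i:\sum_i w_i=0\}$. For $w\in K_{1,\ldots,n}$ an anti-derivative is a family $\hat w=(\hat w_{\{i,i+1\}})_{i\in\mathbb Z/n\mathbb Z}$ of elements of $V$ with $\hat w_{\{i,i+1\}}-\hat w_{\{i-1,i\}}=w_i$ for all $i$; it exists and is unique up to a constant vector. The symmetric form $q_{1,\ldots,n}(v,w)=\sum_iB(v_i,\hat w_{\{i,i+1\}})$ is independent of the choice of $\hat w$, and $T_{1,\ldots,n}=K_{1,\ldots,n}/\ker q_{1,\ldots,n}$ with the induced form $q_{1,\ldots,n}$. The sheaf $P$: $D$ is the closed filled $n$-gon, with vertices cyclically labeled by $\mathbb Z/n\mathbb Z$ and with the corresponding orientation; $U$ is its interior, $j_U:U\to D$ the inclusion, and $F_U$ the constant sheaf on $U$ with fibre $F$. $P$ is the subsheaf of the constant sheaf $V_D$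 (fibre $V$) whose fibre is $V$ on $U$, $l_i$ on the open edge $(i,i+1)$, and $l_{i-1}\cap l_i$ at the vertex $i$. The symplectic form $B$ induces a map $P\otimes P\to j_{U,!}F_U$, and hence the cup product pairing $\cup$. Conventions: triangulate $D$ by a central vertex $\infty$ and radii to the vertices. The cellular 1-cochains with values in $P$ consist of $\alpha_{\{i,i+1\}}\in l_i$ and $\alpha_{\{i,\infty\}}\in V$, with cocycle condition $\alpha_{\{i+1,\infty\}}-\alpha_{\{i,\infty\}}=-\alpha_{\{i,i+1\}}$; a cocycle $\alpha$ corresponds to the class in $T_{1,\ldots,n}$ of $v\in K_{1,\ldots,n}$ with $v_i=\alpha_{\{i,i+1\}}$. The cup product of 1-cocycles is $(\alpha\cup\beta)_{\{i,i+1,\infty\}}=B(\alpha_{\{i,i+1\}},\beta_{\{i+1,\infty\}})$, and the identification $H^2(D,j_{U,!}F_U)=F$ given by the orientation is $\gamma\mapsto\sum_{i\in\mathbb Z/n\mathbb Z}\gamma_{\{i,i+1,\infty\}}$. *)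

theory Defs
  imports "HOL-Analysis.Analysis" "HOL-Library.Function_Algebras"
begin

section \<open>Symplectic linear algebra\<close>

definition symplectic_space ::
  "('f::field \<Rightarrow> 'v::ab_group_add \<Rightarrow> 'v) \<Rightarrow> ('v \<Rightarrow> 'v \<Rightarrow> 'f) \<Rightarrow> bool" where
  "symplectic_space smul B \<longleftrightarrow>
     (\<exists>Bas. finite_dimensional_vector_space smul Bas) \<and>
     (\<forall>v. Vector_Spaces.linear smul (*) (\<lambda>w. B v w)) \<and>
     (\<forall>w. Vector_Spaces.linear smul (*) (\<lambda>v. B v w)) \<and>
     (\<forall>v. B v v = 0) \<and>
     (\<forall>v. (\<forall>w. B v w = 0) \<longrightarrow> v = 0)"

definition lagrangian ::
  "('f::field \<Rightarrow> 'v::ab_group_add \<Rightarrow> 'v) \<Rightarrow> ('v \<Rightarrow> 'v \<Rightarrow> 'f) \<Rightarrow> 'v set \<Rightarrow> bool" where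
  "lagrangian smul B L \<longleftrightarrow> module.subspace smul L \<and> L = {v. \<forall>w\<in>L. B v w = 0}"

text \<open>Families indexed by \<open>\<int>/n\<int>\<close> are represented by the \<open>n\<close>-periodic functions on \<open>\<int>\<close>.\<close>

definition periodic :: "nat \<Rightarrow> (int \<Rightarrow> 'a) \<Rightarrow> bool" where
  "periodic n f \<longleftrightarrow> (\<forall>i. f (i + int n) = f i)"

text \<open>
  Vector spaces that arise as quotients are given by a carrier, an addition and a scalar
  multiplication; this is the notion of linear isomorphism between two of them.
\<close>

definition linear_iso ::
  "'a set \<Rightarrow> ('a \<Rightarrow> 'a \<Rightarrow> 'a) \<Rightarrow> ('f \<Rightarrow> 'a \<Rightarrow> 'a) \<Rightarrow>
   'b set \<Rightarrow> ('b \<Rightarrow> 'b \<Rightarrow> 'b) \<Rightarrow> ('f \<Rightarrow> 'b \<Rightarrow> 'b) \<Rightarrow> ('a \<Rightarrow> 'b) \<Rightarrow> bool" where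
  "linear_iso X addX smulX Y addY smulY \<phi> \<longleftrightarrow>
     bij_betw \<phi> X Y \<and>
     (\<forall>x\<in>X. \<forall>x'\<in>X. addX x x' \<in> X \<and> \<phi> (addX x x') = addY (\<phi> x) (\<phi> x')) \<and>
     (\<forall>a. \<forall>x\<in>X. smulX a x \<in> X \<and> \<phi> (smulX a x) = smulY a (\<phi> x))"


section \<open>The quadratic space \<open>T\<close>\<close>

definition K_space :: "nat \<Rightarrow> (int \<Rightarrow> 'v::ab_group_add set) \<Rightarrow> (int \<Rightarrow> 'v) set" where
  "K_space n l = {w. periodic n w \<and> (\<forall>i. w i \<in> l i) \<and> (\<Sum>i\<in>{0..<int n}. w i) = 0}"

text \<open>The value \<open>h i\<close> is the entry of the anti-derivative at the edge \<open>{i, i+1}\<close>.\<close>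

definition antiderivative :: "nat \<Rightarrow> (int \<Rightarrow> 'v::ab_group_add) \<Rightarrow> (int \<Rightarrow> 'v) \<Rightarrow> bool" where
  "antiderivative n w h \<longleftrightarrow> periodic n h \<and> (\<forall>i. h i - h (i - 1) = w i)"

definition q_form ::
  "nat \<Rightarrow> ('v::ab_group_add \<Rightarrow> 'v \<Rightarrow> 'f::field) \<Rightarrow> (int \<Rightarrow> 'v) \<Rightarrow> (int \<Rightarrow> 'v) \<Rightarrow> 'f" where
  "q_form n B v w =
     (let h = (SOME h. antiderivative n w h) in \<Sum>i\<in>{0..<int n}. B (v i) (h i))"

definition q_kernel ::
  "nat \<Rightarrow> ('v::ab_group_add \<Rightarrow> 'v \<Rightarrow> 'f::field) \<Rightarrow> (int \<Rightarrow> 'v set) \<Rightarrow> (int \<Rightarrow> 'v) set" where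
  "q_kernel n B l = {w \<in> K_space n l. \<forall>v\<in>K_space n l. q_form n B v w = 0}"

definition T_rel ::
  "nat \<Rightarrow> ('v::ab_group_add \<Rightarrow> 'v \<Rightarrow> 'f::field) \<Rightarrow> (int \<Rightarrow> 'v set) \<Rightarrow>
   ((int \<Rightarrow> 'v) \<times> (int \<Rightarrow> 'v)) set" where
  "T_rel n B l =
     {(v, w). v \<in> K_space n l \<and> w \<in> K_space n l \<and> (\<lambda>i. v i - w i) \<in> q_kernel n B l}"

definition T_space ::
  "nat \<Rightarrow> ('v::ab_group_add \<Rightarrow> 'v \<Rightarrow> 'f::field) \<Rightarrow> (int \<Rightarrow> 'v set) \<Rightarrow> (int \<Rightarrow> 'v) set set" where
  "T_space n B l = K_space n l // T_rel n B l"

definition T_class ::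
  "nat \<Rightarrow> ('v::ab_group_add \<Rightarrow> 'v \<Rightarrow> 'f::field) \<Rightarrow> (int \<Rightarrow> 'v set) \<Rightarrow>
   (int \<Rightarrow> 'v) \<Rightarrow> (int \<Rightarrow> 'v) set" where
  "T_class n B l v = T_rel n B l `` {v}"

definition T_add ::
  "nat \<Rightarrow> ('v::ab_group_add \<Rightarrow> 'v \<Rightarrow> 'f::field) \<Rightarrow> (int \<Rightarrow> 'v set) \<Rightarrow>
   (int \<Rightarrow> 'v) set \<Rightarrow> (int \<Rightarrow> 'v) set \<Rightarrow> (int \<Rightarrow> 'v) set" where
  "T_add n B l X Y = (\<Union>v\<in>X. \<Union>w\<in>Y. T_class n B l (\<lambda>i. v i + w i))"

definition T_scale ::
  "nat \<Rightarrow> ('f::field \<Rightarrow> 'v::ab_group_add \<Rightarrow> 'v) \<Rightarrow> ('v \<Rightarrow> 'v \<Rightarrow> 'f) \<Rightarrow> (int \<Rightarrow> 'v set) \<Rightarrow>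
   'f \<Rightarrow> (int \<Rightarrow> 'v) set \<Rightarrow> (int \<Rightarrow> 'v) set" where
  "T_scale n smul B l a X = (\<Union>v\<in>X. T_class n B l (\<lambda>i. smul a (v i)))"

definition T_form ::
  "nat \<Rightarrow> ('v::ab_group_add \<Rightarrow> 'v \<Rightarrow> 'f::field) \<Rightarrow>
   (int \<Rightarrow> 'v) set \<Rightarrow> (int \<Rightarrow> 'v) set \<Rightarrow> 'f" where
  "T_form n B X Y = the_elem (\<Union>v\<in>X. \<Union>w\<in>Y. {q_form n B v w})"


section \<open>Sheaf cohomology\<close>

text \<open>
  All sheaves here are subsheaves of constant sheaves. Such a sheaf is given by its fibres
  \<open>A p\<close>, and its sections over \<open>W\<close> are the locally constant functions
  on \<open>W\<close> with \<open>s p \<in> A p\<close>. Functions on \<open>W\<close> are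
  extended by \<open>0\<close>, so that they are determined by their values on \<open>W\<close>.
\<close>

definition sections ::
  "('p::topological_space \<Rightarrow> 'a::zero set) \<Rightarrow> 'p set \<Rightarrow> ('p \<Rightarrow> 'a) set" where
  "sections A W =
     {s. (\<forall>p\<in>W. s p \<in> A p \<and> (\<forall>\<^sub>F r in at p within W. s r = s p)) \<and> (\<forall>p. p \<notin> W \<longrightarrow> s p = 0)}"

definition restr :: "'p set \<Rightarrow> ('p \<Rightarrow> 'a::zero) \<Rightarrow> 'p \<Rightarrow> 'a" where
  "restr W s = (\<lambda>p. if p \<in> W then s p else 0)"

text \<open>
  On a compact Hausdorff space sheaf cohomology, with its cup product, is Cech cohomology: the
  direct limit, over the open covers and their refinements, of the cohomology of the complexes of
  Cech cochains. A cover \<open>(N x)\<close> of \<open>D\<close> is indexed here by a set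
  \<open>I\<close> of points of the ambient type. Such covers are cofinal among all open covers,
  since every open cover is refined by one that is indexed by the points of \<open>D\<close>.
\<close>

definition open_cover ::
  "'p::topological_space set \<Rightarrow> 'p set \<Rightarrow> ('p \<Rightarrow> 'p set) \<Rightarrow> bool" where
  "open_cover D I N \<longleftrightarrow> (\<forall>x\<in>I. openin (top_of_set D) (N x)) \<and> (\<Union>x\<in>I. N x) = D"

type_synonym ('p, 'a) cochain = "'p list \<Rightarrow> 'p \<Rightarrow> 'a"

text \<open>
  A \<open>k\<close>-cochain assigns to each list \<open>[x\<^sub>0, \<dots>, x\<^sub>k]\<close> of indices a
  section over the intersection of the \<open>N x\<^sub>j\<close>; other lists get the value \<open>0\<close>.
\<close>

definition cochains ::
  "('p::topological_space \<Rightarrow> 'a::ab_group_add set) \<Rightarrow> 'p set \<Rightarrow> ('p \<Rightarrow> 'p set) \<Rightarrow> nat \<Rightarrow>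
   ('p, 'a) cochain set" where
  "cochains A I N k =
     {c. \<forall>xs. if length xs = Suc k \<and> set xs \<subseteq> I
               then c xs \<in> sections A (\<Inter>x\<in>set xs. N x) else c xs = 0}"

definition cobound ::
  "'p set \<Rightarrow> ('p \<Rightarrow> 'p set) \<Rightarrow> ('p, 'a::ab_group_add) cochain \<Rightarrow> ('p, 'a) cochain" where
  "cobound I N c = (\<lambda>xs.
     if set xs \<subseteq> I
     then restr (\<Inter>x\<in>set xs. N x)
            (\<Sum>j<length xs. let s = c (take j xs @ drop (Suc j) xs) in if even j then s else - s)
     else 0)"

definition cocycles ::
  "('p::topological_space \<Rightarrow> 'a::ab_group_add set) \<Rightarrow> 'p set \<Rightarrow> ('p \<Rightarrow> 'p set) \<Rightarrow> nat \<Rightarrow>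
   ('p, 'a) cochain set" where
  "cocycles A I N k = {c \<in> cochains A I N k. cobound I N c = 0}"

fun coboundaries ::
  "('p::topological_space \<Rightarrow> 'a::ab_group_add set) \<Rightarrow> 'p set \<Rightarrow> ('p \<Rightarrow> 'p set) \<Rightarrow> nat \<Rightarrow>
   ('p, 'a) cochain set" where
  "coboundaries A I N 0 = {0}"
| "coboundaries A I N (Suc k) = cobound I N ` cochains A I N k"

definition refines ::
  "'p set \<Rightarrow> ('p \<Rightarrow> 'p set) \<Rightarrow> 'p set \<Rightarrow> ('p \<Rightarrow> 'p set) \<Rightarrow> ('p \<Rightarrow> 'p) \<Rightarrow> bool" where
  "refines J M I N \<tau> \<longleftrightarrow> (\<forall>x\<in>J. \<tau> x \<in> I \<and> M x \<subseteq> N (\<tau> x))"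

definition pullback ::
  "'p set \<Rightarrow> ('p \<Rightarrow> 'p set) \<Rightarrow> ('p \<Rightarrow> 'p) \<Rightarrow> ('p, 'a::zero) cochain \<Rightarrow> ('p, 'a) cochain" where
  "pullback J M \<tau> c = (\<lambda>xs.
     if set xs \<subseteq> J then restr (\<Inter>x\<in>set xs. M x) (c (map \<tau> xs)) else 0)"

type_synonym ('p, 'a) cech = "'p set \<times> ('p \<Rightarrow> 'p set) \<times> ('p, 'a) cochain"

definition cech_cocycles ::
  "'p::topological_space set \<Rightarrow> ('p \<Rightarrow> 'a::ab_group_add set) \<Rightarrow> nat \<Rightarrow> ('p, 'a) cech set" where
  "cech_cocycles D A k = {(I, N, c). open_cover D I N \<and> c \<in> cocycles A I N k}"

definition cech_rel ::
  "'p::topological_space set \<Rightarrow> ('p \<Rightarrow> 'a::ab_group_add set) \<Rightarrow> nat \<Rightarrow>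
   (('p, 'a) cech \<times> ('p, 'a) cech) set" where
  "cech_rel D A k =
     {((I, N, c), (I', N', c')).
        (I, N, c) \<in> cech_cocycles D A k \<and> (I', N', c') \<in> cech_cocycles D A k \<and>
        (\<exists>J M \<tau> \<tau>'. open_cover D J M \<and> refines J M I N \<tau> \<and> refines J M I' N' \<tau>' \<and>
           pullback J M \<tau> c - pullback J M \<tau>' c' \<in> coboundaries A J M k)}"

definition cohomology ::
  "'p::topological_space set \<Rightarrow> ('p \<Rightarrow> 'a::ab_group_add set) \<Rightarrow> nat \<Rightarrow> ('p, 'a) cech set set" where
  "cohomology D A k = cech_cocycles D A k // cech_rel D A k"

definition coh_class ::
  "'p::topological_space set \<Rightarrow> ('p \<Rightarrow> 'a::ab_group_add set) \<Rightarrow> nat \<Rightarrow>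
   'p set \<Rightarrow> ('p \<Rightarrow> 'p set) \<Rightarrow> ('p, 'a) cochain \<Rightarrow> ('p, 'a) cech set" where
  "coh_class D A k I N c = cech_rel D A k `` {(I, N, c)}"

text \<open>
  Two classes always have representatives on a common cover, and operations on classes are
  computed with these.
\<close>

definition coh_zero ::
  "'p::topological_space set \<Rightarrow> ('p \<Rightarrow> 'a::ab_group_add set) \<Rightarrow> nat \<Rightarrow> ('p, 'a) cech set" where
  "coh_zero D A k = coh_class D A k D (\<lambda>_. D) 0"

definition coh_add ::
  "'p::topological_space set \<Rightarrow> ('p \<Rightarrow> 'a::ab_group_add set) \<Rightarrow> nat \<Rightarrow>
   ('p, 'a) cech set \<Rightarrow> ('p, 'a) cech set \<Rightarrow> ('p, 'a) cech set" where
  "coh_add D A k X Y =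
     \<Union>{coh_class D A k I N (c + c') | I N c c'. (I, N, c) \<in> X \<and> (I, N, c') \<in> Y}"

definition coh_scale ::
  "('f \<Rightarrow> 'a \<Rightarrow> 'a) \<Rightarrow>
   'p::topological_space set \<Rightarrow> ('p \<Rightarrow> 'a::ab_group_add set) \<Rightarrow> nat \<Rightarrow>
   'f \<Rightarrow> ('p, 'a) cech set \<Rightarrow> ('p, 'a) cech set" where
  "coh_scale smul D A k a X =
     \<Union>{coh_class D A k I N (\<lambda>xs p. smul a (c xs p)) | I N c. (I, N, c) \<in> X}"

text \<open>
  The cup product of a \<open>k\<close>- and an \<open>m\<close>-cochain followed by the map of
  sheaves that is induced by a bilinear form \<open>B\<close>. No restriction to intersections is
  needed, as \<open>B\<close> vanishes where one of its arguments is \<open>0\<close>.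
\<close>

definition cup_cochain ::
  "('a \<Rightarrow> 'a \<Rightarrow> 'b) \<Rightarrow> nat \<Rightarrow> ('p, 'a) cochain \<Rightarrow> ('p, 'a) cochain \<Rightarrow> ('p, 'b) cochain" where
  "cup_cochain B k c c' = (\<lambda>xs p. B (c (take (Suc k) xs) p) (c' (drop k xs) p))"

definition cup ::
  "('a::ab_group_add \<Rightarrow> 'a \<Rightarrow> 'b::ab_group_add) \<Rightarrow> 'p::topological_space set \<Rightarrow> ('p \<Rightarrow> 'b set) \<Rightarrow>
   nat \<Rightarrow> nat \<Rightarrow> ('p, 'a) cech set \<Rightarrow> ('p, 'a) cech set \<Rightarrow> ('p, 'b) cech set" where
  "cup B D C k m X Y =
     \<Union>{coh_class D C (k + m) I N (cup_cochain B k c c') | I N c c'. (I, N, c) \<in> X \<and> (I, N, c') \<in> Y}"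


section \<open>The polygon, its triangulation and the sheaves on it\<close>

text \<open>The vertices are \<open>n\<close>-periodic in their index and in counterclockwise order.\<close>

definition vertex :: "nat \<Rightarrow> int \<Rightarrow> complex" where
  "vertex n i = cis (2 * pi * real_of_int i / real n)"

definition polygon :: "nat \<Rightarrow> complex set" where
  "polygon n = convex hull (range (vertex n))"

text \<open>
  The fibre of \<open>P\<close> at \<open>p\<close>. The conditions are void in the interior, where
  the fibre is all of \<open>V\<close>.
\<close>

definition P_fibre :: "nat \<Rightarrow> (int \<Rightarrow> 'v set) \<Rightarrow> complex \<Rightarrow> 'v set" where
  "P_fibre n l p =
     {v. \<forall>i. (p \<in> open_segment (vertex n i) (vertex n (i + 1)) \<longrightarrow> v \<in> l i) \<and>
             (p = vertex n i \<longrightarrow> v \<in> l (i - 1) \<inter> l i)}"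

text \<open>The extension by zero to \<open>D\<close> of the constant sheaf on the interior of \<open>D\<close>.\<close>

definition jF_fibre :: "nat \<Rightarrow> complex \<Rightarrow> 'f::zero set" where
  "jF_fibre n p = (if p \<in> interior (polygon n) then UNIV else {0})"

text \<open>
  The triangulation with the central vertex \<open>\<infinity> = 0\<close>. Cellular cochains are
  the Cech cochains of the cover by open stars of vertices: the intersection of the stars of the
  vertices of a simplex is the open star of that simplex, and the sections over it are constant.
\<close>

definition tri_vertices :: "nat \<Rightarrow> complex set" where
  "tri_vertices n = insert 0 (range (vertex n))"

definition tri_simplices :: "nat \<Rightarrow> complex set set" where
  "tri_simplices n = {S. S \<noteq> {} \<and> (\<exists>i. S \<subseteq> {0, vertex n i, vertex n (i + 1)})}"

definition star :: "nat \<Rightarrow> complex \<Rightarrow> complex set" where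
  "star n x = (\<Union>S\<in>{S \<in> tri_simplices n. x \<in> S}. rel_interior (convex hull S))"

text \<open>
  The entries of cellular cochains are read off at the midpoint of the edge \<open>{i, i+1}\<close>
  and at the barycentre of the triangle \<open>{i, i+1, \<infinity>}\<close>.
\<close>

definition edge_value :: "nat \<Rightarrow> (complex, 'a) cochain \<Rightarrow> int \<Rightarrow> 'a" where
  "edge_value n \<alpha> i =
     \<alpha> [vertex n i, vertex n (i + 1)] (midpoint (vertex n i) (vertex n (i + 1)))"

definition triangle_value :: "nat \<Rightarrow> (complex, 'a) cochain \<Rightarrow> int \<Rightarrow> 'a" where
  "triangle_value n \<gamma> i =
     \<gamma> [vertex n i, vertex n (i + 1), 0] ((vertex n i + vertex n (i + 1)) / 3)"

end

theory Submission
  imports Defs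
begin

text \<open>
  Sections of \<open>P\<close> and of \<open>j\<^sub>!F\<close> are locally constant functions with values in
  \<open>V\<close> and in \<open>F\<close>. A constant sheaf on the compact convex set \<open>D\<close> has no
  higher cohomology, so every cocycle has a primitive in the constant sheaf, and all the information about
  its class sits in the behaviour of that primitive on the boundary of \<open>D\<close>.

  Degree 1. A cocycle with values in \<open>P\<close> is \<open>c\<^bsub>xy\<^esub> = b\<^bsub>y\<^esub> - b\<^bsub>x\<^esub>\<close> for locally constant \<open>b\<^bsub>x\<^esub>\<close> with values in
  \<open>V\<close> on the same cover, unique up to one constant (\<open>loc_const_1_cocycle_exact\<close>,
  \<open>glued_const\<close>). Modulo the fibres of \<open>P\<close> the \<open>b\<^bsub>x\<^esub>\<close> glue: at vertex \<open>i\<close>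
  they give a vector \<open>g\<^sub>i\<close> modulo \<open>l\<^bsub>i-1\<^esub> \<inter> l\<^sub>i\<close>, and along the edge from \<open>i\<close> to
  \<open>i+1\<close> they are constant modulo \<open>l\<^sub>i\<close> (\<open>primitive_on_edge\<close>). So the jumps
  \<open>w\<^sub>i = g\<^bsub>i+1\<^esub> - g\<^sub>i\<close> lie in \<open>l\<^sub>i\<close> and sum to zero. They are
  well defined up to differences of families in \<open>l\<^bsub>i-1\<^esub> \<inter> l\<^sub>i\<close>, and these differences are exactly
  the kernel of \<open>q\<close>, because the \<open>l\<^sub>i\<close> are their own orthogonal complements
  (\<open>q_kernel_iff\<close>). This identifies \<open>H\<^sup>1(D,P)\<close> with \<open>T\<close>
  (\<open>cech_rel_iff_jumps\<close>, \<open>H1_value_range\<close>).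

  Degree 2. After a refinement, a cocycle \<open>\<gamma>\<close> of \<open>j\<^sub>!F\<close> is \<open>\<delta>\<beta>\<close>
  in the constant sheaf (\<open>loc_const_2_cocycle_exact\<close>). As \<open>\<gamma>\<close> vanishes on the
  boundary, \<open>\<beta>\<close> is a 1-cocycle there, and its monodromy around the boundary is the trace of
  \<open>\<gamma>\<close> (\<open>trace_data\<close>). The trace depends only on the class
  (\<open>has_trace_rel_unique\<close>); a cocycle with trace zero is a coboundary, since \<open>\<beta>\<close> can be
  corrected so as to vanish on the boundary (\<open>coboundary_if_trace_zero\<close>); and on the star cover the
  trace is the sum over the triangles (\<open>trace_on_star_cover\<close>).

  Cup product. If \<open>c = \<delta>b\<close> and \<open>c' = \<delta>b'\<close> in \<open>V\<close>, then
  \<open>c \<union> c' = \<delta>(b \<union> c')\<close>. The monodromy of \<open>b \<union> c'\<close> around the boundary is computed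
  edge by edge: on the edge from \<open>i\<close> to \<open>i+1\<close> it has the primitive \<open>B(g\<^sub>i, b')\<close>,
  and the mismatches of these primitives at the vertices add up to
  \<open>- \<Sum> B(w\<^sub>i, g'\<^bsub>i+1\<^esub>) = - q(w, w')\<close> (\<open>H2_value_cup\<close>). Symmetry and nondegeneracy
  of the pairing are those of the form \<open>q\<close> on \<open>T\<close>.

  In both degrees the relation between Cech cocycles turns out to be equality of an invariant. The groups of
  classes are therefore identified with the set of values of that invariant by one general argument
  (\<open>linear_iso_class_value\<close>).
\<close>

section \<open>Locally constant functions and cocycles on convex sets\<close>

text \<open>Sections of a subsheaf of a constant sheaf are the locally constant functions with
  values in the fibres. Local constancy is separated from the condition on the fibres, since most
  arguments read sections of a subsheaf as sections of the constant sheaf around it.\<close>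

definition loc_const :: "('p::topological_space \<Rightarrow> 'a) \<Rightarrow> 'p set \<Rightarrow> bool" where
  "loc_const s W \<longleftrightarrow> (\<forall>p\<in>W. \<forall>\<^sub>F r in at p within W. s r = s p)"

lemma loc_const_metric:
  fixes s :: "'p::metric_space \<Rightarrow> 'a"
  shows "loc_const s W \<longleftrightarrow> (\<forall>p\<in>W. \<exists>e>0. \<forall>r\<in>W. dist r p < e \<longrightarrow> s r = s p)"
  unfolding loc_const_def eventually_at by (metis (full_types))

lemma loc_const_mono: "loc_const s W \<Longrightarrow> W' \<subseteq> W \<Longrightarrow> loc_const s W'"
  unfolding loc_const_def by (meson at_le filter_leD subset_iff)

lemma loc_const_const [simp, intro]: "loc_const (\<lambda>_. a) W"
  by (simp add: loc_const_def)

lemma loc_const_comp: "loc_const s W \<Longrightarrow> loc_const (\<lambda>p. h (s p)) W"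
  unfolding loc_const_def by (auto elim!: eventually_mono)

lemma loc_const_comp2:
  assumes "loc_const s W" "loc_const t W"
  shows "loc_const (\<lambda>p. h (s p) (t p)) W"
  unfolding loc_const_def
proof
  fix p assume "p \<in> W"
  with assms have "\<forall>\<^sub>F r in at p within W. s r = s p" "\<forall>\<^sub>F r in at p within W. t r = t p"
    by (auto simp: loc_const_def)
  then show "\<forall>\<^sub>F r in at p within W. h (s r) (t r) = h (s p) (t p)"
    by eventually_elim simp
qed

lemma loc_const_cong:
  assumes "loc_const s W" "\<And>p. p \<in> W \<Longrightarrow> s p = t p"
  shows "loc_const t W"
  using assms unfolding loc_const_def eventually_at_topological by (metis (full_types))

lemma loc_const_connected:
  assumes "connected W" "loc_const s W" "p \<in> W" "q \<in> W"
  shows "s p = s q"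
proof (rule connected_local_const[OF assms(1,3,4)])
  show "\<forall>a\<in>W. \<forall>\<^sub>F b in at a within W. s a = s b"
    using assms(2) unfolding loc_const_def by (auto elim!: eventually_mono)
qed

lemma loc_const_open_pieces:
  fixes s :: "'p::metric_space \<Rightarrow> 'a"
  assumes "\<And>p. p \<in> W \<Longrightarrow> \<exists>M t. openin (top_of_set W) M \<and> p \<in> M \<and> loc_const t M \<and> (\<forall>r\<in>M. s r = t r)"
  shows "loc_const s W"
  unfolding loc_const_metric
proof
  fix p assume "p \<in> W"
  then obtain M t where M: "openin (top_of_set W) M" "p \<in> M" "loc_const t M" "\<And>r. r \<in> M \<Longrightarrow> s r = t r"
    using assms[OF \<open>p \<in> W\<close>] by blast
  have "\<exists>e>0. \<forall>r\<in>W. dist r p < e \<longrightarrow> r \<in> M"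
    using M(1,2) unfolding openin_euclidean_subtopology_iff by blast
  then obtain e where e: "e > 0" "\<And>r. r \<in> W \<Longrightarrow> dist r p < e \<Longrightarrow> r \<in> M" by blast
  obtain e' where e': "e' > 0" "\<And>r. r \<in> M \<Longrightarrow> dist r p < e' \<Longrightarrow> t r = t p"
    using M(2,3) unfolding loc_const_metric by blast
  show "\<exists>e>0. \<forall>r\<in>W. dist r p < e \<longrightarrow> s r = s p"
  proof (intro exI[of _ "min e e'"] conjI ballI impI)
    fix r assume r: "r \<in> W" "dist r p < min e e'"
    then have "r \<in> M" by (intro e(2)) auto
    then have "s r = t r" "t r = t p" using r by (intro M(4) e'(2); simp)+
    then show "s r = s p" using M(4)[OF M(2)] by simp
  qed (use e(1) e'(1) in simp)
qed

text \<open>This is \<open>H\<^sup>0\<close> of a constant sheaf on a connected space, for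
  arbitrary values: with truth values it propagates a property from one point of an edge to the
  whole edge.\<close>

lemma glued_const:
  fixes S :: "'p::metric_space set"
  assumes "connected S"
    and "\<And>x. x \<in> I \<Longrightarrow> openin (top_of_set S) (N x)" "S \<subseteq> (\<Union>x\<in>I. N x)"
    and "\<And>x. x \<in> I \<Longrightarrow> loc_const (s x) (N x)"
    and agree: "\<And>x y p. x \<in> I \<Longrightarrow> y \<in> I \<Longrightarrow> p \<in> N x \<Longrightarrow> p \<in> N y \<Longrightarrow> s x p = s y p"
  shows "\<exists>k. \<forall>x\<in>I. \<forall>p\<in>N x. s x p = k"
proof (cases "S = {}")
  case True
  then have "N x = {}" if "x \<in> I" for x using assms(2)[OF that] openin_imp_subset by blast
  then show ?thesis by auto
next
  case False
  then obtain a where a: "a \<in> S" by auto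
  define \<xi> where "\<xi> p = (SOME x. x \<in> I \<and> p \<in> N x)" for p
  have \<xi>: "\<xi> p \<in> I \<and> p \<in> N (\<xi> p)" if "p \<in> S" for p
    unfolding \<xi>_def by (rule someI_ex) (use assms(3) that in auto)
  have sub: "N x \<subseteq> S" if "x \<in> I" for x using assms(2)[OF that] openin_imp_subset by blast
  have lc: "loc_const (\<lambda>p. s (\<xi> p) p) S"
  proof (rule loc_const_open_pieces)
    fix p assume "p \<in> S"
    have \<xi>p: "\<xi> p \<in> I" "p \<in> N (\<xi> p)" using \<xi>[OF \<open>p \<in> S\<close>] by auto
    have "s (\<xi> r) r = s (\<xi> p) r" if "r \<in> N (\<xi> p)" for r
    proof -
      have "r \<in> S" using sub[OF \<xi>p(1)] that by auto
      then show ?thesis using agree[of "\<xi> r" "\<xi> p" r] \<xi>[of r] \<xi>p that by auto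
    qed
    then show "\<exists>M t. openin (top_of_set S) M \<and> p \<in> M \<and> loc_const t M \<and> (\<forall>r\<in>M. s (\<xi> r) r = t r)"
      using assms(2)[OF \<xi>p(1)] assms(4)[OF \<xi>p(1)] \<xi>p(2) by blast
  qed
  have "s x p = s (\<xi> a) a" if "x \<in> I" "p \<in> N x" for x p
  proof -
    have "p \<in> S" using sub that by auto
    then have "s (\<xi> p) p = s (\<xi> a) a" using loc_const_connected[OF assms(1) lc _ a] by blast
    moreover have "s x p = s (\<xi> p) p" by (rule agree) (use that \<xi>[OF \<open>p \<in> S\<close>] in auto)
    ultimately show ?thesis by simp
  qed
  then show ?thesis by blast
qed

lemma Lebesgue_choice:
  fixes S :: "'p::metric_space set"
  assumes "compact S" "\<And>x. x \<in> I \<Longrightarrow> openin (top_of_set S) (N x)" "S \<subseteq> (\<Union>x\<in>I. N x)"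
  obtains e \<sigma> where "e > 0" "\<And>p. p \<in> S \<Longrightarrow> \<sigma> p \<in> I" "\<And>p. p \<in> S \<Longrightarrow> ball p e \<inter> S \<subseteq> N (\<sigma> p)"
proof -
  have "\<forall>x\<in>I. \<exists>U. open U \<and> N x = S \<inter> U"
    using assms(2) by (simp add: openin_open)
  then obtain U where U: "\<And>x. x \<in> I \<Longrightarrow> open (U x)" "\<And>x. x \<in> I \<Longrightarrow> N x = S \<inter> U x"
    by metis
  have "S \<subseteq> \<Union>(U ` I)" using assms(3) U(2) by fastforce
  from Heine_Borel_lemma[OF assms(1) this] U(1)
  obtain e where e: "e > 0" "\<And>p. p \<in> S \<Longrightarrow> \<exists>G\<in>U ` I. ball p e \<subseteq> G" by blast
  define \<sigma> where "\<sigma> p = (SOME x. x \<in> I \<and> ball p e \<subseteq> U x)" for p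
  have "\<sigma> p \<in> I \<and> ball p e \<subseteq> U (\<sigma> p)" if "p \<in> S" for p
    unfolding \<sigma>_def by (rule someI_ex) (use e(2)[OF that] in auto)
  then show ?thesis using that[of e \<sigma>] e(1) U(2) by blast
qed

text \<open>The contraction of \<open>S\<close> to the point \<open>a\<close> along segments,
  cut into so many steps that no point moves by \<open>e\<close> in one step. Sums over these
  steps replace integration along paths.\<close>

lemma contraction_steps:
  fixes S :: "'p::real_normed_vector set"
  assumes "compact S" "convex S" "a \<in> S" "e > 0"
  obtains m :: nat and f where "f 0 = (\<lambda>_. a)" "\<And>x. f m x = x"
    "\<And>k x. k \<le> m \<Longrightarrow> x \<in> S \<Longrightarrow> f k x \<in> S"
    "\<And>k x y. k \<le> m \<Longrightarrow> dist (f k x) (f k y) \<le> dist x y"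
    "\<And>k x. k < m \<Longrightarrow> x \<in> S \<Longrightarrow> dist (f k x) (f (Suc k) x) < e"
proof -
  obtain R where R: "\<And>x. x \<in> S \<Longrightarrow> dist a x \<le> R" "R > 0"
    using compact_imp_bounded[OF assms(1)] bounded_any_center[of S a]
    by (metis max.strict_coboundedI2 max.coboundedI1 zero_less_one)
  obtain m :: nat where m: "R / e < real m" using reals_Archimedean2 by blast
  with R \<open>e > 0\<close> have m0: "m > 0" by (metis divide_pos_pos gr0I of_nat_0 order.asym)
  define f where "f k x = (1 - real k / real m) *\<^sub>R a + (real k / real m) *\<^sub>R x" for k x
  show ?thesis
  proof (rule that[of f m])
    show "f 0 = (\<lambda>_. a)" "\<And>x. f m x = x" using m0 by (auto simp: f_def)
    show "f k x \<in> S" if "k \<le> m" "x \<in> S" for k x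
      unfolding f_def using that m0 by (intro convexD assms) auto
    show "dist (f k x) (f k y) \<le> dist x y" if "k \<le> m" for k x y
    proof -
      have "f k x - f k y = (real k / real m) *\<^sub>R (x - y)" by (simp add: f_def algebra_simps)
      then have "dist (f k x) (f k y) = (real k / real m) * dist x y" by (simp add: dist_norm)
      also have "\<dots> \<le> 1 * dist x y" using that m0 by (intro mult_right_mono) auto
      finally show ?thesis by simp
    qed
    show "dist (f k x) (f (Suc k) x) < e" if "k < m" "x \<in> S" for k x
    proof -
      have "f k x - f (Suc k) x = (1 / real m) *\<^sub>R (a - x)"
        using m0 by (simp add: f_def algebra_simps add_divide_distrib)
      then have "dist (f k x) (f (Suc k) x) = dist a x / real m" by (simp add: dist_norm)
      also have "\<dots> \<le> R / real m" using R(1)[OF that(2)] by (simp add: divide_right_mono)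
      also have "\<dots> < e" using m m0 \<open>e > 0\<close> by (simp add: field_simps)
      finally show ?thesis .
    qed
  qed
qed

lemma loc_const_convex_eq:
  fixes W :: "'p::real_normed_vector set"
  assumes "loc_const s W" "convex C" "C \<subseteq> W" "p \<in> C" "q \<in> C"
  shows "s p = s q"
  using loc_const_connected[OF convex_connected[OF assms(2)] loc_const_mono[OF assms(1,3)] assms(4,5)] .

text \<open>\<open>H\<^sup>1\<close> of a constant sheaf on a compact convex set vanishes,
  already on the given cover. With a Lebesgue number \<open>e\<close>, a point \<open>p\<close>
  selects an index \<open>\<sigma> p\<close> such that the \<open>e\<close>-ball at
  \<open>p\<close> lies in the member \<open>\<sigma> p\<close>; on intersections of such balls,
  which are convex, the cocycle is a constant \<open>\<Gamma> p q\<close>. Summing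
  \<open>\<Gamma>\<close> along the segment from \<open>a\<close> to \<open>x\<close> gives a
  function \<open>\<phi>\<close> whose differences are \<open>\<Gamma>\<close>: the quadrangles
  between two adjacent segments telescope.\<close>

lemma loc_const_1_cocycle_exact:
  fixes S :: "'p::real_normed_vector set" and c :: "'i \<Rightarrow> 'i \<Rightarrow> 'p \<Rightarrow> 'a::ab_group_add"
  assumes S: "compact S" "convex S"
    and op: "\<And>x. x \<in> I \<Longrightarrow> openin (top_of_set S) (N x)" and cov: "S \<subseteq> (\<Union>x\<in>I. N x)"
    and lc: "\<And>x y. x \<in> I \<Longrightarrow> y \<in> I \<Longrightarrow> loc_const (c x y) (N x \<inter> N y)"
    and cc: "\<And>x y z p. x \<in> I \<Longrightarrow> y \<in> I \<Longrightarrow> z \<in> I \<Longrightarrow> p \<in> N x \<Longrightarrow> p \<in> N y \<Longrightarrow> p \<in> N z \<Longrightarrow>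
               c x y p + c y z p = c x z p"
  shows "\<exists>b. (\<forall>x\<in>I. loc_const (b x) (N x)) \<and>
             (\<forall>x\<in>I. \<forall>y\<in>I. \<forall>p\<in>N x \<inter> N y. b y p - b x p = c x y p)"
proof (cases "S = {}")
  case True
  then have "N x = {}" if "x \<in> I" for x using op[OF that] openin_imp_subset by blast
  then show ?thesis by (intro exI[of _ "\<lambda>_ _. 0"]) auto
next
  case False
  then obtain a where a: "a \<in> S" by auto
  have sub: "N x \<subseteq> S" if "x \<in> I" for x using op[OF that] openin_imp_subset by blast
  obtain e \<sigma> where e: "e > 0" and \<sigma>: "\<And>p. p \<in> S \<Longrightarrow> \<sigma> p \<in> I"
      "\<And>p. p \<in> S \<Longrightarrow> ball p e \<inter> S \<subseteq> N (\<sigma> p)"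
    using Lebesgue_choice[OF S(1) op cov] by blast
  define \<Gamma> where "\<Gamma> p q = c (\<sigma> p) (\<sigma> q) p" for p q
  have \<Gamma>: "\<Gamma> p q = c (\<sigma> p) (\<sigma> q) r"
    if "p \<in> S" "q \<in> S" "r \<in> S" "dist p q < e" "dist p r < e" "dist q r < e" for p q r
    unfolding \<Gamma>_def
  proof (rule loc_const_convex_eq[OF lc[OF \<sigma>(1)[OF that(1)] \<sigma>(1)[OF that(2)]]])
    show "convex (ball p e \<inter> ball q e \<inter> S)" by (intro convex_Int convex_ball S)
  qed (use \<sigma>(2) that e in \<open>auto simp: dist_commute\<close>)
  have N\<sigma>: "q \<in> N (\<sigma> p)" if "p \<in> S" "q \<in> S" "dist p q < e" for p q
    using \<sigma>(2)[OF that(1)] that by auto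
  have \<Gamma>_add: "\<Gamma> p q + \<Gamma> q r = \<Gamma> p r"
    if "p \<in> S" "q \<in> S" "r \<in> S" "dist p q < e" "dist p r < e" "dist q r < e" for p q r
  proof -
    have "\<Gamma> q r = c (\<sigma> q) (\<sigma> r) p" by (rule \<Gamma>) (use that in \<open>auto simp: dist_commute\<close>)
    moreover have "p \<in> N (\<sigma> p)" "p \<in> N (\<sigma> q)" "p \<in> N (\<sigma> r)"
      using that e by (auto intro!: N\<sigma> simp: dist_commute)
    ultimately show ?thesis using cc \<sigma>(1) that unfolding \<Gamma>_def by metis
  qed
  have \<Gamma>0: "\<Gamma> a a = 0" using \<Gamma>_add[of a a a] a e by auto
  have "e / 2 > 0" using e by simp
  obtain m f where f0: "f 0 = (\<lambda>_. a)" and fm: "\<And>x. f m x = x"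
    and fS: "\<And>k x. k \<le> m \<Longrightarrow> x \<in> S \<Longrightarrow> f k x \<in> S"
    and fd: "\<And>k x y. k \<le> m \<Longrightarrow> dist (f k x) (f k y) \<le> dist x y"
    and fs: "\<And>k x. k < m \<Longrightarrow> x \<in> S \<Longrightarrow> dist (f k x) (f (Suc k) x) < e / 2"
    by (rule contraction_steps[OF S a \<open>e / 2 > 0\<close>]) (rule that)
  define \<phi> where "\<phi> x = (\<Sum>k<m. \<Gamma> (f k x) (f (Suc k) x))" for x
  have \<phi>: "\<phi> y - \<phi> x = \<Gamma> x y" if xy: "x \<in> S" "y \<in> S" "dist x y < e / 2" for x y
  proof -
    have step: "\<Gamma> (f k y) (f (Suc k) y) - \<Gamma> (f k x) (f (Suc k) x)
        = \<Gamma> (f (Suc k) x) (f (Suc k) y) - \<Gamma> (f k x) (f k y)" if "k < m" for k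
    proof -
      have k: "k \<le> m" "Suc k \<le> m" using that by auto
      have same: "dist (f j x) (f j y) < e / 2" if "j \<le> m" for j
        using fd[OF that, of x y] xy(3) by linarith
      have "dist (f k x) (f (Suc k) y) < e / 2 + e / 2"
        using same[OF k(2)] fs[OF that xy(1)] by (intro dist_triangle_less_add[of _ "f (Suc k) x"]) (simp_all add: dist_commute)
      then have D1: "dist (f k x) (f (Suc k) y) < e" by simp
      have half: "d < e" if "d < e / 2" for d using that e by linarith
      note D = D1 half[OF same[OF k(1)]] half[OF same[OF k(2)]]
        half[OF fs[OF that xy(1)]] half[OF fs[OF that xy(2)]]
      note E = fS[OF k(1) xy(1)] fS[OF k(1) xy(2)] fS[OF k(2) xy(1)] fS[OF k(2) xy(2)]
      have "\<Gamma> (f k x) (f (Suc k) x) + \<Gamma> (f (Suc k) x) (f (Suc k) y) = \<Gamma> (f k x) (f (Suc k) y)"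
        by (rule \<Gamma>_add) (rule D E)+
      moreover have "\<Gamma> (f k x) (f k y) + \<Gamma> (f k y) (f (Suc k) y) = \<Gamma> (f k x) (f (Suc k) y)"
        by (rule \<Gamma>_add) (rule D E)+
      ultimately show ?thesis by (simp add: algebra_simps)
    qed
    have "\<phi> y - \<phi> x = (\<Sum>k<m. \<Gamma> (f (Suc k) x) (f (Suc k) y) - \<Gamma> (f k x) (f k y))"
      unfolding \<phi>_def sum_subtractf[symmetric] using step by (intro sum.cong) auto
    also have "\<dots> = \<Gamma> x y" using sum_lessThan_telescope[of "\<lambda>k. \<Gamma> (f k x) (f k y)" m]
      by (simp add: fm f0 \<Gamma>0)
    finally show ?thesis .
  qed
  \<comment> \<open>the value at \<open>p\<close> is prescribed in the member \<open>\<sigma> p\<close> and transported by the cocycle\<close>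
  define b where "b x p = \<phi> p + c (\<sigma> p) x p" for x p
  show ?thesis
  proof (intro exI[of _ b] conjI ballI)
    fix x assume x: "x \<in> I"
    show "loc_const (b x) (N x)"
      unfolding loc_const_metric
    proof
      fix p assume p: "p \<in> N x"
      then have pS: "p \<in> S" using sub x by auto
      have "loc_const (c (\<sigma> p) x) (N (\<sigma> p) \<inter> N x)" using lc \<sigma>(1) x pS by auto
      moreover have "p \<in> N (\<sigma> p) \<inter> N x" using N\<sigma>[of p p] pS e p by auto
      ultimately obtain d where d: "d > 0"
        "\<And>r. r \<in> N (\<sigma> p) \<inter> N x \<Longrightarrow> dist r p < d \<Longrightarrow> c (\<sigma> p) x r = c (\<sigma> p) x p"
        unfolding loc_const_metric by blast
      show "\<exists>e>0. \<forall>r\<in>N x. dist r p < e \<longrightarrow> b x r = b x p"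
      proof (intro exI[of _ "min d (e/2)"] conjI ballI impI)
        fix r assume r: "r \<in> N x" "dist r p < min d (e / 2)"
        then have rS: "r \<in> S" using sub x by auto
        have rp: "dist p r < e" "dist p r < e / 2" using r e by (auto simp: dist_commute)
        have "\<phi> r - \<phi> p = c (\<sigma> p) (\<sigma> r) r"
          using \<phi>[OF pS rS rp(2)] \<Gamma>[OF pS rS rS rp(1,1)] e by simp
        moreover have "c (\<sigma> p) (\<sigma> r) r + c (\<sigma> r) x r = c (\<sigma> p) x r"
          using cc \<sigma>(1) pS rS x r N\<sigma>[OF pS rS rp(1)] N\<sigma>[OF rS rS] e by auto
        moreover have "c (\<sigma> p) x r = c (\<sigma> p) x p"
          using d(2)[of r] r N\<sigma>[OF pS rS rp(1)] by auto
        ultimately show "b x r = b x p" unfolding b_def by (simp add: algebra_simps)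
      qed (use d e in auto)
    qed
  next
    fix x y p assume xy: "x \<in> I" "y \<in> I" and p: "p \<in> N x \<inter> N y"
    then have pS: "p \<in> S" using sub by auto
    have "c (\<sigma> p) x p + c x y p = c (\<sigma> p) y p"
      using cc \<sigma>(1)[OF pS] xy p N\<sigma>[OF pS pS] e by auto
    then show "b y p - b x p = c x y p" unfolding b_def by (simp add: algebra_simps)
  qed
qed

text \<open>The coboundary of the prism operator \<open>P(x,y) = \<Gamma>(fx,gx,gy) -
  \<Gamma>(fx,fy,gy)\<close> between two maps \<open>f\<close>, \<open>g\<close> is the difference
  of the pullbacks along \<open>g\<close> and \<open>f\<close>. The hypotheses are the cocycle
  conditions on the three tetrahedra of the prism.\<close>

lemma prism_identity:
  fixes a :: "'a::ab_group_add"
  assumes "a - b + c - d = 0" "e - b + f - g = 0" "h - i + f - j = 0"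
  shows "e - h - (c - i) + (d - g) = a - j"
proof -
  have "e - h - (c - i) + (d - g) - (a - j) = - ((a - b + c - d) - (e - b + f - g) + (h - i + f - j))"
    by (simp add: algebra_simps)
  then show ?thesis by (simp add: assms)
qed

text \<open>\<open>H\<^sup>2\<close> of a constant sheaf on a compact convex set vanishes, after
  a refinement by balls. On such balls a cocycle is a function \<open>\<Gamma>\<close> of three
  nearby points. The prism operators of the steps of the contraction add up to a homotopy between
  the identity and the constant map, and the constant cocycle \<open>\<Gamma> a a a\<close> is its
  own primitive.\<close>

lemma loc_const_2_cocycle_exact:
  fixes S :: "'p::real_normed_vector set" and \<gamma> :: "'i \<Rightarrow> 'i \<Rightarrow> 'i \<Rightarrow> 'p \<Rightarrow> 'a::ab_group_add"
  assumes S: "compact S" "convex S"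
    and op: "\<And>x. x \<in> I \<Longrightarrow> openin (top_of_set S) (N x)" and cov: "S \<subseteq> (\<Union>x\<in>I. N x)"
    and lc: "\<And>x y z. x \<in> I \<Longrightarrow> y \<in> I \<Longrightarrow> z \<in> I \<Longrightarrow> loc_const (\<gamma> x y z) (N x \<inter> N y \<inter> N z)"
    and cc: "\<And>x y z w p. x \<in> I \<Longrightarrow> y \<in> I \<Longrightarrow> z \<in> I \<Longrightarrow> w \<in> I \<Longrightarrow>
               p \<in> N x \<Longrightarrow> p \<in> N y \<Longrightarrow> p \<in> N z \<Longrightarrow> p \<in> N w \<Longrightarrow>
               \<gamma> y z w p - \<gamma> x z w p + \<gamma> x y w p - \<gamma> x y z p = 0"
  shows "\<exists>e \<sigma> \<beta>. e > 0 \<and> (\<forall>p\<in>S. \<sigma> p \<in> I \<and> ball p e \<inter> S \<subseteq> N (\<sigma> p)) \<and>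
           (\<forall>x\<in>S. \<forall>y\<in>S. \<forall>z\<in>S. \<forall>p\<in>S. p \<in> ball x e \<inter> ball y e \<inter> ball z e \<longrightarrow>
              \<gamma> (\<sigma> x) (\<sigma> y) (\<sigma> z) p = \<beta> y z - \<beta> x z + \<beta> x y)"
proof (cases "S = {}")
  case True
  then show ?thesis by (intro exI[of _ 1]) auto
next
  case False
  then obtain a where a: "a \<in> S" by auto
  obtain e \<sigma> where e: "e > 0" and \<sigma>: "\<And>p. p \<in> S \<Longrightarrow> \<sigma> p \<in> I"
      "\<And>p. p \<in> S \<Longrightarrow> ball p e \<inter> S \<subseteq> N (\<sigma> p)"
    using Lebesgue_choice[OF S(1) op cov] by blast
  define \<Gamma> where "\<Gamma> p q r = \<gamma> (\<sigma> p) (\<sigma> q) (\<sigma> r) p" for p q r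
  have \<Gamma>: "\<Gamma> p q r = \<gamma> (\<sigma> p) (\<sigma> q) (\<sigma> r) s"
    if "p \<in> S" "q \<in> S" "r \<in> S" "s \<in> S" "dist p q < e" "dist p r < e"
       "dist p s < e" "dist q s < e" "dist r s < e" for p q r s
    unfolding \<Gamma>_def
  proof (rule loc_const_convex_eq[OF lc[OF \<sigma>(1)[OF that(1)] \<sigma>(1)[OF that(2)] \<sigma>(1)[OF that(3)]]])
    show "convex (ball p e \<inter> ball q e \<inter> ball r e \<inter> S)" by (intro convex_Int convex_ball S)
  qed (use \<sigma>(2) that e in \<open>auto simp: dist_commute\<close>)
  have N\<sigma>: "q \<in> N (\<sigma> p)" if "p \<in> S" "q \<in> S" "dist p q < e" for p q
    using \<sigma>(2)[OF that(1)] that by auto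
  have \<Gamma>_cc: "\<Gamma> q r s - \<Gamma> p r s + \<Gamma> p q s - \<Gamma> p q r = 0"
    if "p \<in> S" "q \<in> S" "r \<in> S" "s \<in> S" "dist p q < e" "dist p r < e" "dist p s < e"
       "dist q r < e" "dist q s < e" "dist r s < e" for p q r s
  proof -
    have "\<Gamma> q r s = \<gamma> (\<sigma> q) (\<sigma> r) (\<sigma> s) p" by (rule \<Gamma>) (use that in \<open>auto simp: dist_commute\<close>)
    moreover have "p \<in> N (\<sigma> p)" "p \<in> N (\<sigma> q)" "p \<in> N (\<sigma> r)" "p \<in> N (\<sigma> s)"
      using that e by (auto intro!: N\<sigma> simp: dist_commute)
    ultimately show ?thesis using cc \<sigma>(1) that unfolding \<Gamma>_def by metis
  qed
  have "e / 2 > 0" using e by simp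
  obtain m f where f0: "f 0 = (\<lambda>_. a)" and fm: "\<And>x. f m x = x"
    and fS: "\<And>k x. k \<le> m \<Longrightarrow> x \<in> S \<Longrightarrow> f k x \<in> S"
    and fd: "\<And>k x y. k \<le> m \<Longrightarrow> dist (f k x) (f k y) \<le> dist x y"
    and fs: "\<And>k x. k < m \<Longrightarrow> x \<in> S \<Longrightarrow> dist (f k x) (f (Suc k) x) < e / 2"
    by (rule contraction_steps[OF S a \<open>e / 2 > 0\<close>]) (rule that)
  define Pr where "Pr k x y = \<Gamma> (f k x) (f (Suc k) x) (f (Suc k) y) - \<Gamma> (f k x) (f k y) (f (Suc k) y)"
    for k x y
  define \<beta> where "\<beta> x y = (\<Sum>k<m. Pr k x y) + \<Gamma> a a a" for x y
  have \<beta>: "\<beta> y z - \<beta> x z + \<beta> x y = \<Gamma> x y z"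
    if xyz: "x \<in> S" "y \<in> S" "z \<in> S" and d: "dist x y < e / 2" "dist x z < e / 2" "dist y z < e / 2"
    for x y z
  proof -
    have step: "Pr k y z - Pr k x z + Pr k x y
        = \<Gamma> (f (Suc k) x) (f (Suc k) y) (f (Suc k) z) - \<Gamma> (f k x) (f k y) (f k z)" if "k < m" for k
    proof -
      have k: "k \<le> m" "Suc k \<le> m" using that by auto
      have same: "dist (f j u) (f j v) < e / 2" if "dist u v < e / 2" "j \<le> m" for j u v
        using fd[OF that(2), of u v] that(1) by linarith
      have cross: "dist (f k u) (f (Suc k) v) < e" if "dist u v < e / 2" "u \<in> S" for u v
      proof -
        have "dist (f k u) (f (Suc k) v) < e / 2 + e / 2"
          using same[OF that(1) k(2)] fs[OF \<open>k < m\<close> that(2)]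
          by (intro dist_triangle_less_add[of _ "f (Suc k) u"]) (simp_all add: dist_commute)
        then show ?thesis by simp
      qed
      have same': "dist (f j u) (f j v) < e" if "dist u v < e / 2" "j \<le> m" for j u v
        using same[OF that] e by linarith
      have self: "dist u u < e / 2" for u :: 'p using e by simp
      note D = cross[OF d(1) xyz(1)] cross[OF d(2) xyz(1)] cross[OF d(3) xyz(2)]
        cross[OF self xyz(1)] cross[OF self xyz(2)] cross[OF self xyz(3)]
        same'[OF d(1) k(1)] same'[OF d(2) k(1)] same'[OF d(3) k(1)]
        same'[OF d(1) k(2)] same'[OF d(2) k(2)] same'[OF d(3) k(2)]
      note E = fS[OF k(1) xyz(1)] fS[OF k(1) xyz(2)] fS[OF k(1) xyz(3)]
        fS[OF k(2) xyz(1)] fS[OF k(2) xyz(2)] fS[OF k(2) xyz(3)]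
      have 1: "\<Gamma> (f (Suc k) x) (f (Suc k) y) (f (Suc k) z) - \<Gamma> (f k x) (f (Suc k) y) (f (Suc k) z)
        + \<Gamma> (f k x) (f (Suc k) x) (f (Suc k) z) - \<Gamma> (f k x) (f (Suc k) x) (f (Suc k) y) = 0"
        by (rule \<Gamma>_cc) (rule D E)+
      have 2: "\<Gamma> (f k y) (f (Suc k) y) (f (Suc k) z) - \<Gamma> (f k x) (f (Suc k) y) (f (Suc k) z)
        + \<Gamma> (f k x) (f k y) (f (Suc k) z) - \<Gamma> (f k x) (f k y) (f (Suc k) y) = 0"
        by (rule \<Gamma>_cc) (rule D E)+
      have 3: "\<Gamma> (f k y) (f k z) (f (Suc k) z) - \<Gamma> (f k x) (f k z) (f (Suc k) z)
        + \<Gamma> (f k x) (f k y) (f (Suc k) z) - \<Gamma> (f k x) (f k y) (f k z) = 0"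
        by (rule \<Gamma>_cc) (rule D E)+
      show ?thesis unfolding Pr_def by (rule prism_identity[OF 1 2 3])
    qed
    have "\<beta> y z - \<beta> x z + \<beta> x y = (\<Sum>k<m. Pr k y z - Pr k x z + Pr k x y) + \<Gamma> a a a"
      unfolding \<beta>_def by (simp add: sum.distrib sum_subtractf)
    also have "(\<Sum>k<m. Pr k y z - Pr k x z + Pr k x y) =
       (\<Sum>k<m. \<Gamma> (f (Suc k) x) (f (Suc k) y) (f (Suc k) z) - \<Gamma> (f k x) (f k y) (f k z))"
      using step by (intro sum.cong) auto
    also have "\<dots> = \<Gamma> x y z - \<Gamma> a a a"
      using sum_lessThan_telescope[of "\<lambda>k. \<Gamma> (f k x) (f k y) (f k z)" m] by (simp add: fm f0)
    finally show ?thesis by simp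
  qed
  show ?thesis
  proof (intro exI[of _ "e/4"] exI[of _ \<sigma>] exI[of _ \<beta>] conjI ballI impI)
    fix p assume "p \<in> S"
    show "\<sigma> p \<in> I" using \<sigma>(1) \<open>p \<in> S\<close> .
    show "ball p (e/4) \<inter> S \<subseteq> N (\<sigma> p)" using \<sigma>(2)[OF \<open>p \<in> S\<close>] e by fastforce
  next
    fix x y z p assume S': "x \<in> S" "y \<in> S" "z \<in> S" "p \<in> S"
      and "p \<in> ball x (e / 4) \<inter> ball y (e / 4) \<inter> ball z (e / 4)"
    then have p: "dist x p < e / 4" "dist y p < e / 4" "dist z p < e / 4" by auto
    then have d: "dist x y < e / 2" "dist x z < e / 2" "dist y z < e / 2"
      using dist_triangle2[of x y p] dist_triangle2[of x z p] dist_triangle2[of y z p] by linarith+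
    have "\<Gamma> x y z = \<gamma> (\<sigma> x) (\<sigma> y) (\<sigma> z) p"
      by (rule \<Gamma>) (use S' d p e in auto)
    then show "\<gamma> (\<sigma> x) (\<sigma> y) (\<sigma> z) p = \<beta> y z - \<beta> x z + \<beta> x y"
      using \<beta>[OF S'(1-3) d] by simp
  qed (use e in auto)
qed

section \<open>The polygon and the open stars of its triangulation\<close>

lemma periodic_shift:
  assumes "periodic n f"
  shows "f (i + int n * k) = f i"
proof (induction k arbitrary: i rule: int_induct[where k = 0])
  case base
  then show ?case by simp
next
  case (step1 k)
  have "f (i + int n * (k + 1)) = f ((i + int n * k) + int n)" by (simp add: algebra_simps)
  then show ?case using assms step1 by (simp add: periodic_def)
next
  case (step2 k)
  have "f (i + int n * (k - 1)) = f (i + int n * (k - 1) + int n)" 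
    using assms by (simp add: periodic_def)
  then show ?case using step2 by (simp add: algebra_simps)
qed

lemma periodic_dvd:
  assumes "periodic n f" "int n dvd i - j"
  shows "f i = f j"
proof -
  obtain k where "i - j = int n * k" using assms(2) by auto
  then have "i = j + int n * k" by simp
  then show ?thesis using periodic_shift[OF assms(1)] by simp
qed

lemma periodic_mod: "periodic n f \<Longrightarrow> f (i mod int n) = f i"
  by (rule periodic_dvd) (auto simp: mod_eq_dvd_iff[symmetric])

lemma inner_cis: "inner (cis a) (cis b) = cos (a - b)"
  by (simp add: inner_complex_def cos_diff)

lemma sin_times_cis:
  "sin (\<beta> - \<alpha>) *\<^sub>R cis \<theta> = sin (\<beta> - \<theta>) *\<^sub>R cis \<alpha> + sin (\<theta> - \<alpha>) *\<^sub>R cis \<beta>"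
  by (simp add: complex_eq_iff sin_diff algebra_simps)

lemma convex_combination3:
  assumes "convex S" "x \<in> S" "y \<in> S" "z \<in> S" "a \<ge> 0" "b \<ge> 0" "c \<ge> 0" "a + b + c = 1"
  shows "a *\<^sub>R x + b *\<^sub>R y + c *\<^sub>R z \<in> S"
proof -
  have "a *\<^sub>R x + b *\<^sub>R y + c *\<^sub>R z \<in> convex hull {x, y, z}"
    unfolding convex_hull_3 using assms(5-) by blast
  also have "\<dots> \<subseteq> S" using assms(1-4) by (intro hull_minimal) auto
  finally show ?thesis .
qed

text \<open>This turns membership in a star into positivity of coefficients.\<close>

lemma rel_interior_convex_hull_finite:
  fixes S :: "'a::euclidean_space set"
  assumes "finite S"
  shows "rel_interior (convex hull S) =
    {y. \<exists>u. (\<forall>x\<in>S. 0 < u x) \<and> sum u S = 1 \<and> (\<Sum>x\<in>S. u x *\<^sub>R x) = y}"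
  using assms by (force simp: rel_interior_convex_hull_union[where S="\<lambda>x. {x}" and I=S, simplified])

text \<open>The unit outer normal of the edge \<open>{j, j+1}\<close>. The polygon is the
  intersection of the half planes \<open>edge_normal n j \<bullet> p \<le> cos (pi / n)\<close>,
  and these linear functions detect the position of a point without any choice of angles.\<close>

definition edge_normal :: "nat \<Rightarrow> int \<Rightarrow> complex" where
  "edge_normal n j = cis (2 * pi * (real_of_int j + 1 / 2) / real n)"

abbreviation edge :: "nat \<Rightarrow> int \<Rightarrow> complex set" where
  "edge n i \<equiv> closed_segment (vertex n i) (vertex n (i + 1))"

lemma closed_segment_midpoint:
  fixes a b :: "'a::real_vector"
  assumes "p \<in> closed_segment a (midpoint a b)"
  obtains u where "0 \<le> u" "u \<le> 1 / 2" "p = (1 - u) *\<^sub>R a + u *\<^sub>R b"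
proof -
  obtain t where t: "0 \<le> t" "t \<le> 1" "p = (1 - t) *\<^sub>R a + t *\<^sub>R midpoint a b"
    using assms by (auto simp: closed_segment_def)
  have p: "p = (1 - t / 2) *\<^sub>R a + (t / 2) *\<^sub>R b"
    unfolding t(3) midpoint_def by (simp add: algebra_simps) (simp flip: scaleR_add_left)
  show ?thesis by (rule that[OF _ _ p]) (use t(1,2) in auto)
qed

locale ngon =
  fixes n :: nat
  assumes n3: "n \<ge> 3"
begin

lemma n_pos: "real n > 0" "n > 0" using n3 by auto

lemmas n_gt0 = n_pos(2)

lemma vertex_eq_iff: "vertex n i = vertex n j \<longleftrightarrow> int n dvd i - j"
proof
  assume "vertex n i = vertex n j"
  then have "inner (vertex n i) (vertex n j) = inner (vertex n j) (vertex n j)" by simp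
  then have "cos (2 * pi * real_of_int i / real n - 2 * pi * real_of_int j / real n) = 1"
    by (simp add: vertex_def inner_cis)
  then obtain k :: int where "2 * pi * real_of_int i / real n - 2 * pi * real_of_int j / real n = k * 2 * pi"
    by (auto simp: cos_one_2pi_int)
  then have "2 * pi * real_of_int (i - j) = 2 * pi * real_of_int (k * int n)"
    using n_pos by (simp add: field_simps)
  then have "real_of_int (i - j) = real_of_int (k * int n)" by simp
  then have "i - j = k * int n" by (simp only: of_int_eq_iff)
  then show "int n dvd i - j" by simp
next
  assume "int n dvd i - j"
  then obtain k where k: "i = j + int n * k" by (metis add.commute diff_add_cancel dvdE)
  have "2 * pi * real_of_int i / real n = 2 * pi * real_of_int j / real n + 2 * pi * real_of_int k"
    using n_pos by (simp add: k field_simps)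
  then show "vertex n i = vertex n j"
    by (simp add: vertex_def cis_multiple_2pi flip: cis_mult)
qed

lemma periodic_vertex: "periodic n (vertex n)"
  by (simp add: periodic_def vertex_eq_iff)

lemma vertex_shift: "vertex n i = vertex n j \<Longrightarrow> vertex n (i + k) = vertex n (j + k)"
  by (simp add: vertex_eq_iff)

lemma vertex_neq_next: "vertex n i \<noteq> vertex n (i + 1)" "vertex n (i + 1) \<noteq> vertex n i"
  using n3 by (auto simp: vertex_eq_iff zdvd_not_zless)

lemma vertex_nonzero [simp]: "vertex n i \<noteq> 0" "0 \<noteq> vertex n i"
  by (metis cis_neq_zero vertex_def)+

lemma cos_pi_n_pos: "cos (pi / real n) > 0"
  using n3 by (intro cos_gt_zero) (auto simp: field_simps)

text \<open>These are the values of the edge normals at the vertices. The multiple \<open>2 k -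
  1\<close> is odd, so that only the two odd multiples next to a multiple of \<open>2 n\<close>
  attain the maximum, which happens at the end points of the edge.\<close>

lemma cos_odd_multiple:
  shows "cos (pi * (2 * real_of_int k - 1) / real n) \<le> cos (pi / real n)"
    and "cos (pi * (2 * real_of_int k - 1) / real n) = cos (pi / real n) \<Longrightarrow>
           int n dvd k \<or> int n dvd k - 1"
proof -
  define r where "r = k mod int n"
  have r: "0 \<le> r" "r < int n" using n_pos by (auto simp: r_def)
  have k: "real_of_int k = real_of_int (k div int n) * real n + real_of_int r"
    unfolding r_def by (metis div_mult_mod_eq of_int_add of_int_mult of_int_of_nat_eq)
  have "pi * (2 * real_of_int k - 1) / real n
      = pi * (2 * real_of_int r - 1) / real n + 2 * pi * real_of_int (k div int n)"
    unfolding k using n_pos by (simp add: field_simps)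
  then have eq: "cos (pi * (2 * real_of_int k - 1) / real n) = cos (pi * (2 * real_of_int r - 1) / real n)"
    by (simp add: cos_add)
  have main: "r = 0 \<or> r = 1 \<or> cos (pi * (2 * real_of_int r - 1) / real n) < cos (pi / real n)"
  proof (cases "r = 0 \<or> r = 1")
    case False
    define x where "x = pi * (2 * real_of_int r - 1) / real n"
    have r2: "real_of_int r \<ge> 2" "real_of_int r \<le> real n - 1" using False r by linarith+
    have x: "pi / real n < x" "x < 2 * pi - pi / real n"
      using r2 n_pos by (auto simp: x_def field_simps)
    have "cos x < cos (pi / real n)"
    proof (cases "x \<le> pi")
      case True
      then show ?thesis using x n_pos by (intro cos_monotone_0_pi) auto
    next
      case False
      have "cos (2 * pi - x) < cos (pi / real n)"
        using x n_pos False by (intro cos_monotone_0_pi) auto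
      then show ?thesis by (simp add: cos_diff)
    qed
    then show ?thesis by (simp add: x_def)
  qed auto
  then show "cos (pi * (2 * real_of_int k - 1) / real n) \<le> cos (pi / real n)"
    unfolding eq by (auto simp: field_simps minus_divide_left[symmetric])
  assume "cos (pi * (2 * real_of_int k - 1) / real n) = cos (pi / real n)"
  with main eq have "r = 0 \<or> r = 1" by auto
  then show "int n dvd k \<or> int n dvd k - 1"
    unfolding r_def by (metis dvd_eq_mod_eq_0 mod_eq_dvd_iff mod_0_imp_dvd n3 mod_pos_pos_trivial of_nat_0_le_iff zle_int zero_le_one less_le_trans numeral_One of_nat_numeral r(2) r_def)
qed

lemma inner_normal_vertex:
  "inner (edge_normal n j) (vertex n i) \<le> cos (pi / real n)"
  "inner (edge_normal n j) (vertex n j) = cos (pi / real n)"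
  "inner (edge_normal n j) (vertex n (j + 1)) = cos (pi / real n)"
  "inner (edge_normal n j) (vertex n i) = cos (pi / real n) \<Longrightarrow>
     vertex n i = vertex n j \<or> vertex n i = vertex n (j + 1)"
proof -
  have "2 * pi * (real_of_int j + 1 / 2) / real n - 2 * pi * real_of_int i / real n
      = - (pi * (2 * real_of_int (i - j) - 1) / real n)" for i
    using n_pos by (simp add: field_simps)
  then have *: "inner (edge_normal n j) (vertex n i) = cos (pi * (2 * real_of_int (i - j) - 1) / real n)" for i
    unfolding edge_normal_def vertex_def inner_cis by (simp only: cos_minus)
  show "inner (edge_normal n j) (vertex n i) \<le> cos (pi / real n)"
    unfolding * by (rule cos_odd_multiple)
  show "inner (edge_normal n j) (vertex n j) = cos (pi / real n)"
    "inner (edge_normal n j) (vertex n (j + 1)) = cos (pi / real n)"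
    unfolding * by (auto simp: minus_divide_left[symmetric])
  show "vertex n i = vertex n j \<or> vertex n i = vertex n (j + 1)"
    if "inner (edge_normal n j) (vertex n i) = cos (pi / real n)"
    using cos_odd_multiple(2)[OF that[unfolded *]] by (simp add: vertex_eq_iff algebra_simps)
qed

lemma inner_normal_combination:
  "inner (edge_normal n j) (a *\<^sub>R vertex n j + b *\<^sub>R vertex n (j + 1)) = (a + b) * cos (pi / real n)"
  by (simp add: inner_add_right inner_normal_vertex distrib_right)

lemma inner_normal_combination_le:
  assumes "a \<ge> 0" "b \<ge> 0"
  shows "inner (edge_normal n j) (a *\<^sub>R vertex n i + b *\<^sub>R vertex n k) \<le> (a + b) * cos (pi / real n)"
proof -
  have "a * inner (edge_normal n j) (vertex n i) \<le> a * cos (pi / real n)"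
    "b * inner (edge_normal n j) (vertex n k) \<le> b * cos (pi / real n)"
    using assms inner_normal_vertex(1) by (intro mult_left_mono; simp)+
  then show ?thesis by (simp add: inner_add_right algebra_simps)
qed

text \<open>Polar coordinates measured in units of the angle between adjacent vertices: between
  \<open>i\<close> and \<open>i + 1\<close> the direction is a nonnegative combination of the two
  vertices, by the sine rule.\<close>

lemma sector:
  assumes "real_of_int i \<le> t" "t \<le> real_of_int i + 1"
  obtains a b where "a \<ge> 0" "b \<ge> 0" "t < real_of_int i + 1 \<Longrightarrow> a > 0" "t > real_of_int i \<Longrightarrow> b > 0"
    "cis (2 * pi * t / real n) = a *\<^sub>R vertex n i + b *\<^sub>R vertex n (i + 1)"
proof -
  define s where "s = sin (2 * pi / real n)"
  have s: "s > 0" unfolding s_def using n3 by (intro sin_gt_zero) (auto simp: field_simps)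
  define \<alpha> where "\<alpha> = 2 * pi * real_of_int i / real n"
  define \<beta> where "\<beta> = 2 * pi * real_of_int (i + 1) / real n"
  define \<theta> where "\<theta> = 2 * pi * t / real n"
  have sb: "sin (\<beta> - \<alpha>) = s" by (simp add: s_def \<alpha>_def \<beta>_def diff_divide_distrib[symmetric] algebra_simps)
  have d1: "\<beta> - \<theta> = 2 * pi * (real_of_int i + 1 - t) / real n" "\<theta> - \<alpha> = 2 * pi * (t - real_of_int i) / real n"
    by (simp_all add: \<alpha>_def \<beta>_def \<theta>_def diff_divide_distrib[symmetric] algebra_simps)
  have small: "2 * pi * u / real n < pi" if "u \<le> 1" for u
  proof -
    have "2 * u < real n" using that n3 by linarith
    then show ?thesis using n_pos by (simp add: field_simps)
  qed
  have pos: "sin (2 * pi * u / real n) > 0" if "u > 0" "u \<le> 1" for u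
    using that n_pos small by (intro sin_gt_zero) auto
  have nn: "sin (2 * pi * u / real n) \<ge> 0" if "u \<ge> 0" "u \<le> 1" for u
    using pos[of u] that by (cases "u = 0") auto
  show ?thesis
  proof (rule that[of "sin (\<beta> - \<theta>) / s" "sin (\<theta> - \<alpha>) / s"])
    show "sin (\<beta> - \<theta>) / s \<ge> 0" "sin (\<theta> - \<alpha>) / s \<ge> 0"
      unfolding d1 using assms s nn by auto
    show "t < real_of_int i + 1 \<Longrightarrow> sin (\<beta> - \<theta>) / s > 0" "t > real_of_int i \<Longrightarrow> sin (\<theta> - \<alpha>) / s > 0"
      unfolding d1 using assms s pos by auto
    have "cis \<theta> = (1 / s) *\<^sub>R (s *\<^sub>R cis \<theta>)" using s by simp
    also have "s *\<^sub>R cis \<theta> = sin (\<beta> - \<theta>) *\<^sub>R cis \<alpha> + sin (\<theta> - \<alpha>) *\<^sub>R cis \<beta>"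
      using sin_times_cis[of \<beta> \<alpha> \<theta>] sb by simp
    finally show "cis (2 * pi * t / real n) =
        (sin (\<beta> - \<theta>) / s) *\<^sub>R vertex n i + (sin (\<theta> - \<alpha>) / s) *\<^sub>R vertex n (i + 1)"
      unfolding vertex_def \<theta>_def[symmetric] \<alpha>_def[symmetric] \<beta>_def[symmetric]
      by (simp add: scaleR_add_right divide_inverse mult.commute)
  qed
qed

lemma polar_angle: obtains t where "p = norm p *\<^sub>R cis (2 * pi * t / real n)"
proof (cases "p = 0")
  case False
  have "p = norm p *\<^sub>R cis (Arg p)"
    using False by (simp add: cis_Arg sgn_div_norm)
  moreover have "2 * pi * (Arg p * real n / (2 * pi)) / real n = Arg p" using n_pos by simp
  ultimately show ?thesis using that by metis
qed (use that[of 0] in simp)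

lemma in_some_sector:
  obtains i a b where "a \<ge> 0" "b \<ge> 0" "p = a *\<^sub>R vertex n i + b *\<^sub>R vertex n (i + 1)"
proof -
  obtain t where t: "p = norm p *\<^sub>R cis (2 * pi * t / real n)" by (rule polar_angle)
  have f: "real_of_int \<lfloor>t\<rfloor> \<le> t" "t \<le> real_of_int \<lfloor>t\<rfloor> + 1" by linarith+
  obtain a b where ab: "a \<ge> 0" "b \<ge> 0"
    "cis (2 * pi * t / real n) = a *\<^sub>R vertex n \<lfloor>t\<rfloor> + b *\<^sub>R vertex n (\<lfloor>t\<rfloor> + 1)"
    using sector[OF f] by metis
  show ?thesis
  proof (rule that[of "norm p * a" "norm p * b" "\<lfloor>t\<rfloor>"])
    show "p = (norm p * a) *\<^sub>R vertex n \<lfloor>t\<rfloor> + (norm p * b) *\<^sub>R vertex n (\<lfloor>t\<rfloor> + 1)"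
      by (subst t, subst ab(3)) (simp add: scaleR_add_right)
  qed (use ab in auto)
qed

lemma vertex_in_polygon: "vertex n i \<in> polygon n"
  unfolding polygon_def by (intro hull_inc) auto

lemma convex_polygon: "convex (polygon n)"
  by (simp add: polygon_def)

text \<open>The point opposite to vertex \<open>0\<close> lies in some sector, which makes
  \<open>0\<close> a convex combination of vertex \<open>0\<close> and the two vertices of that
  sector.\<close>

lemma zero_in_polygon: "0 \<in> polygon n"
proof -
  obtain i a b where ab: "a \<ge> 0" "b \<ge> 0" "- vertex n 0 = a *\<^sub>R vertex n i + b *\<^sub>R vertex n (i + 1)"
    by (rule in_some_sector)
  define c where "c = 1 + a + b"
  have "c > 0" using ab by (simp add: c_def)
  have "(1 / c) *\<^sub>R vertex n 0 + (a / c) *\<^sub>R vertex n i + (b / c) *\<^sub>R vertex n (i + 1) \<in> polygon n"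
    using ab \<open>c > 0\<close>
    by (intro convex_combination3 convex_polygon vertex_in_polygon) (auto simp: c_def add_divide_distrib[symmetric])
  also have "(1 / c) *\<^sub>R vertex n 0 + (a / c) *\<^sub>R vertex n i + (b / c) *\<^sub>R vertex n (i + 1)
      = (1 / c) *\<^sub>R (vertex n 0 + (a *\<^sub>R vertex n i + b *\<^sub>R vertex n (i + 1)))"
    by (simp add: scaleR_add_right)
  also have "\<dots> = 0" using ab(3) by (simp flip: ab(3))
  finally show ?thesis .
qed

lemma combination_in_polygon:
  assumes "a \<ge> 0" "b \<ge> 0" "a + b \<le> 1"
  shows "a *\<^sub>R vertex n i + b *\<^sub>R vertex n j \<in> polygon n"
  using convex_combination3[OF convex_polygon vertex_in_polygon[of i] vertex_in_polygon[of j] zero_in_polygon,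
      of a b "1 - a - b"] assms by simp

lemma polygon_iff: "p \<in> polygon n \<longleftrightarrow> (\<forall>j. inner (edge_normal n j) p \<le> cos (pi / real n))"
proof
  assume "p \<in> polygon n"
  then show "\<forall>j. inner (edge_normal n j) p \<le> cos (pi / real n)"
  proof -
    have "polygon n \<subseteq> {p. inner (edge_normal n j) p \<le> cos (pi / real n)}" for j
      unfolding polygon_def
      by (intro hull_minimal convex_halfspace_le) (auto simp: inner_normal_vertex)
    then show ?thesis using \<open>p \<in> polygon n\<close> by blast
  qed
next
  assume *: "\<forall>j. inner (edge_normal n j) p \<le> cos (pi / real n)"
  obtain i a b where ab: "a \<ge> 0" "b \<ge> 0" "p = a *\<^sub>R vertex n i + b *\<^sub>R vertex n (i + 1)"
    by (rule in_some_sector)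
  have "(a + b) * cos (pi / real n) \<le> 1 * cos (pi / real n)"
    using * inner_normal_combination[of i a b] ab(3) by (metis mult_1)
  then have "a + b \<le> 1" using cos_pi_n_pos by simp
  then show "p \<in> polygon n" unfolding ab(3) using ab by (intro combination_in_polygon)
qed

lemma compact_polygon: "compact (polygon n)"
proof -
  have "range (vertex n) \<subseteq> vertex n ` {0..<int n}"
  proof
    fix x assume "x \<in> range (vertex n)"
    then obtain i where "x = vertex n (i mod int n)" using periodic_mod[OF periodic_vertex] by auto
    then show "x \<in> vertex n ` {0..<int n}" using n_pos by auto
  qed
  then show ?thesis unfolding polygon_def
    by (intro finite_imp_compact_convex_hull) (auto intro: finite_subset)
qed

lemma edge_normal_periodic: "periodic n (edge_normal n)"
proof -
  have "2 * pi * (real_of_int (i + int n) + 1 / 2) / real n = 2 * pi * (real_of_int i + 1 / 2) / real n + 2 * pi"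
    for i using n_pos by (simp add: field_simps)
  then show ?thesis by (simp add: periodic_def edge_normal_def flip: cis_mult)
qed

lemma interior_polygon_iff:
  "p \<in> interior (polygon n) \<longleftrightarrow> (\<forall>j. inner (edge_normal n j) p < cos (pi / real n))"
proof
  assume p: "p \<in> interior (polygon n)"
  have "interior (polygon n) \<subseteq> {p. inner (edge_normal n j) p < cos (pi / real n)}" for j
  proof -
    have "edge_normal n j \<noteq> 0" by (simp add: edge_normal_def)
    then have "{p. inner (edge_normal n j) p < cos (pi / real n)}
        = interior {p. inner (edge_normal n j) p \<le> cos (pi / real n)}" by simp
    moreover have "polygon n \<subseteq> {p. inner (edge_normal n j) p \<le> cos (pi / real n)}"
      by (auto simp: polygon_iff)
    ultimately show ?thesis using interior_mono by metis
  qed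
  then show "\<forall>j. inner (edge_normal n j) p < cos (pi / real n)" using p by blast
next
  assume *: "\<forall>j. inner (edge_normal n j) p < cos (pi / real n)"
  define Q where "Q = (\<Inter>j\<in>{0..<int n}. {p. inner (edge_normal n j) p < cos (pi / real n)})"
  have "open Q" unfolding Q_def by (intro open_INT ballI open_halfspace_lt) auto
  moreover have "Q \<subseteq> polygon n"
  proof
    fix q assume q: "q \<in> Q"
    have "inner (edge_normal n j) q \<le> cos (pi / real n)" for j
    proof -
      have "inner (edge_normal n (j mod int n)) q < cos (pi / real n)"
        using q n_pos by (auto simp: Q_def)
      then show ?thesis using periodic_mod[OF edge_normal_periodic] by simp
    qed
    then show "q \<in> polygon n" by (simp add: polygon_iff)
  qed
  moreover have "p \<in> Q" using * by (auto simp: Q_def)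
  ultimately show "p \<in> interior (polygon n)" by (meson interiorI)
qed

lemma interior_combination:
  assumes "a \<ge> 0" "b \<ge> 0" "a + b < 1"
  shows "a *\<^sub>R vertex n i + b *\<^sub>R vertex n j \<in> interior (polygon n)"
  unfolding interior_polygon_iff
proof
  fix k
  have "(a + b) * cos (pi / real n) < 1 * cos (pi / real n)"
    using assms cos_pi_n_pos by (intro mult_strict_right_mono)
  then show "inner (edge_normal n k) (a *\<^sub>R vertex n i + b *\<^sub>R vertex n j) < cos (pi / real n)"
    using inner_normal_combination_le[OF assms(1,2), of k i j] by linarith
qed

lemma scale_in_interior:
  assumes "p \<in> polygon n" "0 \<le> t" "t < 1"
  shows "t *\<^sub>R p \<in> interior (polygon n)"
  unfolding interior_polygon_iff
proof
  fix j
  have "t * inner (edge_normal n j) p \<le> t * cos (pi / real n)"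
    using assms polygon_iff by (intro mult_left_mono) auto
  also have "\<dots> < 1 * cos (pi / real n)" using assms cos_pi_n_pos by (intro mult_strict_right_mono)
  finally show "inner (edge_normal n j) (t *\<^sub>R p) < cos (pi / real n)" by simp
qed

lemma edge_iff:
  "p \<in> edge n i \<longleftrightarrow> (\<exists>a b. a \<ge> 0 \<and> b \<ge> 0 \<and> a + b = 1 \<and> p = a *\<^sub>R vertex n i + b *\<^sub>R vertex n (i + 1))"
  unfolding closed_segment_def by (auto intro: exI[of _ "1 - _"]) (metis add_diff_cancel_left' le_add_same_cancel1 diff_add_cancel)+

lemma edge_normal_on_edge: "p \<in> edge n i \<Longrightarrow> inner (edge_normal n i) p = cos (pi / real n)"
  unfolding edge_iff using inner_normal_combination by (metis mult_1)

lemma edge_subset_polygon: "edge n i \<subseteq> polygon n"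
  by (intro closed_segment_subset convex_polygon vertex_in_polygon)

lemma edge_not_interior: "p \<in> edge n i \<Longrightarrow> p \<notin> interior (polygon n)"
  using edge_normal_on_edge[of p i] unfolding interior_polygon_iff by (metis less_irrefl)

lemma boundary_in_edge:
  assumes "p \<in> polygon n" "p \<notin> interior (polygon n)"
  obtains i where "p \<in> edge n i"
proof -
  obtain i a b where ab: "a \<ge> 0" "b \<ge> 0" "p = a *\<^sub>R vertex n i + b *\<^sub>R vertex n (i + 1)"
    by (rule in_some_sector)
  have "(a + b) * cos (pi / real n) \<le> 1 * cos (pi / real n)"
    using assms(1) inner_normal_combination[of i a b] ab(3) by (metis mult_1 polygon_iff)
  then have "a + b \<le> 1" using cos_pi_n_pos by simp
  moreover have "\<not> a + b < 1" using interior_combination[OF ab(1,2)] assms(2) ab(3) by blast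
  ultimately have "p \<in> edge n i" unfolding edge_iff using ab by (intro exI[of _ a] exI[of _ b]) auto
  then show ?thesis by (rule that)
qed

lemma edge_periodic: "int n dvd i - j \<Longrightarrow> edge n i = edge n j"
  using vertex_eq_iff[of i j] vertex_shift[of i j 1] by simp

text \<open>A convex combination of two vertices attains the maximum of a linear function only
  if each vertex with a positive coefficient attains it; by \<open>cos_odd_multiple\<close> these
  are the end points of one edge.\<close>

lemma edges_meet:
  assumes "p \<in> edge n i" "p \<in> edge n j"
  shows "int n dvd i - j \<or> int n dvd i - (j + 1) \<and> p = vertex n i \<or> int n dvd j - (i + 1) \<and> p = vertex n j"
proof -
  obtain a b where ab: "a \<ge> 0" "b \<ge> 0" "a + b = 1" "p = a *\<^sub>R vertex n i + b *\<^sub>R vertex n (i + 1)"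
    using assms(1) unfolding edge_iff by blast
  let ?c = "cos (pi / real n)" and ?L = "\<lambda>k. inner (edge_normal n j) (vertex n k)"
  have eq: "a * ?L i + b * ?L (i + 1) = ?c"
    using edge_normal_on_edge[OF assms(2)] unfolding ab(4) by (simp add: inner_add_right)
  have le: "a * ?L i \<le> a * ?c" "b * ?L (i + 1) \<le> b * ?c"
    using ab inner_normal_vertex(1) by (intro mult_left_mono; simp)+
  have sum: "a * ?c + b * ?c = ?c" using ab(3) by (simp flip: distrib_right)
  have "a * ?L i = a * ?c" "b * ?L (i + 1) = b * ?c" using eq le sum by linarith+
  then have A: "a = 0 \<or> vertex n i = vertex n j \<or> vertex n i = vertex n (j + 1)"
    and B: "b = 0 \<or> vertex n (i + 1) = vertex n j \<or> vertex n (i + 1) = vertex n (j + 1)"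
    using inner_normal_vertex(4) by auto
  have nd: "\<not> int n dvd 2" using n3 by (auto dest: zdvd_imp_le)
  show ?thesis
  proof (cases "int n dvd i - j")
    case False
    then have A': "a = 0 \<or> int n dvd i - (j + 1)" and B': "b = 0 \<or> int n dvd i + 1 - j"
      using A B by (auto simp: vertex_eq_iff)
    have "\<not> (int n dvd i - (j + 1) \<and> int n dvd i + 1 - j)"
    proof
      assume h: "int n dvd i - (j + 1) \<and> int n dvd i + 1 - j"
      show False using dvd_diff[OF conjunct2[OF h] conjunct1[OF h]] nd by simp
    qed
    then have "b = 0 \<and> a = 1 \<and> int n dvd i - (j + 1) \<or> a = 0 \<and> b = 1 \<and> int n dvd i + 1 - j"
      using A' B' ab(3) by argo
    then show ?thesis
    proof
      assume "a = 0 \<and> b = 1 \<and> int n dvd i + 1 - j"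
      then have "int n dvd j - (i + 1)" "p = vertex n j" 
        using ab(4) vertex_eq_iff[of "i + 1" j] by (auto simp: dvd_diff_commute)
      then show ?thesis by blast
    qed (use ab(4) in auto)
  qed auto
qed

lemma rel_interior_tri_simplex:
  assumes "S \<subseteq> {0, vertex n k, vertex n (k + 1)}"
  shows "p \<in> rel_interior (convex hull S) \<longleftrightarrow>
    (\<exists>a b. p = a *\<^sub>R vertex n k + b *\<^sub>R vertex n (k + 1) \<and>
       (if vertex n k \<in> S then a > 0 else a = 0) \<and>
       (if vertex n (k + 1) \<in> S then b > 0 else b = 0) \<and>
       (if 0 \<in> S then a + b < 1 else a + b = 1))" (is "?l \<longleftrightarrow> ?r")
proof -
  let ?T = "{0, vertex n k, vertex n (k + 1)}"
  have fin: "finite S" using assms finite_subset by blast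
  have sumT: "sum f S = (\<Sum>x\<in>?T. if x \<in> S then f x else 0)" for f :: "complex \<Rightarrow> 'b::comm_monoid_add"
    using assms by (intro sum.mono_neutral_cong_left) auto
  have expand: "sum f S = (if 0 \<in> S then f 0 else 0) + ((if vertex n k \<in> S then f (vertex n k) else 0) +
      (if vertex n (k + 1) \<in> S then f (vertex n (k + 1)) else 0))" for f :: "complex \<Rightarrow> 'b::comm_monoid_add"
    unfolding sumT using vertex_neq_next[of k] by simp
  show ?thesis
  proof
    assume ?l
    then obtain u where u: "\<forall>x\<in>S. 0 < u x" "sum u S = 1" "(\<Sum>x\<in>S. u x *\<^sub>R x) = p"
      unfolding rel_interior_convex_hull_finite[OF fin] by blast
    define a where "a = (if vertex n k \<in> S then u (vertex n k) else 0)"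
    define b where "b = (if vertex n (k + 1) \<in> S then u (vertex n (k + 1)) else 0)"
    have p: "p = a *\<^sub>R vertex n k + b *\<^sub>R vertex n (k + 1)"
      using u(3) unfolding expand a_def b_def by auto
    have "(if 0 \<in> S then u 0 else 0) + (a + b) = 1" using u(2) unfolding expand a_def b_def .
    moreover have "if vertex n k \<in> S then a > 0 else a = 0" "if vertex n (k + 1) \<in> S then b > 0 else b = 0"
      using u(1) by (auto simp: a_def b_def)
    moreover have "0 \<in> S \<Longrightarrow> u 0 > 0" using u(1) by blast
    ultimately show ?r using p by (intro exI[where x = a] exI[where x = b] conjI) (auto split: if_splits)
  next
    assume ?r
    then obtain a b where ab: "p = a *\<^sub>R vertex n k + b *\<^sub>R vertex n (k + 1)"
       "if vertex n k \<in> S then a > 0 else a = 0" "if vertex n (k + 1) \<in> S then b > 0 else b = 0"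
       "if 0 \<in> S then a + b < 1 else a + b = 1" by blast
    define u where "u x = (if x = vertex n k then a else if x = vertex n (k + 1) then b else 1 - a - b)" for x
    have "\<forall>x\<in>S. 0 < u x" using assms ab by (auto simp: u_def split: if_splits)
    moreover have "sum u S = 1" "(\<Sum>x\<in>S. u x *\<^sub>R x) = p"
      unfolding expand using ab vertex_neq_next[of k] by (auto simp: u_def split: if_splits)
    ultimately show ?l unfolding rel_interior_convex_hull_finite[OF fin] by blast
  qed
qed

lemma star_vertex_iff:
  "p \<in> star n (vertex n i) \<longleftrightarrow>
     (\<exists>a b j. (j = i + 1 \<or> j = i - 1) \<and> a > 0 \<and> b \<ge> 0 \<and> a + b \<le> 1 \<and>
        p = a *\<^sub>R vertex n i + b *\<^sub>R vertex n j)" (is "?l \<longleftrightarrow> ?r")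
proof
  assume ?l
  then obtain S k where S: "S \<subseteq> {0, vertex n k, vertex n (k + 1)}" "vertex n i \<in> S"
    "p \<in> rel_interior (convex hull S)" unfolding star_def tri_simplices_def by auto
  obtain a b where ab: "p = a *\<^sub>R vertex n k + b *\<^sub>R vertex n (k + 1)"
     "if vertex n k \<in> S then a > 0 else a = 0" "if vertex n (k + 1) \<in> S then b > 0 else b = 0"
     "if 0 \<in> S then a + b < 1 else a + b = 1"
    using S(3) unfolding rel_interior_tri_simplex[OF S(1)] by blast
  have "vertex n i = vertex n k \<or> vertex n i = vertex n (k + 1)" using S(1,2) by auto
  then show ?r
  proof
    assume e: "vertex n i = vertex n k"
    then have "vertex n (i + 1) = vertex n (k + 1)" by (rule vertex_shift)
    then show ?r using e ab S(2) by (intro exI[of _ a] exI[of _ b] exI[of _ "i + 1"]) (auto split: if_splits)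
  next
    assume e: "vertex n i = vertex n (k + 1)"
    then have "vertex n (i - 1) = vertex n k" using vertex_shift[of i "k + 1" "- 1"] by simp
    then show ?r using e ab S(2)
      by (intro exI[of _ b] exI[of _ a] exI[of _ "i - 1"]) (auto simp: add.commute split: if_splits)
  qed
next
  assume ?r
  then obtain a b j where j: "j = i + 1 \<or> j = i - 1" and ab: "a > 0" "b \<ge> 0" "a + b \<le> 1"
    "p = a *\<^sub>R vertex n i + b *\<^sub>R vertex n j" by blast
  define S where "S = insert (vertex n i) ((if b > 0 then {vertex n j} else {}) \<union> (if a + b < 1 then {0} else {}))"
  have neq: "vertex n j \<noteq> vertex n i" using j vertex_neq_next(2)[of i] vertex_neq_next(1)[of "i - 1"] by auto
  define k where "k = (if j = i + 1 then i else i - 1)"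
  have k: "S \<subseteq> {0, vertex n k, vertex n (k + 1)}" using j by (auto simp: S_def k_def)
  have "p \<in> rel_interior (convex hull S)"
    unfolding rel_interior_tri_simplex[OF k]
  proof (cases "j = i + 1")
    case True
    then show "\<exists>a b. p = a *\<^sub>R vertex n k + b *\<^sub>R vertex n (k + 1) \<and>
       (if vertex n k \<in> S then a > 0 else a = 0) \<and>
       (if vertex n (k + 1) \<in> S then b > 0 else b = 0) \<and> (if 0 \<in> S then a + b < 1 else a + b = 1)"
      using ab neq by (intro exI[of _ a] exI[of _ b]) (auto simp: S_def k_def)
  next
    case False
    then have "j = i - 1" using j by simp
    then show "\<exists>a b. p = a *\<^sub>R vertex n k + b *\<^sub>R vertex n (k + 1) \<and>
       (if vertex n k \<in> S then a > 0 else a = 0) \<and>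
       (if vertex n (k + 1) \<in> S then b > 0 else b = 0) \<and> (if 0 \<in> S then a + b < 1 else a + b = 1)"
      using ab neq by (intro exI[of _ b] exI[of _ a]) (auto simp: S_def k_def)
  qed
  moreover have "S \<in> {S \<in> tri_simplices n. vertex n i \<in> S}"
    using k unfolding tri_simplices_def by (auto simp: S_def)
  ultimately show ?l unfolding star_def by blast
qed

lemma star_zero: "star n 0 = interior (polygon n)"
proof (intro set_eqI iffI)
  fix p assume "p \<in> star n 0"
  then obtain S k where S: "S \<subseteq> {0, vertex n k, vertex n (k + 1)}" "0 \<in> S"
    "p \<in> rel_interior (convex hull S)" unfolding star_def tri_simplices_def by auto
  then obtain a b where "p = a *\<^sub>R vertex n k + b *\<^sub>R vertex n (k + 1)" "a \<ge> 0" "b \<ge> 0" "a + b < 1"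
    unfolding rel_interior_tri_simplex[OF S(1)] by (metis less_eq_real_def)
  then show "p \<in> interior (polygon n)" using interior_combination by simp
next
  fix p assume p: "p \<in> interior (polygon n)"
  obtain k a b where ab: "a \<ge> 0" "b \<ge> 0" "p = a *\<^sub>R vertex n k + b *\<^sub>R vertex n (k + 1)"
    by (rule in_some_sector)
  have "(a + b) * cos (pi / real n) < 1 * cos (pi / real n)"
    using p inner_normal_combination[of k a b] ab(3) by (metis mult_1 interior_polygon_iff)
  then have lt: "a + b < 1" using cos_pi_n_pos by simp
  define S where "S = insert 0 ((if a > 0 then {vertex n k} else {}) \<union> (if b > 0 then {vertex n (k + 1)} else {}))"
  have k: "S \<subseteq> {0, vertex n k, vertex n (k + 1)}" by (auto simp: S_def)
  have "p \<in> rel_interior (convex hull S)" unfolding rel_interior_tri_simplex[OF k]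
    using ab lt vertex_neq_next[of k] by (intro exI[of _ a] exI[of _ b]) (auto simp: S_def)
  moreover have "S \<in> {S \<in> tri_simplices n. 0 \<in> S}"
    using k unfolding tri_simplices_def by (auto simp: S_def)
  ultimately show "p \<in> star n 0" unfolding star_def by blast
qed

text \<open>The star of a vertex is cut out of the polygon by an open cone around that vertex.
  This shows that it is open and stable under scaling. The cone need not be convex, as for
  \<open>n = 3\<close> its half angle is obtuse.\<close>

lemma star_vertex_cone:
  "star n (vertex n i) = polygon n \<inter> {p. cos (2 * pi / real n) * norm p < inner (vertex n i) p}"
proof (intro set_eqI iffI)
  let ?C = "cos (2 * pi / real n)"
  have C: "-1 < ?C" "?C < 1"
  proof -
    have "cos pi < ?C" "?C < cos 0"
      using n3 by (intro cos_monotone_0_pi; simp add: field_simps)+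
    then show "-1 < ?C" "?C < 1" by simp_all
  qed
  fix p assume "p \<in> star n (vertex n i)"
  then obtain a b j where j: "j = i + 1 \<or> j = i - 1" and ab: "a > 0" "b \<ge> 0" "a + b \<le> 1"
    "p = a *\<^sub>R vertex n i + b *\<^sub>R vertex n j" unfolding star_vertex_iff by blast
  have "inner (vertex n i) (vertex n j) = ?C"
  proof -
    have "2 * pi * real_of_int i / real n - 2 * pi * real_of_int (i + 1) / real n = - (2 * pi / real n)"
      "2 * pi * real_of_int i / real n - 2 * pi * real_of_int (i - 1) / real n = 2 * pi / real n"
      using n_pos by (simp_all add: field_simps)
    then show ?thesis using j unfolding vertex_def inner_cis by (auto simp only: cos_minus)
  qed
  moreover have "inner (vertex n i) (vertex n i) = 1" by (simp add: vertex_def inner_cis)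
  ultimately have ip: "inner (vertex n i) p = a + b * ?C" by (simp add: ab(4) inner_add_right)
  have nv: "norm (vertex n k) = 1" for k by (simp add: vertex_def)
  have "?C * norm p < a + b * ?C"
  proof (cases "?C \<ge> 0")
    case True
    have "norm p \<le> a + b" unfolding ab(4)
      using ab by (intro norm_triangle_le) (auto simp: nv)
    then have "?C * norm p \<le> ?C * (a + b)" using True by (intro mult_left_mono)
    also have "\<dots> < a + b * ?C" using C ab(1) by (simp add: algebra_simps)
    finally show ?thesis .
  next
    case False
    have "norm (b *\<^sub>R vertex n j) \<le> norm p + norm (a *\<^sub>R vertex n i)"
      unfolding ab(4) using norm_triangle_ineq4[of "a *\<^sub>R vertex n i + b *\<^sub>R vertex n j" "a *\<^sub>R vertex n i"] by simp
    then have "b - a \<le> norm p" using ab by (simp add: nv)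
    then have "?C * norm p \<le> ?C * (b - a)" using False by (intro mult_left_mono_neg) auto
    also have "\<dots> < a + b * ?C"
    proof -
      have "- ?C * a < 1 * a" using C ab(1) by (intro mult_strict_right_mono) auto
      then show ?thesis by (simp add: algebra_simps)
    qed
    finally show ?thesis .
  qed
  then show "p \<in> polygon n \<inter> {p. ?C * norm p < inner (vertex n i) p}"
    using combination_in_polygon[of a b i j] ab ip by auto
next
  let ?C = "cos (2 * pi / real n)"
  fix p assume "p \<in> polygon n \<inter> {p. ?C * norm p < inner (vertex n i) p}"
  then have p: "p \<in> polygon n" "?C * norm p < inner (vertex n i) p" by auto
  then have "p \<noteq> 0" by auto
  then have np: "norm p > 0" by simp
  obtain t where t: "p = norm p *\<^sub>R cis (2 * pi * t / real n)" by (rule polar_angle)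
  \<comment> \<open>the angle relative to vertex \<open>i\<close> is reduced to the range from \<open>- pi\<close> to \<open>pi\<close>, where the cosine is monotone in the absolute value\<close>
  define m where "m = round ((t - real_of_int i) / real n)"
  define s where "s = t - real_of_int i - real_of_int m * real n"
  have sm: "\<bar>s\<bar> \<le> real n / 2"
  proof -
    have "\<bar>real_of_int m - (t - real_of_int i) / real n\<bar> \<le> 1 / 2"
      unfolding m_def by (rule of_int_round_abs_le)
    then have "\<bar>(t - real_of_int i) / real n - real_of_int m\<bar> * real n \<le> 1 / 2 * real n"
      using n_pos by (intro mult_right_mono) (auto simp: abs_minus_commute)
    also have "\<bar>(t - real_of_int i) / real n - real_of_int m\<bar> * real n
        = \<bar>((t - real_of_int i) / real n - real_of_int m) * real n\<bar>" by (simp add: abs_mult)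
    also have "((t - real_of_int i) / real n - real_of_int m) * real n = s"
      using n_pos by (simp add: s_def field_simps)
    finally show ?thesis by simp
  qed
  have "2 * pi * t / real n = 2 * pi * (real_of_int i + s) / real n + 2 * pi * real_of_int m"
    using n_pos by (simp add: s_def field_simps)
  then have "cis (2 * pi * t / real n) = cis (2 * pi * (real_of_int i + s) / real n)"
    by (simp add: cis_multiple_2pi flip: cis_mult)
  then have t': "p = norm p *\<^sub>R cis (2 * pi * (real_of_int i + s) / real n)" using t by simp
  have "inner (vertex n i) p = norm p * inner (vertex n i) (cis (2 * pi * (real_of_int i + s) / real n))"
    by (subst t') simp
  also have "inner (vertex n i) (cis (2 * pi * (real_of_int i + s) / real n)) = cos (2 * pi * s / real n)"
  proof -
    have "2 * pi * real_of_int i / real n - 2 * pi * (real_of_int i + s) / real n = - (2 * pi * s / real n)"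
      using n_pos by (simp add: field_simps)
    then show ?thesis unfolding vertex_def inner_cis by (simp only: cos_minus)
  qed
  finally have "norm p * ?C < norm p * cos (2 * pi * s / real n)" using p(2) by (simp add: mult.commute)
  then have "?C < cos (2 * pi * s / real n)" using np by simp
  also have "cos (2 * pi * s / real n) = cos (2 * pi * \<bar>s\<bar> / real n)" by (simp add: abs_if)
  finally have c: "?C < cos (2 * pi * \<bar>s\<bar> / real n)" .
  have s1: "\<bar>s\<bar> < 1"
  proof (rule ccontr)
    assume "\<not> \<bar>s\<bar> < 1"
    then have "cos (2 * pi * \<bar>s\<bar> / real n) \<le> ?C"
      using n3 sm by (intro cos_monotone_0_pi_le) (auto simp: field_simps)
    then show False using c by simp
  qed
  have key: "a + b \<le> 1" if "a \<ge> 0" "b \<ge> 0" "p = a *\<^sub>R vertex n k + b *\<^sub>R vertex n (k + 1)" for a b k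
  proof -
    have "(a + b) * cos (pi / real n) \<le> 1 * cos (pi / real n)"
      using p(1) inner_normal_combination[of k a b] that(3) by (metis mult_1 polygon_iff)
    then show ?thesis using cos_pi_n_pos by simp
  qed
  show "p \<in> star n (vertex n i)"
  proof (cases "s \<ge> 0")
    case True
    have st: "real_of_int i \<le> real_of_int i + s" "real_of_int i + s \<le> real_of_int i + 1" using True s1 by auto
    obtain a b where ab: "a \<ge> 0" "b \<ge> 0" "real_of_int i + s < real_of_int i + 1 \<Longrightarrow> a > 0"
      "cis (2 * pi * (real_of_int i + s) / real n) = a *\<^sub>R vertex n i + b *\<^sub>R vertex n (i + 1)"
      by (rule sector[OF st]) (rule that)
    have p': "p = (norm p * a) *\<^sub>R vertex n i + (norm p * b) *\<^sub>R vertex n (i + 1)"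
      by (subst t', subst ab(4)) (simp add: scaleR_add_right)
    show ?thesis unfolding star_vertex_iff
      using p' ab key[OF _ _ p'] s1 np
      by (intro exI[of _ "norm p * a"] exI[of _ "norm p * b"] exI[of _ "i + 1"]) auto
  next
    case False
    have st: "real_of_int (i - 1) \<le> real_of_int i + s" "real_of_int i + s \<le> real_of_int (i - 1) + 1"
      using False s1 by auto
    obtain a b where ab: "a \<ge> 0" "b \<ge> 0" "real_of_int i + s > real_of_int (i - 1) \<Longrightarrow> b > 0"
      "cis (2 * pi * (real_of_int i + s) / real n) = a *\<^sub>R vertex n (i - 1) + b *\<^sub>R vertex n (i - 1 + 1)"
      by (rule sector[OF st]) (rule that)
    have p': "p = (norm p * a) *\<^sub>R vertex n (i - 1) + (norm p * b) *\<^sub>R vertex n (i - 1 + 1)"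
      by (subst t', subst ab(4)) (simp add: scaleR_add_right)
    show ?thesis unfolding star_vertex_iff
      using p' ab key[OF _ _ p'] s1 np
      by (intro exI[of _ "norm p * b"] exI[of _ "norm p * a"] exI[of _ "i - 1"]) (auto simp: add.commute)
  qed
qed

lemma star_subset_polygon: "x \<in> tri_vertices n \<Longrightarrow> star n x \<subseteq> polygon n"
  using interior_subset[of "polygon n"] by (auto simp: tri_vertices_def star_zero star_vertex_cone)

lemma open_cover_star: "open_cover (polygon n) (tri_vertices n) (star n)"
  unfolding open_cover_def
proof (intro conjI ballI equalityI)
  fix x assume x: "x \<in> tri_vertices n"
  show "openin (top_of_set (polygon n)) (star n x)"
  proof (cases "x = 0")
    case True
    have "interior (polygon n) = polygon n \<inter> interior (polygon n)" using interior_subset by blast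
    then show ?thesis unfolding True star_zero by (metis open_interior openin_open_Int)
  next
    case False
    then obtain i where x: "x = vertex n i" using x by (auto simp: tri_vertices_def)
    have "open {p. cos (2 * pi / real n) * norm p < inner (vertex n i) p}"
      by (intro open_Collect_less continuous_intros)
    then show ?thesis unfolding x star_vertex_cone by (rule openin_open_Int)
  qed
next
  show "(\<Union>x\<in>tri_vertices n. star n x) \<subseteq> polygon n" using star_subset_polygon by blast
  show "polygon n \<subseteq> (\<Union>x\<in>tri_vertices n. star n x)"
  proof
    fix p assume p: "p \<in> polygon n"
    show "p \<in> (\<Union>x\<in>tri_vertices n. star n x)"
    proof (cases "p \<in> interior (polygon n)")
      case True
      then show ?thesis by (auto simp: tri_vertices_def star_zero)
    next
      case False
      then obtain i where "p \<in> edge n i" using boundary_in_edge p by blast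
      then obtain a b where ab: "a \<ge> 0" "b \<ge> 0" "a + b = 1" "p = a *\<^sub>R vertex n i + b *\<^sub>R vertex n (i + 1)"
        unfolding edge_iff by blast
      have "p \<in> star n (vertex n i) \<or> p \<in> star n (vertex n (i + 1))"
      proof (cases "a = 0")
        case True
        have "p \<in> star n (vertex n (i + 1))" unfolding star_vertex_iff
          using ab True by (intro exI[of _ 1] exI[of _ 0] exI[of _ "i + 1 + 1"]) auto
        then show ?thesis ..
      next
        case False
        then have "p \<in> star n (vertex n i)" unfolding star_vertex_iff
          using ab by (intro exI[of _ a] exI[of _ b] exI[of _ "i + 1"]) auto
        then show ?thesis ..
      qed
      then show ?thesis by (auto simp: tri_vertices_def)
    qed
  qed
qed

lemma star_scale:
  assumes "x \<in> tri_vertices n" "p \<in> star n x" "0 < t" "t \<le> 1"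
  shows "t *\<^sub>R p \<in> star n x"
proof (cases "x = 0")
  case True
  have "p \<in> polygon n" using star_subset_polygon assms by blast
  then show ?thesis using assms scale_in_interior[of p t] unfolding True star_zero by (cases "t = 1") auto
next
  case False
  then obtain i where x: "x = vertex n i" using assms(1) by (auto simp: tri_vertices_def)
  have "t *\<^sub>R p \<in> polygon n"
    using convexD[OF convex_polygon zero_in_polygon, of p "1 - t" t] assms star_subset_polygon by auto
  moreover have "t * (cos (2 * pi / real n) * norm p) < t * inner (vertex n i) p"
    using assms unfolding x star_vertex_cone by (intro mult_strict_left_mono) auto
  ultimately show ?thesis unfolding x star_vertex_cone using assms(3) by (simp add: algebra_simps)
qed

text \<open>On the boundary only the stars of the end points of an edge are present. This is the
  reason why cochains on the star cover reduce to values on edges and triangles.\<close>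

lemma edge_star:
  assumes "p \<in> edge n i" "x \<in> tri_vertices n" "p \<in> star n x"
  shows "x = vertex n i \<or> x = vertex n (i + 1)"
proof (cases "x = 0")
  case True
  then show ?thesis using assms edge_not_interior star_zero by auto
next
  case False
  then obtain k where x: "x = vertex n k" using assms(2) by (auto simp: tri_vertices_def)
  obtain a b j where ab: "a > 0" "b \<ge> 0" "a + b \<le> 1" "p = a *\<^sub>R vertex n k + b *\<^sub>R vertex n j"
    using assms(3) unfolding x star_vertex_iff by blast
  let ?c = "cos (pi / real n)" and ?L = "\<lambda>k. inner (edge_normal n i) (vertex n k)"
  have eq: "a * ?L k + b * ?L j = ?c"
    using edge_normal_on_edge[OF assms(1)] unfolding ab(4) by (simp add: inner_add_right)
  have le: "a * ?L k \<le> a * ?c" "b * ?L j \<le> b * ?c"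
    using ab inner_normal_vertex(1) by (intro mult_left_mono; simp)+
  have sum: "a * ?c + b * ?c \<le> 1 * ?c" using ab(3) cos_pi_n_pos
    by (simp only: distrib_right[symmetric]) (intro mult_right_mono, auto)
  have "a * ?L k = a * ?c" using eq le sum by linarith
  then show ?thesis using inner_normal_vertex(4) ab(1) unfolding x by auto
qed

lemma combination_in_star:
  assumes "a > 0" "b \<ge> 0" "a + b \<le> 1"
  shows "a *\<^sub>R vertex n i + b *\<^sub>R vertex n (i + 1) \<in> star n (vertex n i)"
    and "b *\<^sub>R vertex n i + a *\<^sub>R vertex n (i + 1) \<in> star n (vertex n (i + 1))"
proof -
  show "a *\<^sub>R vertex n i + b *\<^sub>R vertex n (i + 1) \<in> star n (vertex n i)"
    unfolding star_vertex_iff using assms by blast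
  have "b *\<^sub>R vertex n i + a *\<^sub>R vertex n (i + 1) = a *\<^sub>R vertex n (i + 1) + b *\<^sub>R vertex n (i + 1 - 1)"
    by simp
  then show "b *\<^sub>R vertex n i + a *\<^sub>R vertex n (i + 1) \<in> star n (vertex n (i + 1))"
    unfolding star_vertex_iff using assms by blast
qed

lemma vertex_in_star: "vertex n i \<in> star n (vertex n i)"
  using combination_in_star(1)[of 1 0 i] by simp

lemma half_edge_in_star:
  "closed_segment (vertex n i) (midpoint (vertex n i) (vertex n (i + 1))) \<subseteq> star n (vertex n i)"
  "closed_segment (vertex n (i + 1)) (midpoint (vertex n (i + 1)) (vertex n i)) \<subseteq> star n (vertex n (i + 1))"
proof -
  show "closed_segment (vertex n i) (midpoint (vertex n i) (vertex n (i + 1))) \<subseteq> star n (vertex n i)"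
  proof
    fix p assume "p \<in> closed_segment (vertex n i) (midpoint (vertex n i) (vertex n (i + 1)))"
    then obtain u where u: "0 \<le> u" "u \<le> 1 / 2" "p = (1 - u) *\<^sub>R vertex n i + u *\<^sub>R vertex n (i + 1)"
      by (rule closed_segment_midpoint)
    show "p \<in> star n (vertex n i)" unfolding u(3) by (rule combination_in_star(1)) (use u in auto)
  qed
  show "closed_segment (vertex n (i + 1)) (midpoint (vertex n (i + 1)) (vertex n i)) \<subseteq> star n (vertex n (i + 1))"
  proof
    fix p assume "p \<in> closed_segment (vertex n (i + 1)) (midpoint (vertex n (i + 1)) (vertex n i))"
    then obtain u where u: "0 \<le> u" "u \<le> 1 / 2" "p = (1 - u) *\<^sub>R vertex n (i + 1) + u *\<^sub>R vertex n i"
      by (rule closed_segment_midpoint)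
    show "p \<in> star n (vertex n (i + 1))" unfolding u(3)
      by (subst add.commute, rule combination_in_star(2)) (use u in auto)
  qed
qed

end

section \<open>The quadratic space of a cycle of Lagrangian subspaces\<close>

lemma int_shift_invariant:
  fixes f :: "int \<Rightarrow> 'a"
  assumes "\<And>i. f (i + 1) = f i"
  shows "f i = f 0"
proof (induction i rule: int_induct[where k = 0])
  case (step2 i)
  then show ?case using assms[of "i - 1"] by simp
qed (use assms in auto)

lemma sum_periodic_shift:
  fixes f :: "int \<Rightarrow> 'a::ab_group_add"
  assumes "periodic n f" "n > 0"
  shows "(\<Sum>i\<in>{0..<int n}. f (i + 1)) = (\<Sum>i\<in>{0..<int n}. f i)"
proof -
  have "(\<Sum>i\<in>{0..<int n}. f (i + 1)) = (\<Sum>i\<in>{1..<int n + 1}. f i)"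
    by (rule sum.reindex_bij_witness[of _ "\<lambda>i. i - 1" "\<lambda>i. i + 1"]) auto
  also have "{1..<int n + 1} = insert (int n) ({0..<int n} - {0})" using assms(2) by auto
  also have "sum f \<dots> = f (int n) + sum f ({0..<int n} - {0})" by (subst sum.insert) auto
  also have "f (int n) = f 0" using assms(1) unfolding periodic_def by (metis add_0)
  also have "f 0 + sum f ({0..<int n} - {0}) = sum f {0..<int n}"
    using assms(2) by (subst sum.remove[of _ 0]) auto
  finally show ?thesis .
qed

lemma sum_periodic_difference:
  fixes f :: "int \<Rightarrow> 'a::ab_group_add"
  assumes "periodic n f" "n > 0"
  shows "(\<Sum>i\<in>{0..<int n}. f (i + 1) - f i) = 0" "(\<Sum>i\<in>{0..<int n}. f (i - 1) - f i) = 0"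
proof -
  show "(\<Sum>i\<in>{0..<int n}. f (i + 1) - f i) = 0"
    using sum_periodic_shift[OF assms] by (simp add: sum_subtractf)
  have p: "periodic n (\<lambda>i. f (i - 1))"
    using assms(1) unfolding periodic_def by (metis add_diff_eq diff_add_eq)
  show "(\<Sum>i\<in>{0..<int n}. f (i - 1) - f i) = 0"
    using sum_periodic_shift[OF p assms(2)] by (simp add: sum_subtractf)
qed

text \<open>Partial sums are periodic because the sum over a period vanishes.\<close>

lemma antiderivative_exists:
  assumes "periodic n w" "n > 0" "(\<Sum>i\<in>{0..<int n}. w i) = 0"
  shows "\<exists>h. antiderivative n w h"
proof -
  define h where "h i = (\<Sum>j\<in>{0..i mod int n}. w j)" for i
  have "h i - h (i - 1) = w i" for i
  proof (cases "i mod int n = 0")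
    case True
    have "(i - 1) mod int n = (i mod int n - 1) mod int n" by (simp add: mod_diff_left_eq)
    also have "\<dots> = int n - 1" using True assms(2) by (simp add: zmod_minus1)
    finally have "(i - 1) mod int n = int n - 1" .
    moreover have "{0..int n - 1} = {0..<int n}" by auto
    ultimately have "h (i - 1) = 0" using assms(3) by (simp add: h_def)
    moreover have "h i = w i" using True periodic_mod[OF assms(1), of i] by (simp add: h_def)
    ultimately show ?thesis by simp
  next
    case False
    have r: "0 \<le> i mod int n" "i mod int n < int n" using assms(2) by auto
    have "(i - 1) mod int n = (i mod int n - 1) mod int n" by (simp add: mod_diff_left_eq)
    also have "\<dots> = i mod int n - 1" using False r by (intro mod_pos_pos_trivial) auto
    finally have *: "(i - 1) mod int n = i mod int n - 1" .
    have "{0..i mod int n} = insert (i mod int n) {0..i mod int n - 1}" using r by auto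
    then have "h i = w (i mod int n) + h (i - 1)" unfolding h_def * by simp
    then show ?thesis using periodic_mod[OF assms(1), of i] by simp
  qed
  moreover have "periodic n h" by (simp add: periodic_def h_def)
  ultimately show ?thesis unfolding antiderivative_def by blast
qed

lemma antiderivative_unique:
  assumes "antiderivative n w h" "antiderivative n w h'"
  shows "h i = h' i + (h 0 - h' 0)"
proof -
  have "h i - h' i = h 0 - h' 0"
  proof (rule int_shift_invariant[of "\<lambda>i. h i - h' i"])
    fix i
    have "h (i + 1) - h i = w (i + 1)" "h' (i + 1) - h' i = w (i + 1)"
      using assms unfolding antiderivative_def by (metis add_diff_cancel_right')+
    then show "h (i + 1) - h' (i + 1) = h i - h' i" by (simp add: algebra_simps)
  qed
  then show ?thesis by (simp add: algebra_simps)
qed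

locale symplectic_form =
  fixes smul :: "'f::field \<Rightarrow> 'v::ab_group_add \<Rightarrow> 'v" and B :: "'v \<Rightarrow> 'v \<Rightarrow> 'f"
  assumes symp: "symplectic_space smul B"
begin

lemma symplectic_vector_space: "vector_space smul"
  using symp finite_dimensional_vector_space.axioms(1) unfolding symplectic_space_def by blast

lemma symplectic_linear:
  "B v (x + y) = B v x + B v y" "B (x + y) v = B x v + B y v"
  "B v (smul a x) = a * B v x" "B (smul a x) v = a * B x v"
  using symp unfolding symplectic_space_def Vector_Spaces.linear_iff by auto

lemma symplectic_zero: "B v 0 = 0" "B 0 v = 0"
  by (metis symplectic_linear(1) add.right_neutral add_left_cancel)
    (metis symplectic_linear(2) add.right_neutral add_left_cancel)

lemma symplectic_minus: "B v (- x) = - B v x" "B (- x) v = - B x v"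
  using symplectic_linear(1)[of v x "- x"] symplectic_linear(2)[of x "- x" v]
  by (auto simp: symplectic_zero eq_neg_iff_add_eq_0 add.commute)

lemma symplectic_diff: "B v (x - y) = B v x - B v y" "B (x - y) v = B x v - B y v"
  using symplectic_linear(1)[of v x "- y"] symplectic_linear(2)[of x "- y" v]
  by (auto simp: symplectic_minus)

lemma symplectic_sum: "B (\<Sum>i\<in>A. f i) v = (\<Sum>i\<in>A. B (f i) v)"
  by (induction A rule: infinite_finite_induct) (auto simp: symplectic_zero symplectic_linear)

lemma symplectic_alternating: "B v v = 0"
  using symp unfolding symplectic_space_def by blast

lemma symplectic_antisym: "B v w = - B w v"
proof -
  have "B (v + w) (v + w) = (B v v + B w v) + (B v w + B w w)"
    by (simp only: symplectic_linear)
  then have "B v w + B w v = 0" by (simp add: symplectic_alternating add.commute)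
  then show ?thesis by (simp add: eq_neg_iff_add_eq_0)
qed

lemma symplectic_nondegenerate: "(\<And>w. B w v = 0) \<Longrightarrow> v = 0"
  using symp symplectic_antisym[of v] unfolding symplectic_space_def by simp

text \<open>The map that sends \<open>c\<close> to the vector with coordinates \<open>B e
  c\<close> in a basis is an injective endomorphism of a finite-dimensional space, hence
  surjective.\<close>

lemma functional_represented:
  assumes "Vector_Spaces.linear smul (*) g"
  shows "\<exists>c. \<forall>x. g x = B x c"
proof -
  obtain Bas where "finite_dimensional_vector_space smul Bas"
    using symp unfolding symplectic_space_def by blast
  then interpret V: finite_dimensional_vector_space smul Bas .
  define T where "T c = (\<Sum>e\<in>Bas. smul (B e c) e)" for c
  have coeff: "u e = u' e" if "(\<Sum>e\<in>Bas. smul (u e) e) = (\<Sum>e\<in>Bas. smul (u' e) e)" "e \<in> Bas" for u u' e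
  proof -
    have "(\<Sum>e\<in>Bas. smul (u e - u' e) e) = 0"
      using that(1) by (simp add: V.scale_left_diff_distrib sum_subtractf)
    then have "u e - u' e = 0"
      using V.independentD[OF V.independent_Basis V.finite_Basis order_refl _ that(2), of "\<lambda>e. u e - u' e"] by simp
    then show ?thesis by simp
  qed
  have on_basis: "f x = f' x" if "\<And>e. e \<in> Bas \<Longrightarrow> f e = f' e"
    "\<And>x y. f (x + y) = f x + f y" "\<And>a x. f (smul a x) = a * f x"
    "\<And>x y. f' (x + y) = f' x + f' y" "\<And>a x. f' (smul a x) = a * f' x" for f f' :: "'v \<Rightarrow> 'f" and x
  proof -
    have z: "f 0 = 0" "f' 0 = 0" 
      by (metis that(2) add.right_neutral add_left_cancel) (metis that(4) add.right_neutral add_left_cancel)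
    have "x \<in> V.span Bas" by (simp add: V.span_Basis)
    then show ?thesis
      by (induction rule: V.span_induct) (auto simp: V.subspace_def that z)
  qed
  have lin: "Vector_Spaces.linear smul smul T"
    unfolding Vector_Spaces.linear_iff T_def using V.vector_space_axioms
    by (auto simp: symplectic_linear V.scale_left_distrib sum.distrib V.scale_sum_right)
  have "inj T"
  proof (rule injI)
    fix c c' assume "T c = T c'"
    then have "B e c = B e c'" if "e \<in> Bas" for e 
      using coeff[of "\<lambda>e. B e c" "\<lambda>e. B e c'"] that unfolding T_def by blast
    then have "B x c = B x c'" for x
      by (rule on_basis) (auto simp: symplectic_linear)
    then have "c - c' = 0" by (intro symplectic_nondegenerate) (simp add: symplectic_diff)
    then show "c = c'" by simp
  qed
  then have "surj T" by (rule V.linear_inj_imp_surj[OF lin])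
  then obtain c where "T c = (\<Sum>e\<in>Bas. smul (g e) e)" by (metis surjD)
  then have "g e = B e c" if "e \<in> Bas" for e using coeff[of "g" "\<lambda>e. B e c", OF _ that] unfolding T_def by simp
  then have "g x = B x c" for x
    by (rule on_basis) (use assms in \<open>auto simp: symplectic_linear Vector_Spaces.linear_iff\<close>)
  then show ?thesis by blast
qed

text \<open>A linear form on \<open>\<Oplus> l i\<close> that vanishes on the families with sum
  zero factors through the sum. It is extended from the subspace of all sums to \<open>V\<close>
  by means of a basis, and represented by a vector.\<close>

lemma annihilator_of_sum_zero:
  fixes l :: "'i \<Rightarrow> 'v set"
  assumes "finite A" and sub: "\<And>i. i \<in> A \<Longrightarrow> module.subspace smul (l i)"
    and zero: "\<And>v. (\<And>i. i \<in> A \<Longrightarrow> v i \<in> l i) \<Longrightarrow> (\<Sum>i\<in>A. v i) = 0 \<Longrightarrow> (\<Sum>i\<in>A. B (v i) (h i)) = 0"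
  shows "\<exists>c. \<forall>i\<in>A. \<forall>x\<in>l i. B x (h i) = B x c"
proof -
  interpret V: vector_space smul by (rule symplectic_vector_space)
  interpret F: vector_space "(*) :: 'f \<Rightarrow> 'f \<Rightarrow> 'f" by unfold_locales (auto simp: algebra_simps)
  interpret VF: vector_space_pair smul "(*) :: 'f \<Rightarrow> 'f \<Rightarrow> 'f" ..
  define fam where "fam v \<longleftrightarrow> (\<forall>i\<in>A. v i \<in> l i)" for v
  define q where "q v = (\<Sum>i\<in>A. B (v i) (h i))" for v
  have fam: "fam (\<lambda>_. 0)" "fam v \<Longrightarrow> fam w \<Longrightarrow> fam (\<lambda>i. v i + w i)" "fam v \<Longrightarrow> fam (\<lambda>i. smul a (v i))" for v w a
    unfolding fam_def using sub V.subspace_0 V.subspace_add V.subspace_scale by blast+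
  have q: "q (\<lambda>_. 0) = 0" "q (\<lambda>i. v i + w i) = q v + q w" "q (\<lambda>i. smul a (v i)) = a * q v" for v w a
    by (simp_all add: q_def symplectic_zero symplectic_linear sum.distrib sum_distrib_left)
  define U where "U = {\<Sum>i\<in>A. v i | v. fam v}"
  obtain Bs where Bs: "Bs \<subseteq> U" "V.independent Bs" "U \<subseteq> V.span Bs"
    by (meson V.maximal_independent_subset)
  have "\<forall>e\<in>Bs. \<exists>v. fam v \<and> (\<Sum>i\<in>A. v i) = e" using Bs(1) unfolding U_def by blast
  then obtain w where w: "\<And>e. e \<in> Bs \<Longrightarrow> fam (w e)" "\<And>e. e \<in> Bs \<Longrightarrow> (\<Sum>i\<in>A. w e i) = e" by metis
  obtain g where g: "Vector_Spaces.linear smul (*) g" "\<And>e. e \<in> Bs \<Longrightarrow> g e = q (w e)"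
    using VF.linear_independent_extend[OF Bs(2), of "\<lambda>e. q (w e)"] by blast
  have glin: "g (x + y) = g x + g y" "g (smul a x) = a * g x" for x y a
    using g(1) unfolding Vector_Spaces.linear_iff by auto
  define G where "G = {x. \<exists>v. fam v \<and> (\<Sum>i\<in>A. v i) = x \<and> g x = q v}"
  have "V.subspace G" unfolding V.subspace_def
  proof (intro conjI ballI allI)
    have "g 0 = 0" by (metis glin(1) add.right_neutral add_left_cancel)
    then show "0 \<in> G" unfolding G_def using fam(1) q(1)
      by (intro CollectI exI[of _ "\<lambda>_. 0"]) simp
  next
    fix x y assume "x \<in> G" "y \<in> G"
    then obtain v v' where "fam v" "(\<Sum>i\<in>A. v i) = x" "g x = q v" "fam v'" "(\<Sum>i\<in>A. v' i) = y" "g y = q v'"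
      unfolding G_def by blast
    then show "x + y \<in> G" unfolding G_def
      by (auto intro!: exI[of _ "\<lambda>i. v i + v' i"] fam simp: q glin sum.distrib)
  next
    fix a x assume "x \<in> G"
    then obtain v where "fam v" "(\<Sum>i\<in>A. v i) = x" "g x = q v" unfolding G_def by blast
    then show "smul a x \<in> G" unfolding G_def
      by (auto intro!: exI[of _ "\<lambda>i. smul a (v i)"] fam simp: q glin V.scale_sum_right)
  qed
  moreover have "Bs \<subseteq> G" unfolding G_def using w g(2) by blast
  ultimately have "V.span Bs \<subseteq> G" by (intro V.span_minimal)
  have gq: "g (\<Sum>i\<in>A. v i) = q v" if "fam v" for v
  proof -
    have "(\<Sum>i\<in>A. v i) \<in> G" using Bs(3) \<open>V.span Bs \<subseteq> G\<close> that unfolding U_def by blast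
    then obtain v' where v': "fam v'" "(\<Sum>i\<in>A. v' i) = (\<Sum>i\<in>A. v i)" "g (\<Sum>i\<in>A. v i) = q v'"
      unfolding G_def by blast
    have "fam (\<lambda>i. v i + smul (-1) (v' i))" by (intro fam that v'(1))
    moreover have "(\<Sum>i\<in>A. v i + smul (-1) (v' i)) = 0" using v'(2) by (simp add: sum.distrib sum_negf sum_subtractf)
    ultimately have "q (\<lambda>i. v i + smul (-1) (v' i)) = 0" unfolding q_def fam_def by (intro zero) auto
    then have "q v = q v'" by (simp only: q(2,3)) simp
    then show ?thesis using v'(3) by simp
  qed
  obtain c where c: "\<And>x. g x = B x c" using functional_represented[OF g(1)] by blast
  have "B x (h i) = B x c" if "i \<in> A" "x \<in> l i" for i x
  proof -
    define v where "v j = (if j = i then x else 0)" for j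
    have "fam v" unfolding fam_def v_def using that sub V.subspace_0 by auto
    moreover have "(\<Sum>j\<in>A. v j) = x" using that \<open>finite A\<close> by (simp add: v_def)
    moreover have "q v = B x (h i)"
    proof -
      have "q v = (\<Sum>j\<in>A. if j = i then B x (h i) else 0)"
        unfolding q_def v_def by (intro sum.cong) (auto simp: symplectic_zero)
      then show ?thesis using that \<open>finite A\<close> by simp
    qed
    ultimately show ?thesis using gq c by metis
  qed
  then show ?thesis by blast
qed

end

locale lagrangian_ngon = symplectic_form smul B + ngon n
  for smul :: "'f::field \<Rightarrow> 'v::ab_group_add \<Rightarrow> 'v" and B :: "'v \<Rightarrow> 'v \<Rightarrow> 'f" and n :: nat +
  fixes l :: "int \<Rightarrow> 'v set"
  assumes per: "periodic n l" and lag: "\<And>i. lagrangian smul B (l i)"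
begin

lemma lagrangian_closed:
  "0 \<in> l i" "x \<in> l i \<Longrightarrow> y \<in> l i \<Longrightarrow> x + y \<in> l i" "x \<in> l i \<Longrightarrow> y \<in> l i \<Longrightarrow> x - y \<in> l i"
  "x \<in> l i \<Longrightarrow> - x \<in> l i" "x \<in> l i \<Longrightarrow> smul a x \<in> l i"
proof -
  interpret V: vector_space smul by (rule symplectic_vector_space)
  have "V.subspace (l i)" using lag[of i] unfolding lagrangian_def by blast
  then show "0 \<in> l i" "x \<in> l i \<Longrightarrow> y \<in> l i \<Longrightarrow> x + y \<in> l i" "x \<in> l i \<Longrightarrow> y \<in> l i \<Longrightarrow> x - y \<in> l i"
    "x \<in> l i \<Longrightarrow> - x \<in> l i" "x \<in> l i \<Longrightarrow> smul a x \<in> l i"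
    using V.subspace_0 V.subspace_add V.subspace_diff V.subspace_neg V.subspace_scale by auto
qed

lemma lagrangian_isotropic: "x \<in> l i \<Longrightarrow> y \<in> l i \<Longrightarrow> B x y = 0"
  using lag[of i] unfolding lagrangian_def by blast

lemma lagrangian_coisotropic: "(\<And>y. y \<in> l i \<Longrightarrow> B y x = 0) \<Longrightarrow> x \<in> l i"
  using lag[of i] symplectic_antisym[of x] unfolding lagrangian_def by auto

lemma K_space_antiderivative: "w \<in> K_space n l \<Longrightarrow> \<exists>h. antiderivative n w h"
  using antiderivative_exists[of n w] n_gt0 unfolding K_space_def by auto

lemma q_form_eq:
  assumes "v \<in> K_space n l" "antiderivative n w h"
  shows "q_form n B v w = (\<Sum>i\<in>{0..<int n}. B (v i) (h i))"
proof -
  define h' where "h' = (SOME h. antiderivative n w h)"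
  have h': "antiderivative n w h'" unfolding h'_def using someI_ex[of "antiderivative n w"] assms(2) by blast
  have "q_form n B v w = (\<Sum>i\<in>{0..<int n}. B (v i) (h' i))" by (simp add: q_form_def h'_def)
  also have "\<dots> = (\<Sum>i\<in>{0..<int n}. B (v i) (h i) + B (v i) (h' 0 - h 0))"
    using antiderivative_unique[OF h' assms(2)] by (intro sum.cong refl) (metis symplectic_linear(1))
  also have "\<dots> = (\<Sum>i\<in>{0..<int n}. B (v i) (h i)) + B (\<Sum>i\<in>{0..<int n}. v i) (h' 0 - h 0)"
    by (simp add: sum.distrib symplectic_sum)
  finally show ?thesis using assms(1) by (simp add: K_space_def symplectic_zero)
qed

lemma K_space_closed:
  assumes "v \<in> K_space n l"
  shows "w \<in> K_space n l \<Longrightarrow> (\<lambda>i. v i + w i) \<in> K_space n l"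
    and "w \<in> K_space n l \<Longrightarrow> (\<lambda>i. v i - w i) \<in> K_space n l"
    and "(\<lambda>i. smul a (v i)) \<in> K_space n l"
proof -
  interpret V: vector_space smul by (rule symplectic_vector_space)
  show "w \<in> K_space n l \<Longrightarrow> (\<lambda>i. v i + w i) \<in> K_space n l"
    and "w \<in> K_space n l \<Longrightarrow> (\<lambda>i. v i - w i) \<in> K_space n l"
    and "(\<lambda>i. smul a (v i)) \<in> K_space n l"
    using assms
    by (auto simp: K_space_def periodic_def sum.distrib sum_subtractf lagrangian_closed
        simp flip: V.scale_sum_right)
qed

lemma q_form_diff_left:
  assumes "v \<in> K_space n l" "v' \<in> K_space n l" "w \<in> K_space n l"
  shows "q_form n B (\<lambda>i. v i - v' i) w = q_form n B v w - q_form n B v' w"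
proof -
  obtain h where h: "antiderivative n w h" using K_space_antiderivative[OF assms(3)] by blast
  show ?thesis
    using q_form_eq[OF K_space_closed(2)[OF assms(1,2)] h] q_form_eq[OF assms(1) h] q_form_eq[OF assms(2) h]
    by (simp add: symplectic_diff sum_subtractf)
qed

text \<open>Summation by parts. The correction term \<open>\<Sum> B (w i) (v i)\<close> vanishes
  because both families have values in the isotropic subspaces \<open>l i\<close>.\<close>

lemma q_form_sym:
  assumes v: "v \<in> K_space n l" and w: "w \<in> K_space n l"
  shows "q_form n B v w = q_form n B w v"
proof -
  obtain h k where h: "antiderivative n w h" and k: "antiderivative n v k"
    using K_space_antiderivative v w by blast
  have h': "h i - h (i - 1) = w i" and k': "k i - k (i - 1) = v i" for i
    using h k by (auto simp: antiderivative_def)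
  have "B (v i) (h i) - B (w i) (k i) = B (k i) (h i) - B (k (i - 1)) (h (i - 1))" for i
  proof -
    have "B (w i) (v i) = 0"
      using v w by (intro lagrangian_isotropic[of _ i]) (auto simp: K_space_def)
    moreover have "B (v i) (h i) - B (w i) (k i) - (B (k i) (h i) - B (k (i - 1)) (h (i - 1))) 
      = - B (w i) (v i)"
      unfolding h'[of i, symmetric] k'[of i, symmetric] symplectic_diff
      using symplectic_antisym[of "h i" "k i"] symplectic_antisym[of "h i" "k (i - 1)"]
        symplectic_antisym[of "h (i - 1)" "k i"] symplectic_antisym[of "h (i - 1)" "k (i - 1)"]
      by simp
    ultimately show ?thesis by simp
  qed
  then have "(\<Sum>i\<in>{0..<int n}. B (v i) (h i)) - (\<Sum>i\<in>{0..<int n}. B (w i) (k i)) =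
      - (\<Sum>i\<in>{0..<int n}. B (k (i - 1)) (h (i - 1)) - B (k i) (h i))"
    by (simp add: sum_subtractf[symmetric] sum_negf[symmetric])
  also have "\<dots> = 0"
  proof -
    have "periodic n (\<lambda>i. B (k i) (h i))" using h k by (auto simp: antiderivative_def periodic_def)
    then show ?thesis using sum_periodic_difference(2)[of n "\<lambda>i. B (k i) (h i)"] n_gt0 by simp
  qed
  finally show ?thesis using q_form_eq[OF v h] q_form_eq[OF w k] by simp
qed

text \<open>The differences of such families \<open>u\<close> are the ambiguities in the choice
  of boundary values of a primitive. If \<open>h\<close> is an antiderivative of \<open>w\<close>
  in the kernel, then some constant \<open>c\<close> makes \<open>h i - c\<close> orthogonal to
  \<open>l i\<close>, so it lies in \<open>l i\<close> by maximality, and \<open>u i = h (i - 1) -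
  c\<close> also equals \<open>(h i - c) - w i\<close>.\<close>

lemma q_kernel_iff:
  "w \<in> q_kernel n B l \<longleftrightarrow>
     (\<exists>u. periodic n u \<and> (\<forall>i. u i \<in> l (i - 1) \<inter> l i \<and> w i = u (i + 1) - u i))" (is "?l \<longleftrightarrow> ?r")
proof
  assume ?l
  then have w: "w \<in> K_space n l" and q0: "\<And>v. v \<in> K_space n l \<Longrightarrow> q_form n B v w = 0"
    by (auto simp: q_kernel_def)
  obtain h where h: "antiderivative n w h" using K_space_antiderivative[OF w] by blast
  then have hw: "h i - h (i - 1) = w i" and hp: "periodic n h" for i by (auto simp: antiderivative_def)
  have "\<exists>c. \<forall>i\<in>{0..<int n}. \<forall>x\<in>l i. B x (h i) = B x c"
  proof (rule annihilator_of_sum_zero)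
    show "module.subspace smul (l i)" for i using lag[of i] unfolding lagrangian_def by blast
    fix v assume v: "\<And>i. i \<in> {0..<int n} \<Longrightarrow> v i \<in> l i" "(\<Sum>i\<in>{0..<int n}. v i) = 0"
    define v' where "v' i = v (i mod int n)" for i
    have "v' i \<in> l i" for i
      using v(1)[of "i mod int n"] n_gt0 periodic_mod[OF per, of i] by (simp add: v'_def)
    moreover have "(\<Sum>i\<in>{0..<int n}. v' i) = (\<Sum>i\<in>{0..<int n}. v i)"
      by (intro sum.cong) (auto simp: v'_def)
    ultimately have "v' \<in> K_space n l" using v(2) by (auto simp: K_space_def periodic_def v'_def)
    then have "(\<Sum>i\<in>{0..<int n}. B (v' i) (h i)) = 0" using q0 q_form_eq h by metis
    then show "(\<Sum>i\<in>{0..<int n}. B (v i) (h i)) = 0"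
      by (simp add: v'_def cong: sum.cong_simp)
  qed simp
  then obtain c where c: "\<And>i x. i \<in> {0..<int n} \<Longrightarrow> x \<in> l i \<Longrightarrow> B x (h i) = B x c" by blast
  have hc: "h i - c \<in> l i" for i
  proof -
    have "h (i mod int n) - c \<in> l (i mod int n)"
      using c n_gt0 by (intro lagrangian_coisotropic) (simp add: symplectic_diff)
    then show ?thesis using periodic_mod[OF hp] periodic_mod[OF per] by simp
  qed
  define u where "u i = h (i - 1) - c" for i
  have "u i \<in> l i" for i
  proof -
    have "u i = (h i - c) - w i" using hw[of i] by (simp add: u_def algebra_simps)
    then show ?thesis using hc[of i] w lagrangian_closed(3) by (auto simp: K_space_def)
  qed
  moreover have "u i \<in> l (i - 1)" for i using hc by (simp add: u_def)
  moreover have "w i = u (i + 1) - u i" for i using hw[of i] by (simp add: u_def)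
  moreover have "periodic n u"
  proof -
    have "h (i + int n - 1) = h (i - 1)" for i
      using hp[unfolded periodic_def, rule_format, of "i - 1"] by (simp add: algebra_simps)
    then show ?thesis by (simp add: u_def periodic_def)
  qed
  ultimately show ?r by blast
next
  assume ?r
  then obtain u where u: "periodic n u" "\<And>i. u i \<in> l (i - 1)" "\<And>i. u i \<in> l i" "\<And>i. w i = u (i + 1) - u i"
    by blast
  have u1: "u (i + 1) \<in> l i" for i using u(2)[of "i + 1"] by simp
  have wl: "w i \<in> l i" for i unfolding u(4) using u(3) u1 by (intro lagrangian_closed)
  have up: "periodic n (\<lambda>i. u (i + 1))"
    using u(1) unfolding periodic_def by (metis add.assoc add.commute)
  have "periodic n w" using u(1) up by (simp add: u(4) periodic_def)
  moreover have "(\<Sum>i\<in>{0..<int n}. w i) = 0" unfolding u(4) by (rule sum_periodic_difference(1)[OF u(1) n_gt0])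
  ultimately have w: "w \<in> K_space n l" using wl by (simp add: K_space_def)
  have h: "antiderivative n w (\<lambda>i. u (i + 1))" using up by (simp add: antiderivative_def u(4))
  have "q_form n B v w = 0" if v: "v \<in> K_space n l" for v
  proof -
    have "B (v i) (u (i + 1)) = 0" for i
      using u1 v by (intro lagrangian_isotropic[of _ i]) (auto simp: K_space_def)
    then show ?thesis using q_form_eq[OF v h] by simp
  qed
  then show ?l using w by (simp add: q_kernel_def)
qed

lemma q_kernel_closed:
  assumes "w \<in> q_kernel n B l"
  shows "w' \<in> q_kernel n B l \<Longrightarrow> (\<lambda>i. w i + w' i) \<in> q_kernel n B l"
    and "w' \<in> q_kernel n B l \<Longrightarrow> (\<lambda>i. w i - w' i) \<in> q_kernel n B l"
    and "(\<lambda>i. smul a (w i)) \<in> q_kernel n B l"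
proof -
  interpret V: vector_space smul by (rule symplectic_vector_space)
  obtain u where u: "periodic n u" "\<And>i. u i \<in> l (i - 1)" "\<And>i. u i \<in> l i" "\<And>i. w i = u (i + 1) - u i"
    using assms unfolding q_kernel_iff by blast
  show "(\<lambda>i. smul a (w i)) \<in> q_kernel n B l"
    unfolding q_kernel_iff using u
    by (intro exI[of _ "\<lambda>i. smul a (u i)"]) (auto simp: periodic_def lagrangian_closed V.scale_right_diff_distrib)
  assume "w' \<in> q_kernel n B l"
  then obtain u' where u': "periodic n u'" "\<And>i. u' i \<in> l (i - 1)" "\<And>i. u' i \<in> l i" "\<And>i. w' i = u' (i + 1) - u' i"
    unfolding q_kernel_iff by blast
  show "(\<lambda>i. w i + w' i) \<in> q_kernel n B l"
    unfolding q_kernel_iff using u u'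
    by (intro exI[of _ "\<lambda>i. u i + u' i"]) (auto simp: periodic_def lagrangian_closed)
  show "(\<lambda>i. w i - w' i) \<in> q_kernel n B l"
    unfolding q_kernel_iff using u u'
    by (intro exI[of _ "\<lambda>i. u i - u' i"]) (auto simp: periodic_def lagrangian_closed)
qed

lemma q_kernel_zero: "(\<lambda>_. 0) \<in> q_kernel n B l"
  unfolding q_kernel_iff by (intro exI[of _ "\<lambda>_. 0"]) (auto simp: periodic_def lagrangian_closed)

lemma T_rel_equiv: "equiv (K_space n l) (T_rel n B l)"
proof (rule equivI)
  show "T_rel n B l \<subseteq> K_space n l \<times> K_space n l" by (auto simp: T_rel_def)
  show "refl_on (K_space n l) (T_rel n B l)"
    using q_kernel_zero by (auto simp: refl_on_def T_rel_def)
  show "sym (T_rel n B l)"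
    using q_kernel_closed(2)[OF q_kernel_zero] by (fastforce simp: sym_def T_rel_def)
  show "trans (T_rel n B l)"
  proof (rule transI)
    fix x y z assume "(x, y) \<in> T_rel n B l" "(y, z) \<in> T_rel n B l"
    then show "(x, z) \<in> T_rel n B l"
      using q_kernel_closed(1)[of "\<lambda>i. x i - y i" "\<lambda>i. y i - z i"] by (auto simp: T_rel_def)
  qed
qed

lemma T_class_eq_iff:
  assumes "v \<in> K_space n l" "w \<in> K_space n l"
  shows "T_class n B l v = T_class n B l w \<longleftrightarrow> (\<lambda>i. v i - w i) \<in> q_kernel n B l"
  unfolding T_class_def using eq_equiv_class_iff[OF T_rel_equiv assms] assms by (simp add: T_rel_def)

lemma T_space_eq: "T_space n B l = T_class n B l ` K_space n l"
  unfolding T_space_def T_class_def quotient_def by auto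

lemma in_T_class_iff:
  assumes "v \<in> K_space n l"
  shows "v' \<in> T_class n B l v \<longleftrightarrow> v' \<in> K_space n l \<and> (\<lambda>i. v i - v' i) \<in> q_kernel n B l"
  unfolding T_class_def using assms by (auto simp: T_rel_def)

lemma T_class_self: "v \<in> K_space n l \<Longrightarrow> v \<in> T_class n B l v"
  using in_T_class_iff q_kernel_zero by simp

lemma T_add_class:
  assumes "v \<in> K_space n l" "w \<in> K_space n l"
  shows "T_add n B l (T_class n B l v) (T_class n B l w) = T_class n B l (\<lambda>i. v i + w i)"
proof -
  have "T_class n B l (\<lambda>i. v' i + w' i) = T_class n B l (\<lambda>i. v i + w i)"
    if "v' \<in> T_class n B l v" "w' \<in> T_class n B l w" for v' w'
  proof -
    have K: "v' \<in> K_space n l" "w' \<in> K_space n l" "(\<lambda>i. v i - v' i) \<in> q_kernel n B l" "(\<lambda>i. w i - w' i) \<in> q_kernel n B l"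
      using that in_T_class_iff assms by auto
    have "(\<lambda>i. (v i + w i) - (v' i + w' i)) \<in> q_kernel n B l"
      using q_kernel_closed(1)[OF K(3,4)] by (simp add: algebra_simps)
    then show ?thesis
      using T_class_eq_iff[OF K_space_closed(1)[OF assms] K_space_closed(1)[OF K(1,2)]] by simp
  qed
  then show ?thesis unfolding T_add_def using T_class_self assms by blast
qed

lemma T_scale_class:
  assumes "v \<in> K_space n l"
  shows "T_scale n smul B l a (T_class n B l v) = T_class n B l (\<lambda>i. smul a (v i))"
proof -
  interpret V: vector_space smul by (rule symplectic_vector_space)
  have "T_class n B l (\<lambda>i. smul a (v' i)) = T_class n B l (\<lambda>i. smul a (v i))"
    if "v' \<in> T_class n B l v" for v'
  proof -
    have K: "v' \<in> K_space n l" "(\<lambda>i. v i - v' i) \<in> q_kernel n B l"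
      using that in_T_class_iff assms by auto
    have "(\<lambda>i. smul a (v i) - smul a (v' i)) \<in> q_kernel n B l"
      using q_kernel_closed(3)[OF K(2), of a] by (simp add: V.scale_right_diff_distrib)
    then show ?thesis
      using T_class_eq_iff[OF K_space_closed(3)[OF assms, of a] K_space_closed(3)[OF K(1), of a]] by simp
  qed
  then show ?thesis unfolding T_scale_def using T_class_self assms by blast
qed

lemma T_form_class:
  assumes "v \<in> K_space n l" "w \<in> K_space n l"
  shows "T_form n B (T_class n B l v) (T_class n B l w) = q_form n B v w"
proof -
  have "q_form n B v' w' = q_form n B v w"
    if "v' \<in> T_class n B l v" "w' \<in> T_class n B l w" for v' w'
  proof -
    have K: "v' \<in> K_space n l" "w' \<in> K_space n l" "(\<lambda>i. v i - v' i) \<in> q_kernel n B l" "(\<lambda>i. w i - w' i) \<in> q_kernel n B l"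
      using that in_T_class_iff assms by auto
    have "q_form n B w' (\<lambda>i. v i - v' i) = 0" "q_form n B v (\<lambda>i. w i - w' i) = 0"
      using K assms by (auto simp: q_kernel_def)
    then have "q_form n B v w' = q_form n B v' w'" "q_form n B w v = q_form n B w' v"
      using q_form_diff_left[OF assms(1) K(1) K(2)] q_form_diff_left[OF assms(2) K(2) assms(1)]
        q_form_sym K_space_closed(2) K assms by simp_all
    then show ?thesis using q_form_sym K assms by simp
  qed
  then have "(\<Union>v'\<in>T_class n B l v. \<Union>w'\<in>T_class n B l w. {q_form n B v' w'}) = {q_form n B v w}"
    using T_class_self assms by blast
  then show ?thesis unfolding T_form_def by simp
qed

lemma q_kernel_in_K: "q_kernel n B l \<subseteq> K_space n l"
  by (auto simp: q_kernel_def)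

end

section \<open>Cech cochains and invariants of Cech classes\<close>

lemma sections_iff:
  "s \<in> sections A W \<longleftrightarrow> (\<forall>p\<in>W. s p \<in> A p) \<and> loc_const s W \<and> (\<forall>p. p \<notin> W \<longrightarrow> s p = 0)"
  by (auto simp: sections_def loc_const_def)

lemma sum_fun_apply: "(\<Sum>j\<in>J. f j) p = (\<Sum>j\<in>J. f j p)"
  by (induction J rule: infinite_finite_induct) auto

lemma cobound_apply:
  "cobound I N c xs p = (if set xs \<subseteq> I \<and> p \<in> (\<Inter>x\<in>set xs. N x)
     then \<Sum>j<length xs. if even j then c (take j xs @ drop (Suc j) xs) p
                         else - c (take j xs @ drop (Suc j) xs) p
     else 0)"
  by (auto simp: cobound_def restr_def sum_fun_apply Let_def intro!: sum.cong)

lemma cobound_1: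
  assumes "x \<in> I" "y \<in> I" "p \<in> N x" "p \<in> N y"
  shows "cobound I N c [x, y] p = c [y] p - c [x] p"
  using assms by (simp add: cobound_apply lessThan_Suc numeral_2_eq_2)

lemma cobound_2:
  assumes "x \<in> I" "y \<in> I" "z \<in> I" "p \<in> N x" "p \<in> N y" "p \<in> N z"
  shows "cobound I N c [x, y, z] p = c [y, z] p - c [x, z] p + c [x, y] p"
  using assms by (simp add: cobound_apply lessThan_Suc numeral_3_eq_3 algebra_simps)

lemma cobound_3:
  assumes "x \<in> I" "y \<in> I" "z \<in> I" "w \<in> I" "p \<in> N x" "p \<in> N y" "p \<in> N z" "p \<in> N w"
  shows "cobound I N c [x, y, z, w] p = c [y, z, w] p - c [x, z, w] p + c [x, y, w] p - c [x, y, z] p"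
proof -
  have "{..<length [x, y, z, w]} = {0, 1, 2, 3}" by auto
  moreover have "Suc 2 = 3" "Suc 3 = 4" by auto
  ultimately show ?thesis using assms by (simp add: cobound_apply algebra_simps del: list.size)
qed

lemma cochain_outside:
  assumes "c \<in> cochains A I N k" "\<not> (length xs = Suc k \<and> set xs \<subseteq> I \<and> p \<in> (\<Inter>x\<in>set xs. N x))"
  shows "c xs p = 0"
proof (cases "length xs = Suc k \<and> set xs \<subseteq> I")
  case True
  then have "c xs \<in> sections A (\<Inter>x\<in>set xs. N x)" using assms(1) unfolding cochains_def by force
  then show ?thesis using assms(2) True by (auto simp: sections_iff)
next
  case False
  then have "c xs = 0" using assms(1) unfolding cochains_def by force
  then show ?thesis by simp
qed

lemma cochain_section:
  assumes "c \<in> cochains A I N k" "length xs = Suc k" "set xs \<subseteq> I"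
  shows "c xs \<in> sections A (\<Inter>x\<in>set xs. N x)"
  using assms unfolding cochains_def by force

lemma cobound_eq_iff:
  assumes c: "c \<in> cochains A I N k" and d: "d \<in> cochains A' I N (Suc k)"
  shows "cobound I N c = d \<longleftrightarrow>
    (\<forall>xs. length xs = Suc (Suc k) \<longrightarrow> set xs \<subseteq> I \<longrightarrow>
       (\<forall>p\<in>(\<Inter>x\<in>set xs. N x). cobound I N c xs p = d xs p))" (is "?l \<longleftrightarrow> ?r")
proof
  assume r: ?r
  show ?l
  proof (intro ext)
    fix xs p
    show "cobound I N c xs p = d xs p"
    proof (cases "length xs = Suc (Suc k) \<and> set xs \<subseteq> I \<and> p \<in> (\<Inter>x\<in>set xs. N x)")
      case True
      then show ?thesis using r by blast
    next
      case False
      have "c (take j xs @ drop (Suc j) xs) p = 0" if "j < length xs" "length xs \<noteq> Suc (Suc k)" for j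
        by (rule cochain_outside[OF c]) (use that in auto)
      then have "cobound I N c xs p = 0" using False by (auto simp: cobound_apply intro!: sum.neutral)
      moreover have "d xs p = 0" by (rule cochain_outside[OF d False])
      ultimately show ?thesis by simp
    qed
  qed
qed blast

lemma zero_cochain: "(\<And>p. 0 \<in> A p) \<Longrightarrow> 0 \<in> cochains A I N k"
  by (auto simp: cochains_def sections_iff zero_fun_def)

lemma all_length_2: "(\<forall>xs. length xs = Suc (Suc 0) \<longrightarrow> Q xs) \<longleftrightarrow> (\<forall>x y. Q [x, y])"
  by (auto simp: length_Suc_conv)
lemma all_length_3: "(\<forall>xs. length xs = Suc (Suc (Suc 0)) \<longrightarrow> Q xs) \<longleftrightarrow> (\<forall>x y z. Q [x, y, z])"
  by (auto simp: length_Suc_conv)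
lemma all_length_4: "(\<forall>xs. length xs = Suc (Suc (Suc (Suc 0))) \<longrightarrow> Q xs) \<longleftrightarrow> (\<forall>x y z w. Q [x, y, z, w])"
  by (auto simp: length_Suc_conv)

lemma cocycles_1_iff:
  assumes "\<And>p. 0 \<in> A p"
  shows "c \<in> cocycles A I N 1 \<longleftrightarrow> c \<in> cochains A I N 1 \<and>
    (\<forall>x\<in>I. \<forall>y\<in>I. \<forall>z\<in>I. \<forall>p\<in>N x \<inter> N y \<inter> N z. c [y, z] p - c [x, z] p + c [x, y] p = 0)"
proof -
  have "cobound I N c = 0 \<longleftrightarrow>
    (\<forall>x\<in>I. \<forall>y\<in>I. \<forall>z\<in>I. \<forall>p\<in>N x \<inter> N y \<inter> N z. c [y, z] p - c [x, z] p + c [x, y] p = 0)"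
    if "c \<in> cochains A I N 1"
    unfolding cobound_eq_iff[OF that zero_cochain[of A I N "Suc 1", OF assms]]
    by (auto simp: all_length_3 cobound_2)
  then show ?thesis unfolding cocycles_def by blast
qed

lemma cocycles_2_iff:
  assumes "\<And>p. 0 \<in> A p"
  shows "c \<in> cocycles A I N 2 \<longleftrightarrow> c \<in> cochains A I N 2 \<and>
    (\<forall>x\<in>I. \<forall>y\<in>I. \<forall>z\<in>I. \<forall>w\<in>I. \<forall>p\<in>N x \<inter> N y \<inter> N z \<inter> N w.
       c [y, z, w] p - c [x, z, w] p + c [x, y, w] p - c [x, y, z] p = 0)"
proof -
  have "cobound I N c = 0 \<longleftrightarrow>
    (\<forall>x\<in>I. \<forall>y\<in>I. \<forall>z\<in>I. \<forall>w\<in>I. \<forall>p\<in>N x \<inter> N y \<inter> N z \<inter> N w.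
       c [y, z, w] p - c [x, z, w] p + c [x, y, w] p - c [x, y, z] p = 0)"
    if "c \<in> cochains A I N 2"
    unfolding cobound_eq_iff[OF that zero_cochain[of A I N "Suc 2", OF assms]]
    by (auto simp: numeral_2_eq_2 all_length_4 cobound_3)
  then show ?thesis unfolding cocycles_def by blast
qed

text \<open>A cochain from any formula for its values: the formula is cut down to the indices
  and intersections on which a cochain lives.\<close>

definition make_cochain ::
  "'p set \<Rightarrow> ('p \<Rightarrow> 'p set) \<Rightarrow> nat \<Rightarrow> ('p list \<Rightarrow> 'p \<Rightarrow> 'a::zero) \<Rightarrow> 'p list \<Rightarrow> 'p \<Rightarrow> 'a" where
  "make_cochain I N k f = (\<lambda>xs. if length xs = Suc k \<and> set xs \<subseteq> I
     then restr (\<Inter>x\<in>set xs. N x) (f xs) else (\<lambda>_. 0))"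

lemma make_cochain_apply:
  "length xs = Suc k \<Longrightarrow> set xs \<subseteq> I \<Longrightarrow> p \<in> (\<Inter>x\<in>set xs. N x) \<Longrightarrow> make_cochain I N k f xs p = f xs p"
  by (auto simp: make_cochain_def restr_def)

lemma make_cochain_in:
  assumes "\<And>xs. length xs = Suc k \<Longrightarrow> set xs \<subseteq> I \<Longrightarrow> loc_const (f xs) (\<Inter>x\<in>set xs. N x)"
    and "\<And>xs p. length xs = Suc k \<Longrightarrow> set xs \<subseteq> I \<Longrightarrow> p \<in> (\<Inter>x\<in>set xs. N x) \<Longrightarrow> f xs p \<in> A p"
  shows "make_cochain I N k f \<in> cochains A I N k"
  unfolding cochains_def make_cochain_def
proof (intro CollectI allI)
  fix xs
  have "restr (\<Inter>x\<in>set xs. N x) (f xs) \<in> sections A (\<Inter>x\<in>set xs. N x)"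
    if "length xs = Suc k" "set xs \<subseteq> I"
    unfolding sections_iff
    using loc_const_cong[OF assms(1)[OF that], of "restr (\<Inter>x\<in>set xs. N x) (f xs)"] assms(2)[OF that]
    by (auto simp: restr_def)
  then show "if length xs = Suc k \<and> set xs \<subseteq> I
    then (if length xs = Suc k \<and> set xs \<subseteq> I then restr (\<Inter>x\<in>set xs. N x) (f xs) else (\<lambda>_. 0))
           \<in> sections A (\<Inter>x\<in>set xs. N x)
    else (if length xs = Suc k \<and> set xs \<subseteq> I then restr (\<Inter>x\<in>set xs. N x) (f xs) else (\<lambda>_. 0)) = 0"
    by (auto simp: zero_fun_def)
qed

lemma coboundaries_1_iff:
  assumes c: "c \<in> cochains A I N 1"
  shows "c \<in> coboundaries A I N 1 \<longleftrightarrow>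
    (\<exists>a. (\<forall>x\<in>I. loc_const (a x) (N x) \<and> (\<forall>p\<in>N x. a x p \<in> A p)) \<and>
      (\<forall>x\<in>I. \<forall>y\<in>I. \<forall>p\<in>N x \<inter> N y. c [x, y] p = a y p - a x p))" (is "_ \<longleftrightarrow> ?r")
proof
  assume "c \<in> coboundaries A I N 1"
  then obtain b where b: "b \<in> cochains A I N 0" "c = cobound I N b" by auto
  show ?r
  proof (intro exI[of _ "\<lambda>x. b [x]"] conjI ballI)
    fix x y p assume "x \<in> I" "y \<in> I" "p \<in> N x \<inter> N y"
    then show "c [x, y] p = b [y] p - b [x] p" unfolding b(2) by (simp add: cobound_1)
  qed (use cochain_section[OF b(1), of "[_]"] in \<open>auto simp: sections_iff\<close>)
next
  assume ?r
  then obtain a where a: "\<And>x. x \<in> I \<Longrightarrow> loc_const (a x) (N x)" "\<And>x p. x \<in> I \<Longrightarrow> p \<in> N x \<Longrightarrow> a x p \<in> A p"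
    "\<And>x y p. x \<in> I \<Longrightarrow> y \<in> I \<Longrightarrow> p \<in> N x \<inter> N y \<Longrightarrow> c [x, y] p = a y p - a x p" by blast
  define b where "b = make_cochain I N 0 (\<lambda>xs. a (hd xs))"
  have b: "b \<in> cochains A I N 0" unfolding b_def
    by (rule make_cochain_in) (auto simp: length_Suc_conv a)
  have "cobound I N b = c"
    unfolding cobound_eq_iff[OF b c[unfolded One_nat_def]]
    by (auto simp: all_length_2 cobound_1 b_def make_cochain_apply a)
  then show "c \<in> coboundaries A I N 1" using b by auto
qed

lemma coboundaries_2_iff:
  assumes c: "c \<in> cochains A I N 2"
  shows "c \<in> coboundaries A I N 2 \<longleftrightarrow>
    (\<exists>\<eta>. (\<forall>x\<in>I. \<forall>y\<in>I. loc_const (\<eta> x y) (N x \<inter> N y) \<and> (\<forall>p\<in>N x \<inter> N y. \<eta> x y p \<in> A p)) \<and>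
      (\<forall>x\<in>I. \<forall>y\<in>I. \<forall>z\<in>I. \<forall>p\<in>N x \<inter> N y \<inter> N z.
         c [x, y, z] p = \<eta> y z p - \<eta> x z p + \<eta> x y p))" (is "_ \<longleftrightarrow> ?r")
proof
  assume "c \<in> coboundaries A I N 2"
  then obtain b where b: "b \<in> cochains A I N 1" "c = cobound I N b" by (auto simp: numeral_2_eq_2)
  have "b [x, y] \<in> sections A (N x \<inter> N y)" if "x \<in> I" "y \<in> I" for x y
    using cochain_section[OF b(1), of "[x, y]"] that by simp
  moreover have "c [x, y, z] p = b [y, z] p - b [x, z] p + b [x, y] p"
    if "x \<in> I" "y \<in> I" "z \<in> I" "p \<in> N x \<inter> N y \<inter> N z" for x y z p
    using that unfolding b(2) by (simp add: cobound_2)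
  ultimately show ?r by (intro exI[of _ "\<lambda>x y. b [x, y]"]) (auto simp: sections_iff)
next
  assume ?r
  then obtain \<eta> where \<eta>: "\<And>x y. x \<in> I \<Longrightarrow> y \<in> I \<Longrightarrow> loc_const (\<eta> x y) (N x \<inter> N y)"
    "\<And>x y p. x \<in> I \<Longrightarrow> y \<in> I \<Longrightarrow> p \<in> N x \<Longrightarrow> p \<in> N y \<Longrightarrow> \<eta> x y p \<in> A p"
    "\<And>x y z p. x \<in> I \<Longrightarrow> y \<in> I \<Longrightarrow> z \<in> I \<Longrightarrow> p \<in> N x \<Longrightarrow> p \<in> N y \<Longrightarrow> p \<in> N z \<Longrightarrow>
       c [x, y, z] p = \<eta> y z p - \<eta> x z p + \<eta> x y p" by blast
  define b where "b = make_cochain I N 1 (\<lambda>xs. \<eta> (xs ! 0) (xs ! 1))"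
  have b: "b \<in> cochains A I N 1" unfolding b_def
    by (rule make_cochain_in) (auto simp: length_Suc_conv \<eta>)
  have c': "c \<in> cochains A I N (Suc 1)" using c by (simp add: numeral_2_eq_2)
  have "cobound I N b = c"
    unfolding cobound_eq_iff[OF b c']
    by (auto simp: all_length_3 cobound_2 b_def make_cochain_apply \<eta>)
  then show "c \<in> coboundaries A I N 2" using b by (auto simp: numeral_2_eq_2)
qed

lemma pullback_apply:
  "pullback J M \<tau> c xs p = (if set xs \<subseteq> J \<and> p \<in> (\<Inter>x\<in>set xs. M x) then c (map \<tau> xs) p else 0)"
  by (auto simp: pullback_def restr_def)

lemma refines_intersection:
  assumes "refines J M I N \<tau>" "set xs \<subseteq> J" "p \<in> (\<Inter>x\<in>set xs. M x)"
  shows "set (map \<tau> xs) \<subseteq> I" "p \<in> (\<Inter>x\<in>set (map \<tau> xs). N x)"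
  using assms unfolding refines_def by auto

lemma cobound_pullback:
  assumes "refines J M I N \<tau>"
  shows "cobound J M (pullback J M \<tau> c) = pullback J M \<tau> (cobound I N c)"
proof (intro ext)
  fix xs p
  show "cobound J M (pullback J M \<tau> c) xs p = pullback J M \<tau> (cobound I N c) xs p"
  proof (cases "set xs \<subseteq> J \<and> p \<in> (\<Inter>x\<in>set xs. M x)")
    case True
    have "set (take j xs @ drop (Suc j) xs) \<subseteq> set xs" for j
      using set_take_subset[of j xs] set_drop_subset[of "Suc j" xs] by auto
    then have "pullback J M \<tau> c (take j xs @ drop (Suc j) xs) p
        = c (take j (map \<tau> xs) @ drop (Suc j) (map \<tau> xs)) p" for j
      using True unfolding pullback_apply by (subst if_P) (blast, simp add: take_map drop_map)
    then show ?thesis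
      using True refines_intersection[OF assms, of xs p]
      by (subst cobound_apply, subst pullback_apply) (simp add: cobound_apply cong: if_cong)
  next
    case False
    then show ?thesis by (auto simp: cobound_apply pullback_apply)
  qed
qed

lemma pullback_cochain:
  assumes "refines J M I N \<tau>" "c \<in> cochains A I N k"
  shows "pullback J M \<tau> c \<in> cochains A J M k"
  unfolding cochains_def
proof (intro CollectI allI)
  fix xs
  show "if length xs = Suc k \<and> set xs \<subseteq> J then pullback J M \<tau> c xs \<in> sections A (\<Inter>x\<in>set xs. M x)
    else pullback J M \<tau> c xs = 0"
  proof (cases "length xs = Suc k \<and> set xs \<subseteq> J")
    case True
    have ri: "set (map \<tau> xs) \<subseteq> I" using assms(1) True unfolding refines_def by auto
    have "c (map \<tau> xs) \<in> sections A (\<Inter>x\<in>set (map \<tau> xs). N x)"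
      by (rule cochain_section[OF assms(2)]) (use True ri in auto)
    moreover have sub: "(\<Inter>x\<in>set xs. M x) \<subseteq> (\<Inter>x\<in>set (map \<tau> xs). N x)"
      using refines_intersection(2)[OF assms(1)] True by blast
    ultimately have "loc_const (c (map \<tau> xs)) (\<Inter>x\<in>set xs. M x)" "\<forall>p\<in>(\<Inter>x\<in>set xs. M x). c (map \<tau> xs) p \<in> A p"
      unfolding sections_iff using loc_const_mono by blast+
    then have "pullback J M \<tau> c xs \<in> sections A (\<Inter>x\<in>set xs. M x)"
      unfolding sections_iff using True
      by (auto simp: pullback_apply intro: loc_const_cong[of "c (map \<tau> xs)"])
    then show ?thesis using True by simp
  next
    case False
    have "pullback J M \<tau> c xs p = 0" for p
      unfolding pullback_apply using False cochain_outside[OF assms(2), of "map \<tau> xs"] by auto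
    then have "pullback J M \<tau> c xs = 0" by (intro ext) simp
    then show ?thesis using False by auto
  qed
qed

lemma pullback_zero [simp]: "pullback J M \<tau> 0 = 0"
  by (intro ext) (simp add: pullback_apply)

lemma pullback_cocycle:
  assumes "refines J M I N \<tau>" "c \<in> cocycles A I N k"
  shows "pullback J M \<tau> c \<in> cocycles A J M k"
  using assms pullback_cochain by (auto simp: cocycles_def cobound_pullback)

lemma pullback_diff: "pullback J M \<tau> (c - c') = pullback J M \<tau> c - pullback J M \<tau> (c'::('p,'a::ab_group_add) cochain)"
  by (intro ext) (simp add: pullback_apply)

lemma pullback_pullback:
  assumes "refines K L J M \<kappa>"
  shows "pullback K L \<kappa> (pullback J M \<tau> c) = pullback K L (\<tau> \<circ> \<kappa>) c"
proof (intro ext)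
  fix xs p
  show "pullback K L \<kappa> (pullback J M \<tau> c) xs p = pullback K L (\<tau> \<circ> \<kappa>) c xs p"
    using refines_intersection[OF assms, of xs p] by (auto simp: pullback_apply)
qed

lemma refines_trans: "refines K L J M \<kappa> \<Longrightarrow> refines J M I N \<tau> \<Longrightarrow> refines K L I N (\<tau> \<circ> \<kappa>)"
  unfolding refines_def by fastforce

lemma refines_id: "refines J M J M id"
  by (simp add: refines_def)

lemma pullback_coboundary:
  assumes "refines J M I N \<tau>" "c \<in> coboundaries A I N k"
  shows "pullback J M \<tau> c \<in> coboundaries A J M k"
proof (cases k)
  case (Suc m)
  then obtain b where "b \<in> cochains A I N m" "c = cobound I N b" using assms(2) by auto
  then have "pullback J M \<tau> c = cobound J M (pullback J M \<tau> b)" "pullback J M \<tau> b \<in> cochains A J M m"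
    using pullback_cochain[OF assms(1)] cobound_pullback[OF assms(1), of b] by auto
  then show ?thesis using Suc by (metis coboundaries.simps(2) imageI)
qed (use assms in auto)

lemma cobound_add: "cobound I N (c + c') = cobound I N c + cobound I N (c'::('p,'a::ab_group_add) cochain)"
  by (intro ext) (auto simp: cobound_apply sum.distrib[symmetric] intro!: sum.cong)

lemma cobound_map:
  fixes h :: "'a::ab_group_add \<Rightarrow> 'a"
  assumes "\<And>x y. h (x + y) = h x + h y" "h 0 = 0"
  shows "cobound I N (\<lambda>xs p. h (c xs p)) = (\<lambda>xs p. h (cobound I N c xs p))"
proof (intro ext)
  fix xs p
  have m: "h (- x) = - h x" for x
  proof -
    have "h (- x) + h x = 0" using assms(1)[of "- x" x] assms(2) by simp
    then show ?thesis by (simp add: eq_neg_iff_add_eq_0)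
  qed
  have s: "h (\<Sum>j\<in>J. f j) = (\<Sum>j\<in>J. h (f j))" for f :: "nat \<Rightarrow> 'a" and J
    by (induction J rule: infinite_finite_induct) (auto simp: assms)
  show "cobound I N (\<lambda>xs p. h (c xs p)) xs p = h (cobound I N c xs p)"
    by (auto simp: cobound_apply s m assms(2) if_distrib[of h] intro!: sum.cong)
qed

lemma cochains_iff:
  "c \<in> cochains A I N k \<longleftrightarrow>
    (\<forall>xs. length xs = Suc k \<longrightarrow> set xs \<subseteq> I \<longrightarrow>
       loc_const (c xs) (\<Inter>x\<in>set xs. N x) \<and> (\<forall>p\<in>(\<Inter>x\<in>set xs. N x). c xs p \<in> A p)) \<and>
    (\<forall>xs p. \<not> (length xs = Suc k \<and> set xs \<subseteq> I \<and> p \<in> (\<Inter>x\<in>set xs. N x)) \<longrightarrow> c xs p = 0)"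
    (is "?l \<longleftrightarrow> ?r")
proof
  assume l: ?l
  show ?r
  proof (intro conjI allI impI)
    fix xs assume "length xs = Suc k" "set xs \<subseteq> I"
    from cochain_section[OF l this]
    show "loc_const (c xs) (\<Inter>x\<in>set xs. N x)" "\<forall>p\<in>(\<Inter>x\<in>set xs. N x). c xs p \<in> A p"
      unfolding sections_iff by simp_all
  qed (rule cochain_outside[OF l])
next
  assume r: ?r
  show ?l unfolding cochains_def
  proof (intro CollectI allI)
    fix xs
    show "if length xs = Suc k \<and> set xs \<subseteq> I then c xs \<in> sections A (\<Inter>x\<in>set xs. N x) else c xs = 0"
    proof (cases "length xs = Suc k \<and> set xs \<subseteq> I")
      case True
      then show ?thesis using r unfolding sections_iff by auto
    next
      case False
      then have "c xs p = 0" for p using r by blast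
      then have "c xs = 0" by (intro ext) simp
      then show ?thesis using False by auto
    qed
  qed
qed

lemma cocycle_add:
  assumes "\<And>p x y. x \<in> A p \<Longrightarrow> y \<in> A p \<Longrightarrow> x + y \<in> A p"
    and "c \<in> cocycles A I N k" "c' \<in> cocycles A I N k"
  shows "c + c' \<in> cocycles A I N k"
proof -
  have "c + c' \<in> cochains A I N k"
    using assms unfolding cochains_iff cocycles_def
    by (auto simp: plus_fun_def intro!: loc_const_comp2[of _ _ _ "(+)"])
  then show ?thesis using assms(2,3) by (simp add: cocycles_def cobound_add)
qed

lemma cocycle_map:
  fixes h :: "'a::ab_group_add \<Rightarrow> 'a"
  assumes "\<And>x y. h (x + y) = h x + h y" "h 0 = 0"
    and "\<And>p x. x \<in> A p \<Longrightarrow> h x \<in> A p" "c \<in> cocycles A I N k"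
  shows "(\<lambda>xs p. h (c xs p)) \<in> cocycles A I N k"
proof -
  have "(\<lambda>xs p. h (c xs p)) \<in> cochains A I N k"
    using assms(2-) unfolding cochains_iff cocycles_def
    by (auto intro!: loc_const_comp[of _ _ h])
  moreover have "cobound I N (\<lambda>xs p. h (c xs p)) = 0"
    using assms(2,4) unfolding cobound_map[OF assms(1,2)] by (auto simp: cocycles_def zero_fun_def)
  ultimately show ?thesis by (simp add: cocycles_def)
qed

lemma cobound_zero: "cobound I N 0 = (0 :: ('p, 'a::ab_group_add) cochain)"
  by (intro ext) (auto simp: cobound_apply zero_fun_def intro!: sum.neutral)

lemma zero_coboundary:
  fixes A :: "'p::topological_space \<Rightarrow> 'a::ab_group_add set"
  assumes "\<And>p. 0 \<in> A p"
  shows "0 \<in> coboundaries A I N k"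
proof (cases k)
  case (Suc m)
  have "0 \<in> cochains A I N m" using assms by (rule zero_cochain)
  then show ?thesis using Suc by (metis coboundaries.simps(2) imageI cobound_zero)
qed simp

lemma zero_cocycle:
  fixes A :: "'p::topological_space \<Rightarrow> 'a::ab_group_add set"
  assumes "\<And>p. 0 \<in> A p"
  shows "0 \<in> cocycles A I N k"
  using zero_cochain[of A, OF assms] by (simp add: cocycles_def cobound_zero)

lemma cochain_diff:
  assumes "\<And>p x y. x \<in> A p \<Longrightarrow> y \<in> A p \<Longrightarrow> x - y \<in> A p"
    and "c \<in> cochains A I N k" "c' \<in> cochains A I N k"
  shows "c - c' \<in> cochains A I N k"
  using assms unfolding cochains_iff
  by (auto simp: fun_diff_def intro!: loc_const_comp2[of _ _ _ "(-)"])

lemma open_coverD: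
  assumes "open_cover D I N"
  shows "x \<in> I \<Longrightarrow> openin (top_of_set D) (N x)" "x \<in> I \<Longrightarrow> N x \<subseteq> D" "D \<subseteq> (\<Union>x\<in>I. N x)"
  using assms openin_imp_subset unfolding open_cover_def by blast+

lemma common_refinement:
  assumes "open_cover D I N" "open_cover D I' N'"
  obtains M \<tau> \<tau>' where "open_cover D D M" "refines D M I N \<tau>" "refines D M I' N' \<tau>'"
proof -
  have "\<forall>p\<in>D. \<exists>x\<in>I. p \<in> N x" "\<forall>p\<in>D. \<exists>x\<in>I'. p \<in> N' x"
    using open_coverD(3)[OF assms(1)] open_coverD(3)[OF assms(2)] by blast+
  then obtain \<tau> \<tau>' where t: "\<And>p. p \<in> D \<Longrightarrow> \<tau> p \<in> I \<and> p \<in> N (\<tau> p)" "\<And>p. p \<in> D \<Longrightarrow> \<tau>' p \<in> I' \<and> p \<in> N' (\<tau>' p)"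
    by metis
  show ?thesis
  proof (rule that[of "\<lambda>p. N (\<tau> p) \<inter> N' (\<tau>' p)" \<tau> \<tau>'])
    show "open_cover D D (\<lambda>p. N (\<tau> p) \<inter> N' (\<tau>' p))"
      unfolding open_cover_def
    proof (intro conjI ballI equalityI)
      show "openin (top_of_set D) (N (\<tau> p) \<inter> N' (\<tau>' p))" if "p \<in> D" for p
        using t that open_coverD(1)[OF assms(1)] open_coverD(1)[OF assms(2)] by (intro openin_Int) auto
    qed (use t open_coverD(2)[OF assms(1)] in blast)+
  qed (use t in \<open>auto simp: refines_def\<close>)
qed

text \<open>A cocycle and its pullback agree on the refinement itself.\<close>

lemma cech_rel_pullback:
  assumes "\<And>p. 0 \<in> A p" "(I, N, c) \<in> cech_cocycles D A k" "open_cover D J M" "refines J M I N \<tau>"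
  shows "((I, N, c), (J, M, pullback J M \<tau> c)) \<in> cech_rel D A k"
proof -
  have "(J, M, pullback J M \<tau> c) \<in> cech_cocycles D A k"
    using assms pullback_cocycle unfolding cech_cocycles_def by blast
  moreover have "pullback J M \<tau> c - pullback J M id (pullback J M \<tau> c) = 0"
    unfolding pullback_pullback[OF refines_id] by simp
  ultimately have "\<exists>J' M' \<tau>1 \<tau>2. open_cover D J' M' \<and> refines J' M' I N \<tau>1 \<and> refines J' M' J M \<tau>2 \<and>
      pullback J' M' \<tau>1 c - pullback J' M' \<tau>2 (pullback J M \<tau> c) \<in> coboundaries A J' M' k"
    using assms refines_id[of J M] zero_coboundary[of A J M k, OF assms(1)]
    by (intro exI[of _ J] exI[of _ M] exI[of _ \<tau>] exI[of _ id] conjI) simp_all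
  then show ?thesis
    unfolding cech_rel_def using assms(2) \<open>(J, M, pullback J M \<tau> c) \<in> cech_cocycles D A k\<close> by simp
qed

context
  fixes D :: "'p::topological_space set" and A :: "'p \<Rightarrow> 'a::ab_group_add set" and k :: nat
    and f :: "('p, 'a) cech \<Rightarrow> 't"
  assumes rel: "\<And>x y. (x, y) \<in> cech_rel D A k \<longleftrightarrow>
      x \<in> cech_cocycles D A k \<and> y \<in> cech_cocycles D A k \<and> f x = f y"
    and zero_in: "\<And>p. 0 \<in> A p"
begin

text \<open>The relation between Cech cocycles asks for a common refinement, and its
  transitivity needs the homotopy of refinements. If it is equality of an invariant
  \<open>f\<close>, then this is automatic, a class is a fibre of \<open>f\<close>, and the
  operations on classes can be read off from their effect on \<open>f\<close>.\<close>

definition class_value :: "('p, 'a) cech set \<Rightarrow> 't" where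
  "class_value X = f (SOME x. x \<in> X)"

lemma coh_class_eq:
  "(I, N, c) \<in> cech_cocycles D A k \<Longrightarrow>
    coh_class D A k I N c = {y \<in> cech_cocycles D A k. f y = f (I, N, c)}"
  unfolding coh_class_def by (auto simp: rel)

lemma coh_class_in_cohomology:
  "(I, N, c) \<in> cech_cocycles D A k \<Longrightarrow> coh_class D A k I N c \<in> cohomology D A k"
  unfolding coh_class_def cohomology_def by (rule quotientI)

lemma class_valueI:
  assumes "X \<in> cohomology D A k" "x \<in> X"
  shows "x \<in> cech_cocycles D A k" "class_value X = f x" "X = {y \<in> cech_cocycles D A k. f y = f x}"
proof -
  obtain z where z: "z \<in> cech_cocycles D A k" "X = cech_rel D A k `` {z}"
    using assms(1) unfolding cohomology_def by (elim quotientE)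
  then have X: "X = {y \<in> cech_cocycles D A k. f y = f z}" by (auto simp: rel)
  show "x \<in> cech_cocycles D A k" "X = {y \<in> cech_cocycles D A k. f y = f x}"
    using assms(2) X by auto
  have "(SOME x. x \<in> X) \<in> X" using assms(2) by (rule someI)
  then show "class_value X = f x" using assms(2) X unfolding class_value_def by auto
qed

lemma cohomology_nonempty: "X \<in> cohomology D A k \<Longrightarrow> \<exists>I N c. (I, N, c) \<in> X"
proof -
  assume "X \<in> cohomology D A k"
  then obtain z where "z \<in> cech_cocycles D A k" "X = cech_rel D A k `` {z}"
    unfolding cohomology_def by (elim quotientE)
  then have "z \<in> X" by (auto simp: rel)
  then show ?thesis by (cases z) auto
qed

lemma class_value_coh_class:
  assumes "(I, N, c) \<in> cech_cocycles D A k"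
  shows "class_value (coh_class D A k I N c) = f (I, N, c)"
  by (rule class_valueI(2)[OF coh_class_in_cohomology[OF assms]]) (use assms in \<open>simp add: coh_class_eq\<close>)

lemma cohomology_eq_iff:
  assumes "X \<in> cohomology D A k" "Y \<in> cohomology D A k"
  shows "X = Y \<longleftrightarrow> class_value X = class_value Y"
proof -
  obtain I N c I' N' c' where "(I, N, c) \<in> X" "(I', N', c') \<in> Y" using cohomology_nonempty assms by metis
  note X = class_valueI[OF assms(1) this(1)] and Y = class_valueI[OF assms(2) this(2)]
  show ?thesis
  proof
    assume "class_value X = class_value Y"
    then show "X = Y" unfolding X(2) Y(2) by (subst X(3), subst Y(3)) simp
  qed simp
qed

lemma common_representatives:
  assumes "X \<in> cohomology D A k" "Y \<in> cohomology D A k"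
  obtains I N c c' where "(I, N, c) \<in> X" "(I, N, c') \<in> Y"
proof -
  obtain I N c I' N' c' where X: "(I, N, c) \<in> X" and Y: "(I', N', c') \<in> Y"
    using cohomology_nonempty assms by metis
  have "(I, N, c) \<in> cech_cocycles D A k" "(I', N', c') \<in> cech_cocycles D A k"
    using class_valueI(1) assms X Y by blast+
  then have oc: "open_cover D I N" "open_cover D I' N'" by (auto simp: cech_cocycles_def)
  obtain M \<tau> \<tau>' where M: "open_cover D D M" "refines D M I N \<tau>" "refines D M I' N' \<tau>'"
    by (rule common_refinement[OF oc])
  have pull: "(D, M, pullback D M \<sigma> b) \<in> Z"
    if Z: "Z \<in> cohomology D A k" "(J, L, b) \<in> Z" "refines D M J L \<sigma>" for Z J L b \<sigma>
  proof -
    have "((J, L, b), (D, M, pullback D M \<sigma> b)) \<in> cech_rel D A k"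
      using cech_rel_pullback[where A = A, OF zero_in class_valueI(1)[OF Z(1,2)] M(1) Z(3)] .
    then show ?thesis by (subst class_valueI(3)[OF Z(1,2)]) (simp add: rel)
  qed
  show ?thesis by (rule that[OF pull[OF assms(1) X M(2)] pull[OF assms(2) Y M(3)]])
qed

lemma linear_iso_class_value:
  fixes smul :: "'f \<Rightarrow> 'a \<Rightarrow> 'a"
  assumes range: "f ` cech_cocycles D A k = T"
    and add_in: "\<And>p x y. x \<in> A p \<Longrightarrow> y \<in> A p \<Longrightarrow> x + y \<in> A p"
    and smul: "\<And>a x y. smul a (x + y) = smul a x + smul a y" "\<And>a. smul a 0 = 0"
    and smul_in: "\<And>p a x. x \<in> A p \<Longrightarrow> smul a x \<in> A p"
    and add: "\<And>I N c c'. (I, N, c) \<in> cech_cocycles D A k \<Longrightarrow> (I, N, c') \<in> cech_cocycles D A k \<Longrightarrow>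
       f (I, N, c + c') = addT (f (I, N, c)) (f (I, N, c'))"
    and scale: "\<And>I N c a. (I, N, c) \<in> cech_cocycles D A k \<Longrightarrow>
       f (I, N, \<lambda>xs p. smul a (c xs p)) = smulT a (f (I, N, c))"
  shows "linear_iso (cohomology D A k) (coh_add D A k) (coh_scale smul D A k) T addT smulT class_value"
  unfolding linear_iso_def
proof (intro conjI ballI allI)
  show "bij_betw class_value (cohomology D A k) T"
    unfolding bij_betw_def
  proof
    show "inj_on class_value (cohomology D A k)"
      by (rule inj_onI) (use cohomology_eq_iff in blast)
    show "class_value ` cohomology D A k = T"
  proof (intro equalityI subsetI)
    fix t assume "t \<in> class_value ` cohomology D A k"
    then obtain X where X: "X \<in> cohomology D A k" "t = class_value X" by blast
    then obtain I N c where "(I, N, c) \<in> X" using cohomology_nonempty by blast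
    then show "t \<in> T" using class_valueI[OF X(1)] X(2) range by blast
  next
    fix t assume "t \<in> T"
    then obtain I N c where "(I, N, c) \<in> cech_cocycles D A k" "t = f (I, N, c)" using range by force
    then show "t \<in> class_value ` cohomology D A k"
      using class_value_coh_class coh_class_in_cohomology by (metis imageI)
  qed
  qed
next
  fix X Y assume XY: "X \<in> cohomology D A k" "Y \<in> cohomology D A k"
  obtain I0 N0 c0 c0' where r: "(I0, N0, c0) \<in> X" "(I0, N0, c0') \<in> Y" by (rule common_representatives[OF XY])
  have sum: "(I, N, c + c') \<in> cech_cocycles D A k \<and> f (I, N, c + c') = addT (class_value X) (class_value Y)"
    if "(I, N, c) \<in> X" "(I, N, c') \<in> Y" for I N c c'
  proof -
    have C: "(I, N, c) \<in> cech_cocycles D A k" "(I, N, c') \<in> cech_cocycles D A k"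
      using class_valueI(1) XY that by blast+
    then show ?thesis
      using add[OF C] class_valueI(2)[OF XY(1) that(1)] class_valueI(2)[OF XY(2) that(2)] cocycle_add[OF add_in]
      by (auto simp: cech_cocycles_def)
  qed
  have "coh_class D A k I N (c + c') = coh_class D A k I0 N0 (c0 + c0')"
    if "(I, N, c) \<in> X" "(I, N, c') \<in> Y" for I N c c'
    using sum[OF that] sum[OF r] coh_class_eq by simp
  then have eq: "coh_add D A k X Y = coh_class D A k I0 N0 (c0 + c0')"
    unfolding coh_add_def using r by blast
  show "coh_add D A k X Y \<in> cohomology D A k"
    and "class_value (coh_add D A k X Y) = addT (class_value X) (class_value Y)"
    unfolding eq using sum[OF r] coh_class_in_cohomology class_value_coh_class by auto
next
  fix a X assume X: "X \<in> cohomology D A k"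
  obtain I0 N0 c0 where r: "(I0, N0, c0) \<in> X" using cohomology_nonempty[OF X] by blast
  have sc: "(I, N, \<lambda>xs p. smul a (c xs p)) \<in> cech_cocycles D A k \<and>
      f (I, N, \<lambda>xs p. smul a (c xs p)) = smulT a (class_value X)"
    if "(I, N, c) \<in> X" for I N c
  proof -
    have C: "(I, N, c) \<in> cech_cocycles D A k" using class_valueI(1) X that by blast
    then show ?thesis
      using scale[OF C] class_valueI(2)[OF X that] cocycle_map[of "smul a" A, OF smul(1) smul(2) smul_in]
      by (auto simp: cech_cocycles_def)
  qed
  have "coh_class D A k I N (\<lambda>xs p. smul a (c xs p)) = coh_class D A k I0 N0 (\<lambda>xs p. smul a (c0 xs p))"
    if "(I, N, c) \<in> X" for I N c
    using sc[OF that] sc[OF r] coh_class_eq by simp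
  then have eq: "coh_scale smul D A k a X = coh_class D A k I0 N0 (\<lambda>xs p. smul a (c0 xs p))"
    unfolding coh_scale_def using r by blast
  show "coh_scale smul D A k a X \<in> cohomology D A k"
    and "class_value (coh_scale smul D A k a X) = smulT a (class_value X)"
    unfolding eq using sc[OF r] coh_class_in_cohomology class_value_coh_class by auto
qed

end

section \<open>The first cohomology of the sheaf of a polygon\<close>

lemma openin_restrict:
  "openin (top_of_set D) W \<Longrightarrow> E \<subseteq> D \<Longrightarrow> openin (top_of_set E) (W \<inter> E)"
  unfolding openin_open by blast

text \<open>The fibre at a vertex is the intersection of the conditions of the two closed edges
  that contain it, so closed edges give a uniform description.\<close>

lemma P_fibre_iff: "v \<in> P_fibre n l p \<longleftrightarrow> (\<forall>i. p \<in> edge n i \<longrightarrow> v \<in> l i)"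
proof
  assume v: "v \<in> P_fibre n l p"
  show "\<forall>i. p \<in> edge n i \<longrightarrow> v \<in> l i"
  proof (intro allI impI)
    fix i assume p: "p \<in> edge n i"
    consider "p \<in> open_segment (vertex n i) (vertex n (i + 1))" | "p = vertex n i" | "p = vertex n (i + 1)"
      using p by (auto simp: open_segment_def)
    then show "v \<in> l i"
    proof cases
      case 3
      have "v \<in> l (i + 1 - 1)" using v 3 unfolding P_fibre_def by blast
      then show ?thesis by simp
    qed (use v in \<open>auto simp: P_fibre_def\<close>)
  qed
next
  assume *: "\<forall>i. p \<in> edge n i \<longrightarrow> v \<in> l i"
  have "v \<in> l (i - 1) \<inter> l i" if "p = vertex n i" for i
    using *[rule_format, of "i - 1"] *[rule_format, of i] that by simp
  moreover have "v \<in> l i" if "p \<in> open_segment (vertex n i) (vertex n (i + 1))" for i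
    using * that by (simp add: open_segment_def)
  ultimately show "v \<in> P_fibre n l p" unfolding P_fibre_def by blast
qed

lemma P_fibre_vertex: "v \<in> P_fibre n l (vertex n i) \<Longrightarrow> v \<in> l (i - 1) \<inter> l i"
  unfolding P_fibre_def by blast

text \<open>The cocycle takes values in a subsheaf, but its primitive only in the surrounding
  constant sheaf.\<close>

definition primitive ::
  "'p set \<Rightarrow> ('p::topological_space \<Rightarrow> 'p set) \<Rightarrow> ('p, 'a::ab_group_add) cochain \<Rightarrow> ('p \<Rightarrow> 'p \<Rightarrow> 'a) \<Rightarrow> bool" where
  "primitive I N c b \<longleftrightarrow> (\<forall>x\<in>I. loc_const (b x) (N x)) \<and>
     (\<forall>x\<in>I. \<forall>y\<in>I. \<forall>p\<in>N x \<inter> N y. b y p - b x p = c [x, y] p)"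

lemma cochain_1_loc_const:
  assumes "c \<in> cochains A I N 1" "x \<in> I" "y \<in> I"
  shows "loc_const (c [x, y]) (N x \<inter> N y)"
    and "p \<in> N x \<Longrightarrow> p \<in> N y \<Longrightarrow> c [x, y] p \<in> A p"
  using cochain_section[OF assms(1), of "[x, y]"] assms(2,3) by (auto simp: sections_iff)

lemma primitive_exists:
  fixes A :: "'p::real_normed_vector \<Rightarrow> 'a::ab_group_add set"
  assumes "compact D" "convex D" "\<And>p. 0 \<in> A p" "open_cover D I N" "c \<in> cocycles A I N 1"
  shows "\<exists>b. primitive I N c b"
proof -
  have c: "c \<in> cochains A I N 1"
    "\<And>x y z p. x \<in> I \<Longrightarrow> y \<in> I \<Longrightarrow> z \<in> I \<Longrightarrow> p \<in> N x \<Longrightarrow> p \<in> N y \<Longrightarrow> p \<in> N z \<Longrightarrow>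
       c [y, z] p - c [x, z] p + c [x, y] p = 0"
    using assms(5) unfolding cocycles_1_iff[of A, OF assms(3)] by auto
  have add: "c [x, y] p + c [y, z] p = c [x, z] p"
    if "x \<in> I" "y \<in> I" "z \<in> I" "p \<in> N x" "p \<in> N y" "p \<in> N z" for x y z p
    using c(2)[OF that] by (simp add: algebra_simps add_eq_0_iff)
  have "\<exists>b. (\<forall>x\<in>I. loc_const (b x) (N x)) \<and>
    (\<forall>x\<in>I. \<forall>y\<in>I. \<forall>p\<in>N x \<inter> N y. b y p - b x p = c [x, y] p)"
    by (rule loc_const_1_cocycle_exact[OF assms(1,2)])
      (use open_coverD[OF assms(4)] cochain_1_loc_const[OF c(1)] add in auto)
  then show ?thesis unfolding primitive_def .
qed

text \<open>For each vertex a member of the cover that contains it, in order to evaluate a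
  primitive there.\<close>

definition vertex_index :: "nat \<Rightarrow> complex set \<Rightarrow> (complex \<Rightarrow> complex set) \<Rightarrow> (int \<Rightarrow> complex) \<Rightarrow> bool" where
  "vertex_index n I N \<xi> \<longleftrightarrow> periodic n \<xi> \<and> (\<forall>i. \<xi> i \<in> I \<and> vertex n i \<in> N (\<xi> i))"

definition vertex_jumps :: "nat \<Rightarrow> (complex \<Rightarrow> complex \<Rightarrow> 'v::ab_group_add) \<Rightarrow> (int \<Rightarrow> complex) \<Rightarrow> int \<Rightarrow> 'v" where
  "vertex_jumps n b \<xi> i = b (\<xi> (i + 1)) (vertex n (i + 1)) - b (\<xi> i) (vertex n i)"

lemma (in ngon) vertex_index_exists:
  assumes "open_cover (polygon n) I N"
  shows "\<exists>\<xi>. vertex_index n I N \<xi>"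
proof -
  define \<xi> where "\<xi> i = (SOME x. x \<in> I \<and> vertex n i \<in> N x)" for i
  have "\<xi> i \<in> I \<and> vertex n i \<in> N (\<xi> i)" for i
    unfolding \<xi>_def by (rule someI_ex)
      (use open_coverD(3)[OF assms] vertex_in_polygon[of i] in blast)
  moreover have "periodic n \<xi>"
    using periodic_vertex by (simp add: periodic_def \<xi>_def)
  ultimately show ?thesis unfolding vertex_index_def by blast
qed

lemma cech_relI:
  assumes "(I, N, c) \<in> cech_cocycles D A k" "(I', N', c') \<in> cech_cocycles D A k"
    "open_cover D J M" "refines J M I N \<tau>" "refines J M I' N' \<tau>'"
    "pullback J M \<tau> c - pullback J M \<tau>' c' \<in> coboundaries A J M k"
  shows "((I, N, c), (I', N', c')) \<in> cech_rel D A k"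
proof -
  have "\<exists>J M \<tau> \<tau>'. open_cover D J M \<and> refines J M I N \<tau> \<and> refines J M I' N' \<tau>' \<and>
           pullback J M \<tau> c - pullback J M \<tau>' c' \<in> coboundaries A J M k"
    using assms by blast
  then show ?thesis unfolding cech_rel_def using assms(1,2) by simp
qed

lemma cech_rel_refl:
  assumes "\<And>p. 0 \<in> A p" "x \<in> cech_cocycles D A k"
  shows "(x, x) \<in> cech_rel D A k"
proof -
  obtain I N c where x: "x = (I, N, c)" by (cases x) auto
  have "open_cover D I N" using assms(2) x by (simp add: cech_cocycles_def)
  then show ?thesis
    unfolding x using refines_id[of I N] zero_coboundary[of A I N k, OF assms(1)] assms(2) x
    by (intro cech_relI[of _ _ _ _ _ _ _ _ _ I N id id]) simp_all
qed

context lagrangian_ngon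
begin

lemma P_closed:
  "0 \<in> P_fibre n l p" "x \<in> P_fibre n l p \<Longrightarrow> y \<in> P_fibre n l p \<Longrightarrow> x + y \<in> P_fibre n l p"
  "x \<in> P_fibre n l p \<Longrightarrow> y \<in> P_fibre n l p \<Longrightarrow> x - y \<in> P_fibre n l p"
  "x \<in> P_fibre n l p \<Longrightarrow> smul a x \<in> P_fibre n l p"
  using lagrangian_closed by (simp_all add: P_fibre_iff)

text \<open>The fibres of the sheaf on the closed edge \<open>i\<close> lie in \<open>l
  i\<close>, so that the primitive is well defined modulo \<open>l i\<close> and locally constant
  there; the edge is connected.\<close>

lemma primitive_on_edge:
  assumes cov: "open_cover (polygon n) I N" and c: "c \<in> cocycles (P_fibre n l) I N 1"
    and b: "primitive I N c b"
    and x: "x \<in> I" "p \<in> N x" "p \<in> edge n i" and y: "y \<in> I" "q \<in> N y" "q \<in> edge n i"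
  shows "b x p - b y q \<in> l i"
proof -
  have b': "\<And>x. x \<in> I \<Longrightarrow> loc_const (b x) (N x)"
    "\<And>x y p. x \<in> I \<Longrightarrow> y \<in> I \<Longrightarrow> p \<in> N x \<Longrightarrow> p \<in> N y \<Longrightarrow> b y p - b x p = c [x, y] p"
    using b by (auto simp: primitive_def)
  have cc: "c \<in> cochains (P_fibre n l) I N 1" using c by (simp add: cocycles_def)
  have "\<exists>k. \<forall>x\<in>I. \<forall>p\<in>N x \<inter> edge n i. (b x p - b y q \<in> l i) = k"
  proof (rule glued_const[of "edge n i"])
    show "edge n i \<subseteq> (\<Union>x\<in>I. N x \<inter> edge n i)"
      using open_coverD(3)[OF cov] edge_subset_polygon[of i] by blast
    show "openin (top_of_set (edge n i)) (N x \<inter> edge n i)" if "x \<in> I" for x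
      using openin_restrict[OF open_coverD(1)[OF cov that] edge_subset_polygon] .
    show "loc_const (\<lambda>p. b x p - b y q \<in> l i) (N x \<inter> edge n i)" if "x \<in> I" for x
      by (rule loc_const_comp[of _ _ "\<lambda>v. v - b y q \<in> l i"], rule loc_const_mono[OF b'(1)[OF that]]) blast
    show "(b x p - b y q \<in> l i) = (b x' p - b y q \<in> l i)"
      if "x \<in> I" "x' \<in> I" "p \<in> N x \<inter> edge n i" "p \<in> N x' \<inter> edge n i" for x x' p
    proof -
      have "c [x, x'] p \<in> P_fibre n l p" using cochain_1_loc_const(2)[OF cc] that by blast
      then have "c [x, x'] p \<in> l i" using that(4) unfolding P_fibre_iff by blast
      then have "b x' p - b x p \<in> l i" using b'(2)[of x x' p] that by simp
      then show ?thesis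
        using lagrangian_closed(2)[of "b x p - b y q" i "b x' p - b x p"]
          lagrangian_closed(3)[of "b x' p - b y q" i "b x' p - b x p"] by auto
    qed
  qed simp
  then have "(b x p - b y q \<in> l i) = (b y q - b y q \<in> l i)" using x y by blast
  then show ?thesis using lagrangian_closed(1) by simp
qed

lemma vertex_jumps_in_K:
  assumes cov: "open_cover (polygon n) I N" and c: "c \<in> cocycles (P_fibre n l) I N 1"
    and b: "primitive I N c b" and \<xi>: "vertex_index n I N \<xi>"
  shows "vertex_jumps n b \<xi> \<in> K_space n l"
proof -
  have \<xi>': "\<And>i. \<xi> i \<in> I" "\<And>i. vertex n i \<in> N (\<xi> i)" using \<xi> by (auto simp: vertex_index_def)
  have p: "periodic n (\<lambda>i. b (\<xi> i) (vertex n i))"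
    using \<xi> periodic_vertex by (simp add: vertex_index_def periodic_def)
  have "vertex_jumps n b \<xi> i \<in> l i" for i
    unfolding vertex_jumps_def by (rule primitive_on_edge[OF cov c b]) (use \<xi>' in auto)
  moreover have "(\<Sum>i\<in>{0..<int n}. vertex_jumps n b \<xi> i) = 0"
    unfolding vertex_jumps_def by (rule sum_periodic_difference(1)[OF p n_gt0])
  moreover have "periodic n (vertex_jumps n b \<xi>)"
    unfolding periodic_def vertex_jumps_def
  proof
    fix i
    have "b (\<xi> (i + 1 + int n)) (vertex n (i + 1 + int n)) = b (\<xi> (i + 1)) (vertex n (i + 1))"
      "b (\<xi> (i + int n)) (vertex n (i + int n)) = b (\<xi> i) (vertex n i)"
      using p unfolding periodic_def by blast+
    then show "b (\<xi> (i + int n + 1)) (vertex n (i + int n + 1)) - b (\<xi> (i + int n)) (vertex n (i + int n))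
        = b (\<xi> (i + 1)) (vertex n (i + 1)) - b (\<xi> i) (vertex n i)"
      by (simp add: add.commute add.left_commute)
  qed
  ultimately show ?thesis by (simp add: K_space_def)
qed

text \<open>If two cocycles differ by a coboundary of \<open>a\<close> on a refinement, then the
  difference of their primitives is \<open>a\<close> plus one constant \<open>k\<close>, and at
  vertex \<open>i\<close> it is \<open>k + u i\<close> with \<open>u i\<close> in the fibre of the
  sheaf. Conversely, once \<open>k\<close> is subtracted, the difference of the primitives has
  values in the fibres at the vertices, hence by \<open>primitive_on_edge\<close> on all edges,
  and there is no condition in the interior.\<close>

lemma cech_rel_iff_jumps:
  assumes cov: "open_cover (polygon n) I N" "open_cover (polygon n) I' N'"
    and c: "c \<in> cocycles (P_fibre n l) I N 1" "c' \<in> cocycles (P_fibre n l) I' N' 1"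
    and b: "primitive I N c b" "primitive I' N' c' b'"
    and \<xi>: "vertex_index n I N \<xi>" "vertex_index n I' N' \<xi>'"
  shows "((I, N, c), (I', N', c')) \<in> cech_rel (polygon n) (P_fibre n l) 1 \<longleftrightarrow>
    (\<lambda>i. vertex_jumps n b \<xi> i - vertex_jumps n b' \<xi>' i) \<in> q_kernel n B l" (is "?l \<longleftrightarrow> ?r")
proof -
  note ker = q_kernel_iff
  have \<xi>1: "\<And>i. \<xi> i \<in> I" "\<And>i. vertex n i \<in> N (\<xi> i)" and \<xi>2: "\<And>i. \<xi>' i \<in> I'" "\<And>i. vertex n i \<in> N' (\<xi>' i)"
    and \<xi>p: "periodic n \<xi>" "periodic n \<xi>'"
    using \<xi> by (auto simp: vertex_index_def)
  have b1: "\<And>x. x \<in> I \<Longrightarrow> loc_const (b x) (N x)"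
    "\<And>x y p. x \<in> I \<Longrightarrow> y \<in> I \<Longrightarrow> p \<in> N x \<Longrightarrow> p \<in> N y \<Longrightarrow> c [x, y] p = b y p - b x p"
    and b2: "\<And>x. x \<in> I' \<Longrightarrow> loc_const (b' x) (N' x)"
    "\<And>x y p. x \<in> I' \<Longrightarrow> y \<in> I' \<Longrightarrow> p \<in> N' x \<Longrightarrow> p \<in> N' y \<Longrightarrow> c' [x, y] p = b' y p - b' x p"
    using b by (auto simp: primitive_def)
  have cc: "c \<in> cochains (P_fibre n l) I N 1" "c' \<in> cochains (P_fibre n l) I' N' 1"
    using c by (auto simp: cocycles_def)
  have diff_cochain: "pullback J M \<tau> c - pullback J M \<tau>' c' \<in> cochains (P_fibre n l) J M 1"
    if "refines J M I N \<tau>" "refines J M I' N' \<tau>'" for J M \<tau> \<tau>'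
    using pullback_cochain[OF that(1) cc(1)] pullback_cochain[OF that(2) cc(2)]
    by (rule cochain_diff[rotated]) (rule P_closed)
  have diff_apply: "(pullback J M \<tau> c - pullback J M \<tau>' c') [x, y] p
      = (b (\<tau> y) p - b' (\<tau>' y) p) - (b (\<tau> x) p - b' (\<tau>' x) p)"
    if "refines J M I N \<tau>" "refines J M I' N' \<tau>'" "x \<in> J" "y \<in> J" "p \<in> M x" "p \<in> M y" for J M \<tau> \<tau>' x y p
  proof -
    have "\<tau> x \<in> I" "\<tau> y \<in> I" "\<tau>' x \<in> I'" "\<tau>' y \<in> I'" "p \<in> N (\<tau> x)" "p \<in> N (\<tau> y)" "p \<in> N' (\<tau>' x)" "p \<in> N' (\<tau>' y)"
      using that unfolding refines_def by auto
    then show ?thesis using that(3-) by (simp add: pullback_apply b1(2) b2(2) algebra_simps)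
  qed
  have lc: "loc_const (\<lambda>p. b (\<tau> x) p - b' (\<tau>' x) p) (M x)"
    if "refines J M I N \<tau>" "refines J M I' N' \<tau>'" "x \<in> J" for J M \<tau> \<tau>' x
  proof -
    have "\<tau> x \<in> I" "M x \<subseteq> N (\<tau> x)" "\<tau>' x \<in> I'" "M x \<subseteq> N' (\<tau>' x)" using that by (auto simp: refines_def)
    then show ?thesis using b1(1) b2(1) by (intro loc_const_comp2[of _ _ _ "(-)"]) (blast intro: loc_const_mono)+
  qed
  show ?thesis
  proof
    assume ?l
    then obtain J M \<tau> \<tau>' where J: "open_cover (polygon n) J M" and r: "refines J M I N \<tau>" "refines J M I' N' \<tau>'"
      and cob: "pullback J M \<tau> c - pullback J M \<tau>' c' \<in> coboundaries (P_fibre n l) J M 1"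
      unfolding cech_rel_def by auto
    obtain a where A: "\<forall>x\<in>J. loc_const (a x) (M x) \<and> (\<forall>p\<in>M x. a x p \<in> P_fibre n l p)"
      "\<forall>x\<in>J. \<forall>y\<in>J. \<forall>p\<in>M x \<inter> M y. (pullback J M \<tau> c - pullback J M \<tau>' c') [x, y] p = a y p - a x p"
      using cob unfolding coboundaries_1_iff[OF diff_cochain[OF r]] by blast
    then have a: "\<And>x. x \<in> J \<Longrightarrow> loc_const (a x) (M x)" "\<And>x p. x \<in> J \<Longrightarrow> p \<in> M x \<Longrightarrow> a x p \<in> P_fibre n l p"
      "\<And>x y p. x \<in> J \<Longrightarrow> y \<in> J \<Longrightarrow> p \<in> M x \<Longrightarrow> p \<in> M y \<Longrightarrow>
         (pullback J M \<tau> c - pullback J M \<tau>' c') [x, y] p = a y p - a x p"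
      by blast+
    have "\<exists>k. \<forall>x\<in>J. \<forall>p\<in>M x. (b (\<tau> x) p - b' (\<tau>' x) p) - a x p = k"
    proof (rule glued_const[of "polygon n"])
      show "connected (polygon n)" using convex_polygon by (rule convex_connected)
      show "loc_const (\<lambda>p. (b (\<tau> x) p - b' (\<tau>' x) p) - a x p) (M x)" if "x \<in> J" for x
        using loc_const_comp2[OF lc[OF r that] a(1)[OF that], of "(-)"] .
      show "(b (\<tau> x) p - b' (\<tau>' x) p) - a x p = (b (\<tau> y) p - b' (\<tau>' y) p) - a y p"
        if "x \<in> J" "y \<in> J" "p \<in> M x" "p \<in> M y" for x y p
      proof -
        have "a y p - a x p = (b (\<tau> y) p - b' (\<tau>' y) p) - (b (\<tau> x) p - b' (\<tau>' x) p)"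
          using a(3)[OF that] diff_apply[OF r that] by metis
        then show ?thesis by (simp add: algebra_simps)
      qed
    qed (use open_coverD[OF J] in auto)
    then obtain k where k: "\<And>x p. x \<in> J \<Longrightarrow> p \<in> M x \<Longrightarrow> (b (\<tau> x) p - b' (\<tau>' x) p) - a x p = k" by blast
    define u where "u i = b (\<xi> i) (vertex n i) - b' (\<xi>' i) (vertex n i) - k" for i
    have "u i \<in> P_fibre n l (vertex n i)" for i
    proof -
      obtain x where x: "x \<in> J" "vertex n i \<in> M x"
        using open_coverD(3)[OF J] vertex_in_polygon[of i] by blast
      let ?v = "vertex n i"
      have t: "\<tau> x \<in> I" "?v \<in> N (\<tau> x)" "\<tau>' x \<in> I'" "?v \<in> N' (\<tau>' x)" using r x unfolding refines_def by auto
      have "c [\<tau> x, \<xi> i] ?v \<in> P_fibre n l ?v" "c' [\<tau>' x, \<xi>' i] ?v \<in> P_fibre n l ?v"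
        using cochain_1_loc_const(2)[OF cc(1) t(1) \<xi>1(1)[of i]] cochain_1_loc_const(2)[OF cc(2) t(3) \<xi>2(1)[of i]]
          t \<xi>1 \<xi>2 by auto
      then have "(c [\<tau> x, \<xi> i] ?v - c' [\<tau>' x, \<xi>' i] ?v) + a x ?v \<in> P_fibre n l ?v"
        using a(2)[OF x] by (intro P_closed)
      moreover have ax: "a x ?v = (b (\<tau> x) ?v - b' (\<tau>' x) ?v) - k"
        unfolding k[OF x, symmetric] by simp
      have "(c [\<tau> x, \<xi> i] ?v - c' [\<tau>' x, \<xi>' i] ?v) + a x ?v = u i"
        unfolding b1(2)[OF t(1) \<xi>1(1)[of i] t(2) \<xi>1(2)] b2(2)[OF t(3) \<xi>2(1)[of i] t(4) \<xi>2(2)] ax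
        by (simp add: u_def algebra_simps)
      ultimately show ?thesis by simp
    qed
    then have "u i \<in> l (i - 1) \<inter> l i" for i by (rule P_fibre_vertex)
    moreover have "periodic n u" using \<xi>p periodic_vertex by (simp add: u_def periodic_def)
    moreover have "vertex_jumps n b \<xi> i - vertex_jumps n b' \<xi>' i = u (i + 1) - u i" for i
      by (simp add: u_def vertex_jumps_def)
    ultimately show ?r unfolding ker by blast
  next
    assume ?r
    then obtain u where u: "periodic n u" "\<And>i. u i \<in> l (i - 1)" "\<And>i. u i \<in> l i"
      "\<And>i. vertex_jumps n b \<xi> i - vertex_jumps n b' \<xi>' i = u (i + 1) - u i" unfolding ker by blast
    \<comment> \<open>the primitives and \<open>u\<close> have the same jumps, so this does not depend on the vertex\<close>
  define k where "k = b (\<xi> 0) (vertex n 0) - b' (\<xi>' 0) (vertex n 0) - u 0"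
    have k: "b (\<xi> i) (vertex n i) - b' (\<xi>' i) (vertex n i) - u i = k" for i
    proof -
      have "b (\<xi> (i + 1)) (vertex n (i + 1)) - b' (\<xi>' (i + 1)) (vertex n (i + 1)) - u (i + 1)
          = b (\<xi> i) (vertex n i) - b' (\<xi>' i) (vertex n i) - u i" for i
        using u(4)[of i] by (simp add: vertex_jumps_def algebra_simps)
      then show ?thesis unfolding k_def
        by (rule int_shift_invariant[of "\<lambda>i. b (\<xi> i) (vertex n i) - b' (\<xi>' i) (vertex n i) - u i"])
    qed
    obtain M \<tau> \<tau>' where M: "open_cover (polygon n) (polygon n) M"
      and r: "refines (polygon n) M I N \<tau>" "refines (polygon n) M I' N' \<tau>'"
      by (rule common_refinement[OF cov])
    define a where "a x p = (b (\<tau> x) p - b' (\<tau>' x) p) - k" for x p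
    have "a x p \<in> P_fibre n l p" if x: "x \<in> polygon n" "p \<in> M x" for x p
      unfolding P_fibre_iff
    proof (intro allI impI)
      fix i assume p: "p \<in> edge n i"
      have t: "\<tau> x \<in> I" "p \<in> N (\<tau> x)" "\<tau>' x \<in> I'" "p \<in> N' (\<tau>' x)" using r x unfolding refines_def by auto
      have "b (\<tau> x) p - b (\<xi> i) (vertex n i) \<in> l i"
        by (rule primitive_on_edge[OF cov(1) c(1) b(1)]) (use t p \<xi>1 in auto)
      moreover have "b' (\<tau>' x) p - b' (\<xi>' i) (vertex n i) \<in> l i"
        by (rule primitive_on_edge[OF cov(2) c(2) b(2)]) (use t p \<xi>2 in auto)
      ultimately have "((b (\<tau> x) p - b (\<xi> i) (vertex n i)) - (b' (\<tau>' x) p - b' (\<xi>' i) (vertex n i))) + u i \<in> l i"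
        by (rule lagrangian_closed(2)[OF lagrangian_closed(3) u(3)])
      then show "a x p \<in> l i" unfolding a_def k[of i, symmetric] by (simp add: algebra_simps)
    qed
    moreover have "loc_const (a x) (M x)" if "x \<in> polygon n" for x
      using loc_const_comp[OF lc[OF r that], of "\<lambda>v. v - k"] by (simp add: a_def[abs_def])
    moreover have "(pullback (polygon n) M \<tau> c - pullback (polygon n) M \<tau>' c') [x, y] p = a y p - a x p"
      if "x \<in> polygon n" "y \<in> polygon n" "p \<in> M x \<inter> M y" for x y p
      using diff_apply[OF r that(1,2)] that(3) by (simp add: a_def)
    ultimately have "pullback (polygon n) M \<tau> c - pullback (polygon n) M \<tau>' c'
        \<in> coboundaries (P_fibre n l) (polygon n) M 1"
      unfolding coboundaries_1_iff[OF diff_cochain[OF r]] by blast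
    then show ?l using cov c M r by (intro cech_relI[of _ _ _ _ _ _ _ _ _ "polygon n" M \<tau> \<tau>']) (auto simp: cech_cocycles_def)
  qed
qed

text \<open>The choices of a primitive and of indices do not matter, by
  \<open>H1_value_eq\<close>.\<close>

definition H1_value :: "(complex, 'v) cech \<Rightarrow> (int \<Rightarrow> 'v) set" where
  "H1_value = (\<lambda>(I, N, c). T_class n B l (vertex_jumps n (SOME b. primitive I N c b) (SOME \<xi>. vertex_index n I N \<xi>)))"

lemmas primitive_ex = primitive_exists[OF compact_polygon convex_polygon, of "P_fibre n l", OF P_closed(1)]

lemma H1_value_eq:
  assumes "open_cover (polygon n) I N" "c \<in> cocycles (P_fibre n l) I N 1"
    and b: "primitive I N c b" and \<xi>: "vertex_index n I N \<xi>"
  shows "H1_value (I, N, c) = T_class n B l (vertex_jumps n b \<xi>)"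
proof -
  define b' where "b' = (SOME b. primitive I N c b)"
  define \<xi>' where "\<xi>' = (SOME \<xi>. vertex_index n I N \<xi>)"
  have b': "primitive I N c b'" unfolding b'_def using someI_ex[of "primitive I N c"] b by blast
  have \<xi>': "vertex_index n I N \<xi>'" unfolding \<xi>'_def using someI_ex[of "vertex_index n I N"] \<xi> by blast
  have "((I, N, c), (I, N, c)) \<in> cech_rel (polygon n) (P_fibre n l) 1"
    by (rule cech_rel_refl) (use assms P_closed in \<open>auto simp: cech_cocycles_def\<close>)
  then have "(\<lambda>i. vertex_jumps n b' \<xi>' i - vertex_jumps n b \<xi> i) \<in> q_kernel n B l"
    using cech_rel_iff_jumps[OF assms(1,1,2,2) b' b \<xi>' \<xi>] by blast
  then show ?thesis
    unfolding H1_value_def prod.case b'_def[symmetric] \<xi>'_def[symmetric]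
    using T_class_eq_iff[OF vertex_jumps_in_K[OF assms(1,2) b' \<xi>'] vertex_jumps_in_K[OF assms(1,2) b \<xi>]]
    by blast
qed

lemma cech_cocycle_1E:
  assumes "(I, N, c) \<in> cech_cocycles (polygon n) (P_fibre n l) 1"
  obtains b \<xi> where "open_cover (polygon n) I N" "c \<in> cocycles (P_fibre n l) I N 1"
    "primitive I N c b" "vertex_index n I N \<xi>" "vertex_jumps n b \<xi> \<in> K_space n l"
    "H1_value (I, N, c) = T_class n B l (vertex_jumps n b \<xi>)"
proof -
  have C: "open_cover (polygon n) I N" "c \<in> cocycles (P_fibre n l) I N 1"
    using assms by (auto simp: cech_cocycles_def)
  obtain b where b: "primitive I N c b" using primitive_ex[OF C] by blast
  obtain \<xi> where \<xi>: "vertex_index n I N \<xi>" using vertex_index_exists[OF C(1)] by blast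
  show ?thesis using that[OF C b \<xi> vertex_jumps_in_K[OF C b \<xi>] H1_value_eq[OF C b \<xi>]] .
qed

lemma H1_rel:
  "(x, y) \<in> cech_rel (polygon n) (P_fibre n l) 1 \<longleftrightarrow>
    x \<in> cech_cocycles (polygon n) (P_fibre n l) 1 \<and> y \<in> cech_cocycles (polygon n) (P_fibre n l) 1 \<and>
    H1_value x = H1_value y"
proof (cases "x \<in> cech_cocycles (polygon n) (P_fibre n l) 1 \<and> y \<in> cech_cocycles (polygon n) (P_fibre n l) 1")
  case True
  obtain I N c I' N' c' where xy: "x = (I, N, c)" "y = (I', N', c')" by (cases x, cases y) auto
  obtain b \<xi> where 1: "open_cover (polygon n) I N" "c \<in> cocycles (P_fibre n l) I N 1"
    "primitive I N c b" "vertex_index n I N \<xi>" "vertex_jumps n b \<xi> \<in> K_space n l"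
    "H1_value (I, N, c) = T_class n B l (vertex_jumps n b \<xi>)"
    using cech_cocycle_1E[of I N c] True xy by blast
  obtain b' \<xi>' where 2: "open_cover (polygon n) I' N'" "c' \<in> cocycles (P_fibre n l) I' N' 1"
    "primitive I' N' c' b'" "vertex_index n I' N' \<xi>'" "vertex_jumps n b' \<xi>' \<in> K_space n l"
    "H1_value (I', N', c') = T_class n B l (vertex_jumps n b' \<xi>')"
    using cech_cocycle_1E[of I' N' c'] True xy by blast
  show ?thesis
    using True cech_rel_iff_jumps[OF 1(1) 2(1) 1(2) 2(2) 1(3) 2(3) 1(4) 2(4)]
      T_class_eq_iff[OF 1(5) 2(5)] 1(6) 2(6) xy by simp
next
  case False
  then show ?thesis by (auto simp: cech_rel_def)
qed

lemma H1_value_add: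
  assumes "(I, N, c) \<in> cech_cocycles (polygon n) (P_fibre n l) 1" "(I, N, c') \<in> cech_cocycles (polygon n) (P_fibre n l) 1"
  shows "H1_value (I, N, c + c') = T_add n B l (H1_value (I, N, c)) (H1_value (I, N, c'))"
proof -
  obtain b \<xi> where 1: "open_cover (polygon n) I N" "c \<in> cocycles (P_fibre n l) I N 1"
    "primitive I N c b" "vertex_index n I N \<xi>" "vertex_jumps n b \<xi> \<in> K_space n l"
    "H1_value (I, N, c) = T_class n B l (vertex_jumps n b \<xi>)"
    using cech_cocycle_1E[OF assms(1)] by blast
  obtain b' where 2: "c' \<in> cocycles (P_fibre n l) I N 1" "primitive I N c' b'"
    using cech_cocycle_1E[OF assms(2)] by blast
  have j: "vertex_jumps n (\<lambda>x p. b x p + b' x p) \<xi> = (\<lambda>i. vertex_jumps n b \<xi> i + vertex_jumps n b' \<xi> i)"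
    by (intro ext) (simp add: vertex_jumps_def)
  have "primitive I N (c + c') (\<lambda>x p. b x p + b' x p)"
    unfolding primitive_def
  proof (intro conjI ballI)
    fix x assume "x \<in> I"
    then show "loc_const (\<lambda>p. b x p + b' x p) (N x)"
      using 1(3) 2(2) by (intro loc_const_comp2[of _ _ _ "(+)"]) (auto simp: primitive_def)
  next
    fix x y p assume "x \<in> I" "y \<in> I" "p \<in> N x \<inter> N y"
    then have "b y p - b x p = c [x, y] p" "b' y p - b' x p = c' [x, y] p"
      using 1(3) 2(2) by (auto simp: primitive_def)
    then show "b y p + b' y p - (b x p + b' x p) = (c + c') [x, y] p"
      by (simp add: add_diff_add)
  qed
  moreover have "c + c' \<in> cocycles (P_fibre n l) I N 1"
    by (rule cocycle_add[OF _ 1(2) 2(1)]) (rule P_closed)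
  ultimately have "H1_value (I, N, c + c') = T_class n B l (\<lambda>i. vertex_jumps n b \<xi> i + vertex_jumps n b' \<xi> i)"
    using H1_value_eq[OF 1(1) _ _ 1(4)] unfolding j[symmetric] by blast
  then show ?thesis
    unfolding 1(6) H1_value_eq[OF 1(1) 2 1(4)]
      T_add_class[OF 1(5) vertex_jumps_in_K[OF 1(1) 2 1(4)]] .
qed

lemma H1_value_scale:
  assumes "(I, N, c) \<in> cech_cocycles (polygon n) (P_fibre n l) 1"
  shows "H1_value (I, N, \<lambda>xs p. smul a (c xs p)) = T_scale n smul B l a (H1_value (I, N, c))"
proof -
  interpret V: vector_space smul by (rule symplectic_vector_space)
  obtain b \<xi> where 1: "open_cover (polygon n) I N" "c \<in> cocycles (P_fibre n l) I N 1"
    "primitive I N c b" "vertex_index n I N \<xi>" "vertex_jumps n b \<xi> \<in> K_space n l"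
    "H1_value (I, N, c) = T_class n B l (vertex_jumps n b \<xi>)"
    using cech_cocycle_1E[OF assms(1)] by blast
  have j: "vertex_jumps n (\<lambda>x p. smul a (b x p)) \<xi> = (\<lambda>i. smul a (vertex_jumps n b \<xi> i))"
    by (intro ext) (simp add: vertex_jumps_def V.scale_right_diff_distrib)
  have "primitive I N (\<lambda>xs p. smul a (c xs p)) (\<lambda>x p. smul a (b x p))"
    using 1(3) unfolding primitive_def
    by (auto intro!: loc_const_comp[of _ _ "smul a"] simp flip: V.scale_right_diff_distrib)
  moreover have "(\<lambda>xs p. smul a (c xs p)) \<in> cocycles (P_fibre n l) I N 1"
    by (rule cocycle_map[OF _ _ _ 1(2)]) (auto simp: V.scale_right_distrib P_closed)
  ultimately have "H1_value (I, N, \<lambda>xs p. smul a (c xs p)) = T_class n B l (\<lambda>i. smul a (vertex_jumps n b \<xi> i))"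
    using H1_value_eq[OF 1(1) _ _ 1(4)] unfolding j[symmetric] by blast
  then show ?thesis
    unfolding 1(6) T_scale_class[OF 1(5)] .
qed

lemma vertex_index_star: "vertex_index n (tri_vertices n) (star n) (vertex n)"
  using periodic_vertex vertex_in_star by (auto simp: vertex_index_def tri_vertices_def)

lemma H1_value_star:
  assumes \<alpha>: "\<alpha> \<in> cocycles (P_fibre n l) (tri_vertices n) (star n) 1"
  shows "edge_value n \<alpha> \<in> K_space n l"
    and "H1_value (tri_vertices n, star n, \<alpha>) = T_class n B l (edge_value n \<alpha>)"
proof -
  note cov = open_cover_star
  obtain b where b: "primitive (tri_vertices n) (star n) \<alpha> b" using primitive_ex[OF cov \<alpha>] by blast
  have tv: "vertex n i \<in> tri_vertices n" for i by (simp add: tri_vertices_def)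
  have lc: "loc_const (b (vertex n i)) (star n (vertex n i))" for i
    using b tv by (simp add: primitive_def)
  have "edge_value n \<alpha> i = vertex_jumps n b (vertex n) i" for i
  proof -
    let ?m = "midpoint (vertex n i) (vertex n (i + 1))"
    have m: "?m \<in> star n (vertex n i)" "?m \<in> star n (vertex n (i + 1))"
      using half_edge_in_star[of i] by (auto simp: midpoint_sym)
    have "b (vertex n i) (vertex n i) = b (vertex n i) ?m"
      by (rule loc_const_convex_eq[OF lc convex_closed_segment half_edge_in_star(1)]) auto
    moreover have "b (vertex n (i + 1)) (vertex n (i + 1)) = b (vertex n (i + 1)) ?m"
      by (rule loc_const_convex_eq[OF lc convex_closed_segment half_edge_in_star(2)]) (auto simp: midpoint_sym)
    moreover have "\<alpha> [vertex n i, vertex n (i + 1)] ?m = b (vertex n (i + 1)) ?m - b (vertex n i) ?m"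
      using b tv m by (simp add: primitive_def)
    ultimately show ?thesis by (simp add: edge_value_def vertex_jumps_def)
  qed
  then have e: "edge_value n \<alpha> = vertex_jumps n b (vertex n)" by blast
  show "edge_value n \<alpha> \<in> K_space n l" unfolding e
    by (rule vertex_jumps_in_K[OF cov \<alpha> b vertex_index_star])
  show "H1_value (tri_vertices n, star n, \<alpha>) = T_class n B l (edge_value n \<alpha>)" unfolding e
    by (rule H1_value_eq[OF cov \<alpha> b vertex_index_star])
qed

text \<open>Given \<open>w\<close>, the shifted antiderivative serves as a constant primitive on
  the star of each vertex; its differences across an edge are \<open>\<plusminus>w i \<in> l
  i\<close>.\<close>

lemma H1_value_range: "H1_value ` cech_cocycles (polygon n) (P_fibre n l) 1 = T_space n B l"
proof (intro equalityI subsetI)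
  fix t assume "t \<in> H1_value ` cech_cocycles (polygon n) (P_fibre n l) 1"
  then obtain I N c where "(I, N, c) \<in> cech_cocycles (polygon n) (P_fibre n l) 1" "t = H1_value (I, N, c)"
    by force
  then show "t \<in> T_space n B l"
    unfolding T_space_eq by (metis cech_cocycle_1E imageI)
next
  fix t assume "t \<in> T_space n B l"
  then obtain w where w: "w \<in> K_space n l" "t = T_class n B l w" unfolding T_space_eq by blast
  obtain h where h: "antiderivative n w h" using K_space_antiderivative[OF w(1)] by blast
  define g where "g i = h (i - 1)" for i
  have hp: "periodic n h" using h by (simp add: antiderivative_def)
  have gp: "periodic n g"
    unfolding periodic_def g_def using hp[unfolded periodic_def, rule_format, of "_ - 1"] by (simp add: algebra_simps)
  have gw: "g (i + 1) - g i = w i" for i using h by (simp add: g_def antiderivative_def)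
  define b where "b x = (if x = 0 then 0 else g (SOME i. x = vertex n i))" for x
  have bv: "b (vertex n i) = g i" for i
  proof -
    have "vertex n i = vertex n (SOME j. vertex n i = vertex n j)" by (rule someI[of _ i]) simp
    then have "g i = g (SOME j. vertex n i = vertex n j)"
      using periodic_dvd[OF gp] vertex_eq_iff by blast
    then show ?thesis by (simp add: b_def vertex_nonzero)
  qed
  define c where "c = make_cochain (tri_vertices n) (star n) 1 (\<lambda>xs p. b (xs ! 1) - b (xs ! 0))"
  have c_apply: "c [x, y] p = b y - b x"
    if "x \<in> tri_vertices n" "y \<in> tri_vertices n" "p \<in> star n x" "p \<in> star n y" for x y p
    using that by (simp add: c_def make_cochain_apply)
  have val: "b y - b x \<in> P_fibre n l p"
    if xy: "x \<in> tri_vertices n" "y \<in> tri_vertices n" "p \<in> star n x" "p \<in> star n y" for x y p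
    unfolding P_fibre_iff
  proof (intro allI impI)
    fix i assume p: "p \<in> edge n i"
    have wl: "w i \<in> l i" using w(1) by (simp add: K_space_def)
    have "x = vertex n i \<or> x = vertex n (i + 1)" "y = vertex n i \<or> y = vertex n (i + 1)"
      using edge_star[OF p] xy by blast+
    moreover have "g i - g (i + 1) = - w i" using gw[of i] by (metis minus_diff_eq)
    ultimately show "b y - b x \<in> l i" using gw[of i] lagrangian_closed(1)[of i] lagrangian_closed(4)[OF wl] wl bv by auto
  qed
  have cc: "c \<in> cochains (P_fibre n l) (tri_vertices n) (star n) 1"
    unfolding c_def by (rule make_cochain_in) (auto simp: length_Suc_conv val)
  have c: "c \<in> cocycles (P_fibre n l) (tri_vertices n) (star n) 1"
    unfolding cocycles_1_iff[of "P_fibre n l", OF P_closed(1)] using cc by (auto simp: c_apply)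
  have "primitive (tri_vertices n) (star n) c (\<lambda>x p. b x)"
    unfolding primitive_def by (auto simp: c_apply)
  from H1_value_eq[OF open_cover_star c this vertex_index_star]
  have "H1_value (tri_vertices n, star n, c) = t"
    by (simp add: w(2) vertex_jumps_def[abs_def] bv gw)
  moreover have "(tri_vertices n, star n, c) \<in> cech_cocycles (polygon n) (P_fibre n l) 1"
    using c open_cover_star by (simp add: cech_cocycles_def)
  ultimately show "t \<in> H1_value ` cech_cocycles (polygon n) (P_fibre n l) 1" by blast
qed

end

section \<open>The trace on the second cohomology\<close>

lemma jF_fibre_iff: "v \<in> jF_fibre n p \<longleftrightarrow> p \<in> interior (polygon n) \<or> v = 0"
  by (simp add: jF_fibre_def)

lemma pullback_id:
  assumes "c \<in> cochains A I N k"
  shows "pullback I N id c = c"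
proof (intro ext)
  fix xs p
  show "pullback I N id c xs p = c xs p"
    using cochain_outside[OF assms, of xs p] by (auto simp: pullback_apply)
qed

lemma coboundaries_add:
  fixes A :: "'p::topological_space \<Rightarrow> 'a::ab_group_add set"
  assumes "\<And>p x y. x \<in> A p \<Longrightarrow> y \<in> A p \<Longrightarrow> x + y \<in> A p"
    "c \<in> coboundaries A I N (Suc k)" "c' \<in> coboundaries A I N (Suc k)"
  shows "c + c' \<in> coboundaries A I N (Suc k)"
proof -
  obtain b b' where b: "b \<in> cochains A I N k" "c = cobound I N b" "b' \<in> cochains A I N k" "c' = cobound I N b'"
    using assms(2,3) by auto
  have "b + b' \<in> cochains A I N k"
    using assms(1) b(1,3) unfolding cochains_iff
    by (auto simp: plus_fun_def intro!: loc_const_comp2[of _ _ _ "(+)"])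
  then show ?thesis using b(2,4) by (metis cobound_add coboundaries.simps(2) imageI)
qed

lemma cochain_2_loc_const:
  assumes "c \<in> cochains A I N 2" "x \<in> I" "y \<in> I" "z \<in> I"
  shows "loc_const (c [x, y, z]) (N x \<inter> N y \<inter> N z)"
    and "p \<in> N x \<Longrightarrow> p \<in> N y \<Longrightarrow> p \<in> N z \<Longrightarrow> c [x, y, z] p \<in> A p"
  using cochain_section[OF assms(1), of "[x, y, z]"] assms(2-) by (auto simp: sections_iff Int_assoc)

lemma cocycle_2_apply:
  assumes "\<And>p. 0 \<in> A p" "c \<in> cocycles A I N 2" "x \<in> I" "y \<in> I" "z \<in> I" "w \<in> I"
    "p \<in> N x" "p \<in> N y" "p \<in> N z" "p \<in> N w"
  shows "c [y, z, w] p - c [x, z, w] p + c [x, y, w] p - c [x, y, z] p = 0"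
  using assms unfolding cocycles_2_iff[of A, OF assms(1)] by blast

text \<open>The prism operator of two refinement maps. It takes values in the same sheaf because
  it is an evaluation of the cocycle itself.\<close>

lemma refinements_homotopic:
  fixes A :: "'p::topological_space \<Rightarrow> 'a::ab_group_add set"
  assumes zero: "\<And>p. 0 \<in> A p" and diff: "\<And>p x y. x \<in> A p \<Longrightarrow> y \<in> A p \<Longrightarrow> x - y \<in> A p"
    and c: "c \<in> cocycles A I N 2" and r: "refines J M I N \<tau>" "refines J M I N \<tau>'"
  shows "pullback J M \<tau> c - pullback J M \<tau>' c \<in> coboundaries A J M 2"
proof -
  have cc: "c \<in> cochains A I N 2" using c by (simp add: cocycles_def)
  have ch: "pullback J M \<tau> c - pullback J M \<tau>' c \<in> cochains A J M 2"
    by (rule cochain_diff[OF diff pullback_cochain[OF r(1) cc] pullback_cochain[OF r(2) cc]])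
  have t: "\<tau> x \<in> I" "\<tau>' x \<in> I" "M x \<subseteq> N (\<tau> x)" "M x \<subseteq> N (\<tau>' x)" if "x \<in> J" for x
    using r that by (auto simp: refines_def)
  define \<eta> where "\<eta> x y p = c [\<tau>' x, \<tau> x, \<tau> y] p - c [\<tau>' x, \<tau>' y, \<tau> y] p" for x y p
  have "loc_const (\<eta> x y) (M x \<inter> M y)" if "x \<in> J" "y \<in> J" for x y
  proof -
    have sub: "M x \<inter> M y \<subseteq> N (\<tau>' x) \<inter> N (\<tau> x) \<inter> N (\<tau> y)" "M x \<inter> M y \<subseteq> N (\<tau>' x) \<inter> N (\<tau>' y) \<inter> N (\<tau> y)"
      using t(3,4) that by blast+
    show ?thesis
      unfolding \<eta>_def
      using loc_const_mono[OF cochain_2_loc_const(1)[OF cc t(2)[OF that(1)] t(1)[OF that(1)] t(1)[OF that(2)]] sub(1)]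
        loc_const_mono[OF cochain_2_loc_const(1)[OF cc t(2)[OF that(1)] t(2)[OF that(2)] t(1)[OF that(2)]] sub(2)]
      by (rule loc_const_comp2[of _ _ _ "(-)"])
  qed
  moreover have "\<eta> x y p \<in> A p" if "x \<in> J" "y \<in> J" "p \<in> M x \<inter> M y" for x y p
    unfolding \<eta>_def
    by (intro diff cochain_2_loc_const(2)[OF cc]) (use t[OF that(1)] t[OF that(2)] that(3) in auto)
  moreover have "(pullback J M \<tau> c - pullback J M \<tau>' c) [x, y, z] p = \<eta> y z p - \<eta> x z p + \<eta> x y p"
    if x: "x \<in> J" "y \<in> J" "z \<in> J" "p \<in> M x \<inter> M y \<inter> M z" for x y z p
  proof -
    note T = t[OF x(1)] t[OF x(2)] t[OF x(3)]
    have p: "p \<in> N (\<tau> x)" "p \<in> N (\<tau>' x)" "p \<in> N (\<tau> y)" "p \<in> N (\<tau>' y)" "p \<in> N (\<tau> z)" "p \<in> N (\<tau>' z)"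
      using x(4) T by auto
    note cyc = cocycle_2_apply[OF zero c]
    have "\<eta> y z p - \<eta> x z p + \<eta> x y p = c [\<tau> x, \<tau> y, \<tau> z] p - c [\<tau>' x, \<tau>' y, \<tau>' z] p"
      unfolding \<eta>_def
      by (rule prism_identity[OF cyc[of "\<tau>' x" "\<tau> x" "\<tau> y" "\<tau> z"] cyc[of "\<tau>' x" "\<tau>' y" "\<tau> y" "\<tau> z"]
            cyc[of "\<tau>' x" "\<tau>' y" "\<tau>' z" "\<tau> z"]]) (use T p in auto)
    then show ?thesis using x by (simp add: pullback_apply)
  qed
  ultimately show ?thesis unfolding coboundaries_2_iff[OF ch] by blast
qed

text \<open>The cochain \<open>\<beta>\<close> is a primitive of \<open>\<gamma>\<close> in the
  constant sheaf. As \<open>\<gamma>\<close> vanishes on the boundary, \<open>\<beta>\<close> is a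
  cocycle there and has a primitive \<open>F i\<close> on each closed edge. The mismatch
  \<open>\<kappa> i\<close> at vertex \<open>i\<close> of the primitives on the two adjacent edges
  does not depend on the member of the cover, and the sum of the mismatches is the monodromy of
  \<open>\<beta>\<close> around the boundary: the image of the class under the inverse of the
  connecting map from \<open>H\<^sup>1\<close> of the boundary to \<open>H\<^sup>2\<close>.
  Choosing primitives edge by edge avoids a parametrization of the boundary.\<close>

definition trace_data ::
  "nat \<Rightarrow> complex set \<Rightarrow> (complex \<Rightarrow> complex set) \<Rightarrow> (complex, 'a::ab_group_add) cochain \<Rightarrow>
    (complex \<Rightarrow> complex \<Rightarrow> complex \<Rightarrow> 'a) \<Rightarrow> (int \<Rightarrow> complex \<Rightarrow> complex \<Rightarrow> 'a) \<Rightarrow> (int \<Rightarrow> 'a) \<Rightarrow> bool" where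
  "trace_data n I N \<gamma> \<beta> F \<kappa> \<longleftrightarrow>
    (\<forall>x\<in>I. \<forall>y\<in>I. loc_const (\<beta> x y) (N x \<inter> N y)) \<and>
    (\<forall>x\<in>I. \<forall>y\<in>I. \<forall>z\<in>I. \<forall>p\<in>N x \<inter> N y \<inter> N z. \<gamma> [x, y, z] p = \<beta> y z p - \<beta> x z p + \<beta> x y p) \<and>
    (\<forall>i. \<forall>x\<in>I. loc_const (F i x) (N x \<inter> edge n i)) \<and>
    (\<forall>i. \<forall>x\<in>I. \<forall>y\<in>I. \<forall>p\<in>N x \<inter> N y \<inter> edge n i. F i y p - F i x p = \<beta> x y p) \<and>
    periodic n F \<and> periodic n \<kappa> \<and>
    (\<forall>i. \<forall>x\<in>I. vertex n i \<in> N x \<longrightarrow> F (i - 1) x (vertex n i) - F i x (vertex n i) = \<kappa> i)"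

lemma trace_dataD:
  assumes "trace_data n I N \<gamma> \<beta> F \<kappa>"
  shows "x \<in> I \<Longrightarrow> y \<in> I \<Longrightarrow> loc_const (\<beta> x y) (N x \<inter> N y)"
    and "x \<in> I \<Longrightarrow> y \<in> I \<Longrightarrow> z \<in> I \<Longrightarrow> p \<in> N x \<Longrightarrow> p \<in> N y \<Longrightarrow> p \<in> N z \<Longrightarrow>
           \<gamma> [x, y, z] p = \<beta> y z p - \<beta> x z p + \<beta> x y p"
    and "x \<in> I \<Longrightarrow> loc_const (F i x) (N x \<inter> edge n i)"
    and "x \<in> I \<Longrightarrow> y \<in> I \<Longrightarrow> p \<in> N x \<Longrightarrow> p \<in> N y \<Longrightarrow> p \<in> edge n i \<Longrightarrow> F i y p - F i x p = \<beta> x y p"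
    and "periodic n F" "periodic n \<kappa>"
    and "x \<in> I \<Longrightarrow> vertex n i \<in> N x \<Longrightarrow> F (i - 1) x (vertex n i) - F i x (vertex n i) = \<kappa> i"
  using assms unfolding trace_data_def by blast+

lemma trace_data_pullback:
  assumes T: "trace_data n I N \<gamma> \<beta> F \<kappa>" and r: "refines J M I N \<tau>"
  shows "trace_data n J M (pullback J M \<tau> \<gamma>) (\<lambda>x y. \<beta> (\<tau> x) (\<tau> y)) (\<lambda>i x. F i (\<tau> x)) \<kappa>"
proof -
  have t: "\<tau> x \<in> I" "M x \<subseteq> N (\<tau> x)" if "x \<in> J" for x using r that by (auto simp: refines_def)
  note D = trace_dataD[OF T]
  show ?thesis unfolding trace_data_def
  proof (intro conjI ballI allI impI)
    fix x y assume "x \<in> J" "y \<in> J"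
    then show "loc_const (\<beta> (\<tau> x) (\<tau> y)) (M x \<inter> M y)"
      using t by (intro loc_const_mono[OF D(1)]) blast+
  next
    fix i x assume "x \<in> J"
    then show "loc_const (F i (\<tau> x)) (M x \<inter> edge n i)"
      using t by (intro loc_const_mono[OF D(3)]) blast+
  next
    show "periodic n (\<lambda>i x. F i (\<tau> x))" using D(5) by (simp add: periodic_def)
  qed (use t in \<open>auto simp: pullback_apply subset_eq intro!: D\<close>)
qed

lemma trace_data_add:
  assumes T: "trace_data n I N \<gamma> \<beta> F \<kappa>" and T': "trace_data n I N \<gamma>' \<beta>' F' \<kappa>'"
  shows "trace_data n I N (\<gamma> + \<gamma>') (\<lambda>x y p. \<beta> x y p + \<beta>' x y p) (\<lambda>i x p. F i x p + F' i x p) (\<lambda>i. \<kappa> i + \<kappa>' i)"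
proof -
  note D = trace_dataD[OF T] and D' = trace_dataD[OF T']
  show ?thesis unfolding trace_data_def
  proof (intro conjI ballI allI impI)
    fix x y assume "x \<in> I" "y \<in> I"
    then show "loc_const (\<lambda>p. \<beta> x y p + \<beta>' x y p) (N x \<inter> N y)"
      by (intro loc_const_comp2[of _ _ _ "(+)"] D D')
  next
    fix i x assume "x \<in> I"
    then show "loc_const (\<lambda>p. F i x p + F' i x p) (N x \<inter> edge n i)"
      by (intro loc_const_comp2[of _ _ _ "(+)"] D D')
  next
    fix x y z p assume "x \<in> I" "y \<in> I" "z \<in> I" "p \<in> N x \<inter> N y \<inter> N z"
    then have "\<gamma> [x, y, z] p = \<beta> y z p - \<beta> x z p + \<beta> x y p" "\<gamma>' [x, y, z] p = \<beta>' y z p - \<beta>' x z p + \<beta>' x y p"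
      using D(2) D'(2) by blast+
    then show "(\<gamma> + \<gamma>') [x, y, z] p =
        \<beta> y z p + \<beta>' y z p - (\<beta> x z p + \<beta>' x z p) + (\<beta> x y p + \<beta>' x y p)"
      by (simp only: plus_fun_apply) (simp add: algebra_simps)
  next
    fix i x y p assume "x \<in> I" "y \<in> I" "p \<in> N x \<inter> N y \<inter> edge n i"
    then have "F i y p - F i x p = \<beta> x y p" "F' i y p - F' i x p = \<beta>' x y p" using D(4) D'(4) by blast+
    then show "F i y p + F' i y p - (F i x p + F' i x p) = \<beta> x y p + \<beta>' x y p"
      by (metis add_diff_add)
  next
    fix i x assume "x \<in> I" "vertex n i \<in> N x"
    then have "F (i - 1) x (vertex n i) - F i x (vertex n i) = \<kappa> i"
      "F' (i - 1) x (vertex n i) - F' i x (vertex n i) = \<kappa>' i" using D(7) D'(7) by blast+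
    then show "F (i - 1) x (vertex n i) + F' (i - 1) x (vertex n i) - (F i x (vertex n i) + F' i x (vertex n i))
        = \<kappa> i + \<kappa>' i"
      by (metis add_diff_add)
  next
    show "periodic n (\<lambda>i x p. F i x p + F' i x p)" "periodic n (\<lambda>i. \<kappa> i + \<kappa>' i)"
      using D(5,6) D'(5,6) by (auto simp: periodic_def)
  qed
qed

lemma trace_data_map:
  fixes h :: "'a::ab_group_add \<Rightarrow> 'a"
  assumes h: "\<And>x y. h (x + y) = h x + h y" and T: "trace_data n I N \<gamma> \<beta> F \<kappa>"
  shows "trace_data n I N (\<lambda>xs p. h (\<gamma> xs p)) (\<lambda>x y p. h (\<beta> x y p)) (\<lambda>i x p. h (F i x p)) (\<lambda>i. h (\<kappa> i))"
proof -
  have hd: "h (x - y) = h x - h y" for x y using h[of "x - y" y] by (simp add: algebra_simps)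
  note D = trace_dataD[OF T]
  show ?thesis unfolding trace_data_def
  proof (intro conjI ballI allI impI)
    show "periodic n (\<lambda>i x p. h (F i x p))" "periodic n (\<lambda>i. h (\<kappa> i))"
      using D(5,6) by (auto simp: periodic_def)
  qed (use D in \<open>auto simp: hd[symmetric] h[symmetric] intro!: loc_const_comp[of _ _ h] arg_cong[where f = h]\<close>)
qed

context ngon
begin

lemma jF_edge: "p \<in> edge n i \<Longrightarrow> v \<in> jF_fibre n p \<Longrightarrow> v = 0"
  using edge_not_interior by (auto simp: jF_fibre_iff)

lemma jF_closed:
  "0 \<in> jF_fibre n p"
  "x \<in> jF_fibre n p \<Longrightarrow> y \<in> jF_fibre n p \<Longrightarrow> x + y \<in> jF_fibre n p" for x y :: "'a::ab_group_add"
  by (auto simp: jF_fibre_iff)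

lemma jF_closed_diff:
  "x \<in> jF_fibre n p \<Longrightarrow> y \<in> jF_fibre n p \<Longrightarrow> x - y \<in> jF_fibre n p" for x y :: "'a::ab_group_add"
  by (auto simp: jF_fibre_iff)

lemma edge_cover:
  assumes "open_cover (polygon n) I N"
  shows "x \<in> I \<Longrightarrow> openin (top_of_set (edge n i)) (N x \<inter> edge n i)"
    and "edge n i \<subseteq> (\<Union>x\<in>I. N x \<inter> edge n i)"
  using openin_restrict[OF open_coverD(1)[OF assms] edge_subset_polygon]
    open_coverD(3)[OF assms] edge_subset_polygon[of i] by blast+

lemma vertex_in_edges: "vertex n i \<in> edge n i" "vertex n i \<in> edge n (i - 1)"
  using ends_in_segment(2)[of "vertex n i" "vertex n (i - 1)"] by auto

lemma trace_data_exists: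
  fixes \<gamma> :: "(complex, 'a::ab_group_add) cochain"
  assumes cov: "open_cover (polygon n) I N" and \<gamma>: "\<gamma> \<in> cochains (jF_fibre n) I N 2"
    and lc: "\<And>x y. x \<in> I \<Longrightarrow> y \<in> I \<Longrightarrow> loc_const (\<beta> x y) (N x \<inter> N y)"
    and d: "\<And>x y z p. x \<in> I \<Longrightarrow> y \<in> I \<Longrightarrow> z \<in> I \<Longrightarrow> p \<in> N x \<Longrightarrow> p \<in> N y \<Longrightarrow> p \<in> N z \<Longrightarrow>
           \<gamma> [x, y, z] p = \<beta> y z p - \<beta> x z p + \<beta> x y p"
  shows "\<exists>F \<kappa>. trace_data n I N \<gamma> \<beta> F \<kappa>"
proof -
  have "\<exists>f. (\<forall>x\<in>I. loc_const (f x) (N x \<inter> edge n i)) \<and>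
      (\<forall>x\<in>I. \<forall>y\<in>I. \<forall>p\<in>(N x \<inter> edge n i) \<inter> (N y \<inter> edge n i). f y p - f x p = \<beta> x y p)" for i
  proof (rule loc_const_1_cocycle_exact[of "edge n i"])
    show "loc_const (\<beta> x y) (N x \<inter> edge n i \<inter> (N y \<inter> edge n i))" if "x \<in> I" "y \<in> I" for x y
      by (rule loc_const_mono[OF lc[OF that]]) blast
    show "\<beta> x y p + \<beta> y z p = \<beta> x z p" if "x \<in> I" "y \<in> I" "z \<in> I" "p \<in> N x \<inter> edge n i"
      "p \<in> N y \<inter> edge n i" "p \<in> N z \<inter> edge n i" for x y z p
    proof -
      have "\<gamma> [x, y, z] p \<in> jF_fibre n p" using cochain_2_loc_const(2)[OF \<gamma>] that by blast
      then have "\<beta> y z p - \<beta> x z p + \<beta> x y p = 0" using jF_edge that d[of x y z p] by auto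
      then show ?thesis by (simp add: algebra_simps)
    qed
  qed (use edge_cover[OF cov] in auto)
  then obtain f where f: "\<And>i x. x \<in> I \<Longrightarrow> loc_const (f i x) (N x \<inter> edge n i)"
    "\<And>i x y p. x \<in> I \<Longrightarrow> y \<in> I \<Longrightarrow> p \<in> N x \<Longrightarrow> p \<in> N y \<Longrightarrow> p \<in> edge n i \<Longrightarrow> f i y p - f i x p = \<beta> x y p"
    by (metis IntI)
  define F where "F i = f (i mod int n)" for i
  have em: "edge n (i mod int n) = edge n i" for i
    by (rule edge_periodic) (auto simp: mod_eq_dvd_iff[symmetric])
  have F: "loc_const (F i x) (N x \<inter> edge n i)" if "x \<in> I" for i x
    using f(1)[OF that, of "i mod int n"] by (simp add: F_def em)
  have F2: "F i y p - F i x p = \<beta> x y p" if "x \<in> I" "y \<in> I" "p \<in> N x" "p \<in> N y" "p \<in> edge n i" for i x y p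
    using f(2)[OF that(1-4), of "i mod int n"] that(5) by (simp add: F_def em)
  have Fp: "periodic n F" by (simp add: periodic_def F_def)
  obtain \<xi> where \<xi>: "vertex_index n I N \<xi>" using vertex_index_exists[OF cov] by blast
  then have \<xi>': "\<And>i. \<xi> i \<in> I" "\<And>i. vertex n i \<in> N (\<xi> i)" "periodic n \<xi>" by (auto simp: vertex_index_def)
  \<comment> \<open>at a boundary point both \<open>F (i - 1)\<close> and \<open>F i\<close> change by \<open>\<beta>\<close> when the index changes, so any index can be used\<close>
  define \<kappa> where "\<kappa> i = F (i - 1) (\<xi> i) (vertex n i) - F i (\<xi> i) (vertex n i)" for i
  have "F (i - 1) x (vertex n i) - F i x (vertex n i) = \<kappa> i" if "x \<in> I" "vertex n i \<in> N x" for i x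
  proof -
    have "F (i - 1) x (vertex n i) - F (i - 1) (\<xi> i) (vertex n i) = \<beta> (\<xi> i) x (vertex n i)"
      "F i x (vertex n i) - F i (\<xi> i) (vertex n i) = \<beta> (\<xi> i) x (vertex n i)"
      using F2[OF \<xi>'(1) that(1) \<xi>'(2) that(2)] vertex_in_edges by auto
    then have "F (i - 1) x (vertex n i) - F (i - 1) (\<xi> i) (vertex n i)
        = F i x (vertex n i) - F i (\<xi> i) (vertex n i)" by simp
    then show ?thesis unfolding \<kappa>_def by (simp add: algebra_simps)
  qed
  moreover have "periodic n \<kappa>"
  proof -
    have "F (i + int n - 1) = F (i - 1)" for i
      using Fp[unfolded periodic_def, rule_format, of "i - 1"] by (simp add: algebra_simps)
    then show ?thesis using Fp \<xi>'(3) periodic_vertex by (simp add: periodic_def \<kappa>_def)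
  qed
  ultimately have "trace_data n I N \<gamma> \<beta> F \<kappa>"
    unfolding trace_data_def using lc d F F2 Fp by blast
  then show ?thesis by blast
qed

text \<open>On a common cover the difference of the primitives \<open>\<beta>\<close> and
  \<open>\<beta>'\<close>, corrected by the coboundary term \<open>\<eta>\<close>, is a cocycle on
  the whole polygon and thus the coboundary of some \<open>a\<close>. Since \<open>\<eta>\<close>
  vanishes on the boundary, \<open>F i - F' i - a\<close> is a constant \<open>k i\<close> on edge
  \<open>i\<close>, and \<open>\<kappa> i - \<kappa>' i = k (i - 1) - k i\<close> sums to
  zero.\<close>

lemma trace_data_unique:
  fixes \<gamma> :: "(complex, 'a::ab_group_add) cochain"
  assumes cov: "open_cover (polygon n) I N"
    and T: "trace_data n I N \<gamma> \<beta> F \<kappa>" and T': "trace_data n I N \<gamma>' \<beta>' F' \<kappa>'"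
    and g: "\<gamma> \<in> cochains (jF_fibre n) I N 2" "\<gamma>' \<in> cochains (jF_fibre n) I N 2"
    and cob: "\<gamma> - \<gamma>' \<in> coboundaries (jF_fibre n) I N 2"
  shows "(\<Sum>i\<in>{0..<int n}. \<kappa> i) = (\<Sum>i\<in>{0..<int n}. \<kappa>' i)"
proof -
  note D = trace_dataD[OF T] and D' = trace_dataD[OF T']
  have ch: "\<gamma> - \<gamma>' \<in> cochains (jF_fibre n) I N 2" by (rule cochain_diff[OF jF_closed_diff g])
  obtain \<eta> where E: "\<forall>x\<in>I. \<forall>y\<in>I. loc_const (\<eta> x y) (N x \<inter> N y) \<and> (\<forall>p\<in>N x \<inter> N y. \<eta> x y p \<in> jF_fibre n p)"
    "\<forall>x\<in>I. \<forall>y\<in>I. \<forall>z\<in>I. \<forall>p\<in>N x \<inter> N y \<inter> N z. (\<gamma> - \<gamma>') [x, y, z] p = \<eta> y z p - \<eta> x z p + \<eta> x y p"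
    using cob unfolding coboundaries_2_iff[OF ch] by blast
  define c where "c x y p = \<beta> x y p - \<beta>' x y p - \<eta> x y p" for x y p
  have c_cyc: "c x y p + c y z p = c x z p"
    if "x \<in> I" "y \<in> I" "z \<in> I" "p \<in> N x" "p \<in> N y" "p \<in> N z" for x y z p
  proof -
    have "(\<gamma> - \<gamma>') [x, y, z] p = \<eta> y z p - \<eta> x z p + \<eta> x y p" using E(2) that by blast
    then have "(\<beta> y z p - \<beta> x z p + \<beta> x y p) - (\<beta>' y z p - \<beta>' x z p + \<beta>' x y p) - (\<eta> y z p - \<eta> x z p + \<eta> x y p) = 0"
      using D(2)[OF that] D'(2)[OF that] by simp
    moreover have "c x y p + c y z p - c x z p =
      (\<beta> y z p - \<beta> x z p + \<beta> x y p) - (\<beta>' y z p - \<beta>' x z p + \<beta>' x y p) - (\<eta> y z p - \<eta> x z p + \<eta> x y p)"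
      by (simp add: c_def algebra_simps)
    ultimately show ?thesis by simp
  qed
  have "\<exists>a. (\<forall>x\<in>I. loc_const (a x) (N x)) \<and> (\<forall>x\<in>I. \<forall>y\<in>I. \<forall>p\<in>N x \<inter> N y. a y p - a x p = c x y p)"
  proof (rule loc_const_1_cocycle_exact[OF compact_polygon convex_polygon])
    show "loc_const (c x y) (N x \<inter> N y)" if "x \<in> I" "y \<in> I" for x y
      unfolding c_def using D(1)[OF that] D'(1)[OF that] E(1) that by (intro loc_const_comp2[of _ _ _ "(-)"]) auto
  qed (use open_coverD[OF cov] c_cyc in auto)
  then obtain a where a: "\<And>x. x \<in> I \<Longrightarrow> loc_const (a x) (N x)"
    "\<And>x y p. x \<in> I \<Longrightarrow> y \<in> I \<Longrightarrow> p \<in> N x \<Longrightarrow> p \<in> N y \<Longrightarrow> a y p - a x p = c x y p" by blast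
  have "\<exists>k. \<forall>x\<in>I. \<forall>p\<in>N x \<inter> edge n i. F i x p - F' i x p - a x p = k" for i
  proof (rule glued_const[of "edge n i"])
    show "loc_const (\<lambda>p. F i x p - F' i x p - a x p) (N x \<inter> edge n i)" if "x \<in> I" for x
      using D(3)[OF that] D'(3)[OF that] loc_const_mono[OF a(1)[OF that], of "N x \<inter> edge n i"]
      by (intro loc_const_comp2[of _ _ _ "(-)"]) auto
    show "F i x p - F' i x p - a x p = F i y p - F' i y p - a y p"
      if x: "x \<in> I" "y \<in> I" "p \<in> N x \<inter> edge n i" "p \<in> N y \<inter> edge n i" for x y p
    proof -
      have "\<eta> x y p \<in> jF_fibre n p" using E(1) x by blast
      then have "\<eta> x y p = 0" using jF_edge x by blast
      then have "a y p - a x p = (F i y p - F i x p) - (F' i y p - F' i x p)"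
        using a(2)[of x y p] D(4)[of x y p i] D'(4)[of x y p i] x by (simp add: c_def)
      then show ?thesis by (simp add: algebra_simps)
    qed
  qed (use edge_cover[OF cov] in auto)
  then obtain k where k: "\<And>i x p. x \<in> I \<Longrightarrow> p \<in> N x \<Longrightarrow> p \<in> edge n i \<Longrightarrow> F i x p - F' i x p - a x p = k i"
    by (metis IntI)
  obtain \<xi> where "vertex_index n I N \<xi>" using vertex_index_exists[OF cov] by blast
  then have \<xi>: "\<And>i. \<xi> i \<in> I" "\<And>i. vertex n i \<in> N (\<xi> i)" "periodic n \<xi>" by (auto simp: vertex_index_def)
  have kp: "periodic n k"
    unfolding periodic_def
  proof
    fix i
    have "edge n (i + int n) = edge n i" by (rule edge_periodic) simp
    then have "vertex n i \<in> edge n (i + int n)" using vertex_in_edges(1)[of i] by (simp only:)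
    then have "k (i + int n) = F (i + int n) (\<xi> i) (vertex n i) - F' (i + int n) (\<xi> i) (vertex n i) - a (\<xi> i) (vertex n i)"
      using k[OF \<xi>(1,2)] by simp
    also have "\<dots> = k i" using k[OF \<xi>(1,2) vertex_in_edges(1)] D(5) D'(5) by (simp add: periodic_def)
    finally show "k (i + int n) = k i" .
  qed
  have "\<kappa> i - \<kappa>' i = k (i - 1) - k i" for i
    unfolding D(7)[OF \<xi>(1,2), of i, symmetric] D'(7)[OF \<xi>(1,2), of i, symmetric]
      k[OF \<xi>(1,2) vertex_in_edges(1), of i, symmetric] k[OF \<xi>(1,2) vertex_in_edges(2), of i, symmetric]
    by (simp add: algebra_simps)
  then have "(\<Sum>i\<in>{0..<int n}. \<kappa> i - \<kappa>' i) = 0"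
    using sum_periodic_difference(2)[OF kp n_gt0] by simp
  then show ?thesis by (simp add: sum_subtractf)
qed

text \<open>If the mismatches sum to zero, then adding constants \<open>k i\<close> to the
  primitives on the edges makes them agree at the vertices, so that they form one primitive
  \<open>G\<close> on the boundary. A point \<open>p\<close> has a neighbourhood on whose boundary
  part \<open>G\<close> is a constant \<open>a p\<close>. On the cover by these neighbourhoods
  \<open>a\<close> extends \<open>G\<close> into the interior, and \<open>\<beta> -
  \<delta>a\<close> is a primitive that vanishes on the boundary.\<close>

lemma coboundary_if_trace_zero:
  fixes \<gamma> :: "(complex, 'a::ab_group_add) cochain"
  assumes cov: "open_cover (polygon n) I N" and \<gamma>: "\<gamma> \<in> cochains (jF_fibre n) I N 2"
    and T: "trace_data n I N \<gamma> \<beta> F \<kappa>" and zero: "(\<Sum>i\<in>{0..<int n}. \<kappa> i) = 0"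
  shows "\<exists>M \<tau>. open_cover (polygon n) (polygon n) M \<and> refines (polygon n) M I N \<tau> \<and>
           pullback (polygon n) M \<tau> \<gamma> \<in> coboundaries (jF_fibre n) (polygon n) M 2"
proof -
  note D = trace_dataD[OF T]
  let ?D = "polygon n"
  obtain k where "antiderivative n \<kappa> k" using antiderivative_exists[OF D(6) n_gt0 zero] by blast
  then have k: "periodic n k" "\<And>i. k i - k (i - 1) = \<kappa> i" by (auto simp: antiderivative_def)
  define G where "G i x p = F i x p + k i" for i x p
  have Glc: "loc_const (G i x) (N x \<inter> edge n i)" if "x \<in> I" for i x
    unfolding G_def using loc_const_comp[OF D(3)[OF that], of "\<lambda>v. v + k i"] .
  have Gd: "G i y p - G i x p = \<beta> x y p" if "x \<in> I" "y \<in> I" "p \<in> N x" "p \<in> N y" "p \<in> edge n i" for i x y p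
    using D(4)[OF that] by (simp add: G_def)
  have Gp: "periodic n G" using D(5) k(1) by (simp add: periodic_def G_def[abs_def])
  have Gv: "G (i - 1) x (vertex n i) = G i x (vertex n i)" if "x \<in> I" "vertex n i \<in> N x" for i x
    using D(7)[OF that] k(2)[of i] by (simp add: G_def algebra_simps)
  have Geq: "G i x p = G j x p" if x: "x \<in> I" "p \<in> N x" and p: "p \<in> edge n i" "p \<in> edge n j" for i j x p
  proof -
    consider "int n dvd i - j" | "int n dvd i - (j + 1)" "p = vertex n i" | "int n dvd j - (i + 1)" "p = vertex n j"
      using edges_meet[OF p] by blast
    then show ?thesis
    proof cases
      case 1
      then show ?thesis using periodic_dvd[OF Gp] by simp
    next
      case 2
      have "int n dvd i - 1 - j" using 2(1) by (simp add: algebra_simps)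
      then have "G (i - 1) = G j" by (rule periodic_dvd[OF Gp])
      then show ?thesis using Gv[OF x(1), of i] x 2 by simp
    next
      case 3
      have "int n dvd j - 1 - i" using 3(1) by (simp add: algebra_simps)
      then have "G (j - 1) = G i" by (rule periodic_dvd[OF Gp])
      then show ?thesis using Gv[OF x(1), of j] x 3 by simp
    qed
  qed
  have "\<forall>p\<in>?D. \<exists>x\<in>I. p \<in> N x" using open_coverD(3)[OF cov] by blast
  then obtain \<tau> where \<tau>: "\<And>p. p \<in> ?D \<Longrightarrow> \<tau> p \<in> I" "\<And>p. p \<in> ?D \<Longrightarrow> p \<in> N (\<tau> p)" by metis
  define a where "a p = G (SOME i. p \<in> edge n i) (\<tau> p) p" for p
  have a: "a p = G i (\<tau> p) p" if "p \<in> ?D" "p \<in> edge n i" for p i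
    unfolding a_def by (rule Geq[OF \<tau>[OF that(1)] _ that(2)]) (rule someI[of _ i], rule that(2))
  have "\<exists>e>0. ball p e \<inter> ?D \<subseteq> N (\<tau> p) \<and> (\<forall>i r. r \<in> ball p e \<longrightarrow> r \<in> ?D \<longrightarrow> r \<in> edge n i \<longrightarrow> G i (\<tau> p) r = a p)"
    if p: "p \<in> ?D" for p
  proof -
    have "\<exists>e>0. \<forall>r\<in>?D. dist r p < e \<longrightarrow> r \<in> N (\<tau> p)"
      using open_coverD(1)[OF cov \<tau>(1)[OF p]] \<tau>(2)[OF p] unfolding openin_euclidean_subtopology_iff by blast
    then obtain e0 where e0: "e0 > 0" "\<And>r. r \<in> ?D \<Longrightarrow> dist r p < e0 \<Longrightarrow> r \<in> N (\<tau> p)" by blast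
    have "\<exists>e>0. \<forall>r. dist r p < e \<longrightarrow> r \<in> edge n i \<longrightarrow> r \<in> N (\<tau> p) \<longrightarrow> G i (\<tau> p) r = a p" for i
    proof (cases "p \<in> edge n i")
      case True
      then obtain e where "e > 0" "\<And>r. r \<in> N (\<tau> p) \<inter> edge n i \<Longrightarrow> dist r p < e \<Longrightarrow> G i (\<tau> p) r = G i (\<tau> p) p"
        using Glc[OF \<tau>(1)[OF p], of i] \<tau>(2)[OF p] unfolding loc_const_metric by (metis IntI)
      then show ?thesis using a[OF p True] by (metis IntI)
    next
      case False
      have "open (- edge n i)" using closed_segment by blast
      then obtain e where "e > 0" "ball p e \<subseteq> - edge n i" using False by (metis ComplI openE)
      then show ?thesis by (intro exI[of _ e]) (auto simp: dist_commute subset_eq)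
    qed
    then obtain \<epsilon> where \<epsilon>: "\<And>i. \<epsilon> i > 0"
      "\<And>i r. dist r p < \<epsilon> i \<Longrightarrow> r \<in> edge n i \<Longrightarrow> r \<in> N (\<tau> p) \<Longrightarrow> G i (\<tau> p) r = a p" by metis
    \<comment> \<open>finitely many edges suffice, as edges and \<open>G\<close> are periodic\<close>
  define e where "e = Min (insert e0 (\<epsilon> ` {0..<int n}))"
    have e: "e > 0" "e \<le> e0"
      using e0(1) \<epsilon>(1) unfolding e_def by auto
    have e3: "e \<le> \<epsilon> i" if "i \<in> {0..<int n}" for i
      unfolding e_def by (rule Min_le) (use that in auto)
    show ?thesis
    proof (intro exI[of _ e] conjI allI impI subsetI)
      show "e > 0" by (rule e(1))
      show r: "r \<in> N (\<tau> p)" if "r \<in> ball p e \<inter> ?D" for r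
        using that e(2) by (intro e0(2)) (auto simp: dist_commute)
      fix i r assume r': "r \<in> ball p e" "r \<in> ?D" "r \<in> edge n i"
      have em: "edge n (i mod int n) = edge n i"
        by (rule edge_periodic) (auto simp: mod_eq_dvd_iff[symmetric])
      have i: "i mod int n \<in> {0..<int n}" using n_gt0 by simp
      have rn: "r \<in> N (\<tau> p)" using r r' by blast
      have "G (i mod int n) (\<tau> p) r = a p"
      proof (rule \<epsilon>(2)[OF _ _ rn])
        show "r \<in> edge n (i mod int n)" unfolding em by (rule r'(3))
        show "dist r p < \<epsilon> (i mod int n)" using e3[OF i] r'(1) by (simp add: dist_commute)
      qed
      then show "G i (\<tau> p) r = a p" using periodic_mod[OF Gp] by simp
    qed
  qed
  then obtain e where e: "\<And>p. p \<in> ?D \<Longrightarrow> e p > 0" "\<And>p. p \<in> ?D \<Longrightarrow> ball p (e p) \<inter> ?D \<subseteq> N (\<tau> p)"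
    "\<And>p i r. p \<in> ?D \<Longrightarrow> r \<in> ball p (e p) \<Longrightarrow> r \<in> ?D \<Longrightarrow> r \<in> edge n i \<Longrightarrow> G i (\<tau> p) r = a p" by metis
  define M where "M p = ball p (e p) \<inter> ?D" for p
  have M: "open_cover ?D ?D M"
    unfolding open_cover_def
  proof (intro conjI ballI equalityI)
    show "openin (top_of_set ?D) (M p)" if "p \<in> ?D" for p
      unfolding M_def by (metis Int_commute open_ball openin_open_Int)
  qed (use e(1) in \<open>auto simp: M_def\<close>)
  have r: "refines ?D M I N \<tau>" using \<tau> e(2) by (auto simp: refines_def M_def)
  define \<eta> where "\<eta> x y p = \<beta> (\<tau> x) (\<tau> y) p - (a y - a x)" for x y p
  have MN: "p \<in> N (\<tau> x)" if "x \<in> ?D" "p \<in> M x" for x p using r that by (auto simp: refines_def)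
  have "loc_const (\<eta> x y) (M x \<inter> M y)" if "x \<in> ?D" "y \<in> ?D" for x y
    unfolding \<eta>_def
  proof (rule loc_const_comp[of _ _ "\<lambda>v. v - (a y - a x)"])
    show "loc_const (\<beta> (\<tau> x) (\<tau> y)) (M x \<inter> M y)"
      using MN that by (intro loc_const_mono[OF D(1)[OF \<tau>(1)[OF that(1)] \<tau>(1)[OF that(2)]]]) blast
  qed
  moreover have "\<eta> x y p \<in> jF_fibre n p" if x: "x \<in> ?D" "y \<in> ?D" "p \<in> M x \<inter> M y" for x y p
  proof (cases "p \<in> interior ?D")
    case False
    have pD: "p \<in> ?D" using x(3) by (simp add: M_def)
    then obtain i where i: "p \<in> edge n i" using boundary_in_edge False by blast
    have "G i (\<tau> y) p - G i (\<tau> x) p = \<beta> (\<tau> x) (\<tau> y) p"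
      using x MN \<tau> i by (intro Gd) auto
    moreover have "G i (\<tau> y) p = a y" "G i (\<tau> x) p = a x"
      using e(3)[OF x(1) _ pD i] e(3)[OF x(2) _ pD i] x(3) by (auto simp: M_def)
    ultimately show ?thesis by (simp add: \<eta>_def jF_fibre_iff)
  qed (simp add: jF_fibre_iff)
  moreover have "pullback ?D M \<tau> \<gamma> [x, y, z] p = \<eta> y z p - \<eta> x z p + \<eta> x y p"
    if x: "x \<in> ?D" "y \<in> ?D" "z \<in> ?D" "p \<in> M x \<inter> M y \<inter> M z" for x y z p
  proof -
    have "\<gamma> [\<tau> x, \<tau> y, \<tau> z] p = \<beta> (\<tau> y) (\<tau> z) p - \<beta> (\<tau> x) (\<tau> z) p + \<beta> (\<tau> x) (\<tau> y) p"
      using x MN \<tau> by (intro D(2)) auto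
    then show ?thesis using x by (simp add: pullback_apply \<eta>_def algebra_simps)
  qed
  ultimately have "pullback ?D M \<tau> \<gamma> \<in> coboundaries (jF_fibre n) ?D M 2"
    unfolding coboundaries_2_iff[OF pullback_cochain[OF r \<gamma>]] by blast
  then show ?thesis using M r by blast
qed

lemma trace_data_refined:
  fixes \<gamma> :: "(complex, 'a::ab_group_add) cochain"
  assumes cov: "open_cover (polygon n) I N" and \<gamma>: "\<gamma> \<in> cocycles (jF_fibre n) I N 2"
  obtains M \<tau> \<beta> F \<kappa> where "open_cover (polygon n) (polygon n) M" "refines (polygon n) M I N \<tau>"
    "trace_data n (polygon n) M (pullback (polygon n) M \<tau> \<gamma>) \<beta> F \<kappa>"
proof -
  let ?D = "polygon n"
  have gc: "\<gamma> \<in> cochains (jF_fibre n) I N 2" using \<gamma> by (simp add: cocycles_def)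
  have "\<exists>e \<sigma> \<beta>. e > 0 \<and> (\<forall>p\<in>?D. \<sigma> p \<in> I \<and> ball p e \<inter> ?D \<subseteq> N (\<sigma> p)) \<and>
           (\<forall>x\<in>?D. \<forall>y\<in>?D. \<forall>z\<in>?D. \<forall>p\<in>?D. p \<in> ball x e \<inter> ball y e \<inter> ball z e \<longrightarrow>
              \<gamma> [\<sigma> x, \<sigma> y, \<sigma> z] p = \<beta> y z - \<beta> x z + \<beta> x y)"
    by (rule loc_const_2_cocycle_exact[OF compact_polygon convex_polygon, where \<gamma> = "\<lambda>x y z. \<gamma> [x, y, z]"])
      (use open_coverD[OF cov] cochain_2_loc_const(1)[OF gc] cocycle_2_apply[OF jF_closed(1) \<gamma>] in blast)+
  then obtain e \<sigma> \<beta> where e: "e > 0" "\<And>p. p \<in> ?D \<Longrightarrow> \<sigma> p \<in> I" "\<And>p. p \<in> ?D \<Longrightarrow> ball p e \<inter> ?D \<subseteq> N (\<sigma> p)"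
    "\<And>x y z p. x \<in> ?D \<Longrightarrow> y \<in> ?D \<Longrightarrow> z \<in> ?D \<Longrightarrow> p \<in> ?D \<Longrightarrow> p \<in> ball x e \<Longrightarrow> p \<in> ball y e \<Longrightarrow> p \<in> ball z e \<Longrightarrow>
       \<gamma> [\<sigma> x, \<sigma> y, \<sigma> z] p = \<beta> y z - \<beta> x z + \<beta> x y" by (metis IntI)
  define M where "M p = ball p e \<inter> ?D" for p
  have M: "open_cover ?D ?D M"
    unfolding open_cover_def
  proof (intro conjI ballI equalityI)
    show "openin (top_of_set ?D) (M p)" for p
      unfolding M_def by (metis Int_commute open_ball openin_open_Int)
  qed (use e(1) in \<open>auto simp: M_def\<close>)
  have r: "refines ?D M I N \<sigma>" using e by (auto simp: refines_def M_def)
  have "\<exists>F \<kappa>. trace_data n ?D M (pullback ?D M \<sigma> \<gamma>) (\<lambda>x y p. \<beta> x y) F \<kappa>"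
    by (rule trace_data_exists[OF M pullback_cochain[OF r gc]])
      (use e(4) in \<open>auto simp: pullback_apply M_def\<close>)
  then show ?thesis using that[OF M r] by blast
qed

text \<open>A primitive \<open>\<beta>\<close> need not exist on the given cover, so a
  refinement is allowed.\<close>

definition has_trace :: "(complex, 'a::ab_group_add) cech \<Rightarrow> 'a \<Rightarrow> bool" where
  "has_trace = (\<lambda>(I, N, \<gamma>) \<mu>. \<exists>J M \<tau> \<beta> F \<kappa>. open_cover (polygon n) J M \<and> refines J M I N \<tau> \<and>
     trace_data n J M (pullback J M \<tau> \<gamma>) \<beta> F \<kappa> \<and> \<mu> = (\<Sum>i\<in>{0..<int n}. \<kappa> i))"

lemma has_trace_exists:
  "x \<in> cech_cocycles (polygon n) (jF_fibre n) 2 \<Longrightarrow> \<exists>\<mu>. has_trace x \<mu>"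
proof -
  assume x: "x \<in> cech_cocycles (polygon n) (jF_fibre n) 2"
  obtain I N \<gamma> where e: "x = (I, N, \<gamma>)" by (cases x) auto
  have g: "open_cover (polygon n) I N" "\<gamma> \<in> cocycles (jF_fibre n) I N 2"
    using x unfolding e cech_cocycles_def by auto
  obtain M \<tau> \<beta> F \<kappa> where "open_cover (polygon n) (polygon n) M" "refines (polygon n) M I N \<tau>"
    "trace_data n (polygon n) M (pullback (polygon n) M \<tau> \<gamma>) \<beta> F \<kappa>" by (rule trace_data_refined[OF g])
  then show ?thesis unfolding e has_trace_def prod.case by blast
qed

lemma has_traceI:
  assumes "open_cover (polygon n) I N" "\<gamma> \<in> cochains (jF_fibre n) I N 2" "trace_data n I N \<gamma> \<beta> F \<kappa>"
  shows "has_trace (I, N, \<gamma>) (\<Sum>i\<in>{0..<int n}. \<kappa> i)"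
  unfolding has_trace_def prod.case
  by (intro exI[of _ I] exI[of _ N] exI[of _ id] exI[of _ \<beta>] exI[of _ F] exI[of _ \<kappa>] conjI)
    (use assms refines_id[of I N] pullback_id[OF assms(2)] in auto)

text \<open>The two primitives and the relation between the cocycles live on three different
  refinements. On a common refinement \<open>L\<close> the pullbacks of one cocycle along
  different maps differ by a coboundary (\<open>refinements_homotopic\<close>), so that the
  pullbacks that carry the primitives are cohomologous.\<close>

lemma has_trace_rel_unique:
  fixes x y :: "(complex, 'a::ab_group_add) cech"
  assumes rel: "(x, y) \<in> cech_rel (polygon n) (jF_fibre n) 2" and tr: "has_trace x \<mu>" "has_trace y \<mu>'"
  shows "\<mu> = \<mu>'"
proof -
  let ?D = "polygon n" and ?A = "jF_fibre n :: complex \<Rightarrow> 'a set"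
  obtain I N \<gamma> I' N' \<gamma>' where xy: "x = (I, N, \<gamma>)" "y = (I', N', \<gamma>')" by (cases x, cases y) auto
  from rel have C: "\<gamma> \<in> cocycles ?A I N 2" "\<gamma>' \<in> cocycles ?A I' N' 2"
    unfolding cech_rel_def xy cech_cocycles_def by auto
  from rel obtain J0 M0 \<rho> \<rho>' where 0: "open_cover ?D J0 M0" "refines J0 M0 I N \<rho>" "refines J0 M0 I' N' \<rho>'"
    "pullback J0 M0 \<rho> \<gamma> - pullback J0 M0 \<rho>' \<gamma>' \<in> coboundaries ?A J0 M0 2"
    unfolding cech_rel_def xy by blast
  obtain J M \<tau> \<beta> F \<kappa> where 1: "open_cover ?D J M" "refines J M I N \<tau>"
    "trace_data n J M (pullback J M \<tau> \<gamma>) \<beta> F \<kappa>" "\<mu> = (\<Sum>i\<in>{0..<int n}. \<kappa> i)"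
    using tr(1) unfolding has_trace_def xy by auto
  obtain J' M' \<tau>' \<beta>' F' \<kappa>' where 2: "open_cover ?D J' M'" "refines J' M' I' N' \<tau>'"
    "trace_data n J' M' (pullback J' M' \<tau>' \<gamma>') \<beta>' F' \<kappa>'" "\<mu>' = (\<Sum>i\<in>{0..<int n}. \<kappa>' i)"
    using tr(2) unfolding has_trace_def xy by auto
  obtain L1 a b where L1: "open_cover ?D ?D L1" "refines ?D L1 J0 M0 a" "refines ?D L1 J M b"
    by (rule common_refinement[OF 0(1) 1(1)])
  obtain L b' a' where L: "open_cover ?D ?D L" "refines ?D L ?D L1 b'" "refines ?D L J' M' a'"
    by (rule common_refinement[OF L1(1) 2(1)])
  have ra: "refines ?D L J0 M0 (a \<circ> b')" and rb: "refines ?D L J M (b \<circ> b')"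
    using refines_trans L L1 by blast+
  have rI: "refines ?D L I N (\<rho> \<circ> (a \<circ> b'))" "refines ?D L I N (\<tau> \<circ> (b \<circ> b'))"
    and rI': "refines ?D L I' N' (\<rho>' \<circ> (a \<circ> b'))" "refines ?D L I' N' (\<tau>' \<circ> a')"
    using refines_trans ra rb L 0 1 2 by blast+
  let ?p = "\<lambda>\<tau>. pullback ?D L \<tau>"
  have c1: "?p (\<tau> \<circ> (b \<circ> b')) \<gamma> - ?p (\<rho> \<circ> (a \<circ> b')) \<gamma> \<in> coboundaries ?A ?D L 2"
    by (rule refinements_homotopic[OF jF_closed(1) jF_closed_diff C(1) rI(2,1)])
  have c3: "?p (\<rho>' \<circ> (a \<circ> b')) \<gamma>' - ?p (\<tau>' \<circ> a') \<gamma>' \<in> coboundaries ?A ?D L 2"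
    by (rule refinements_homotopic[OF jF_closed(1) jF_closed_diff C(2) rI'])
  have c2: "?p (\<rho> \<circ> (a \<circ> b')) \<gamma> - ?p (\<rho>' \<circ> (a \<circ> b')) \<gamma>' \<in> coboundaries ?A ?D L 2"
    using pullback_coboundary[OF ra 0(4)] by (simp only: pullback_diff pullback_pullback[OF ra])
  note add = coboundaries_add[OF jF_closed(2), where k = 1, unfolded Suc_1]
  have "(?p (\<tau> \<circ> (b \<circ> b')) \<gamma> - ?p (\<rho> \<circ> (a \<circ> b')) \<gamma>) + (?p (\<rho> \<circ> (a \<circ> b')) \<gamma> - ?p (\<rho>' \<circ> (a \<circ> b')) \<gamma>')
      + (?p (\<rho>' \<circ> (a \<circ> b')) \<gamma>' - ?p (\<tau>' \<circ> a') \<gamma>') \<in> coboundaries ?A ?D L 2"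
    by (intro add c1 c2 c3)
  then have cob: "?p (\<tau> \<circ> (b \<circ> b')) \<gamma> - ?p (\<tau>' \<circ> a') \<gamma>' \<in> coboundaries ?A ?D L 2" by simp
  have gc: "\<gamma> \<in> cochains ?A I N 2" "\<gamma>' \<in> cochains ?A I' N' 2" using C by (auto simp: cocycles_def)
  have "trace_data n ?D L (?p (\<tau> \<circ> (b \<circ> b')) \<gamma>) (\<lambda>x y. \<beta> ((b \<circ> b') x) ((b \<circ> b') y)) (\<lambda>i x. F i ((b \<circ> b') x)) \<kappa>"
    using trace_data_pullback[OF 1(3) rb] by (simp only: pullback_pullback[OF rb])
  moreover have "trace_data n ?D L (?p (\<tau>' \<circ> a') \<gamma>') (\<lambda>x y. \<beta>' (a' x) (a' y)) (\<lambda>i x. F' i (a' x)) \<kappa>'"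
    using trace_data_pullback[OF 2(3) L(3)] by (simp only: pullback_pullback[OF L(3)])
  ultimately show ?thesis unfolding 1(4) 2(4)
    using pullback_cochain[OF rI(2) gc(1)] pullback_cochain[OF rI'(2) gc(2)] cob by (rule trace_data_unique[OF L(1)])
qed

definition H2_value :: "(complex, 'a::ab_group_add) cech \<Rightarrow> 'a" where
  "H2_value x = (SOME \<mu>. has_trace x \<mu>)"

lemma H2_value_eq:
  assumes "x \<in> cech_cocycles (polygon n) (jF_fibre n) 2" "has_trace x \<mu>"
  shows "H2_value x = \<mu>"
proof -
  have "has_trace x (H2_value x)" unfolding H2_value_def using assms(2) by (rule someI)
  moreover have "(x, x) \<in> cech_rel (polygon n) (jF_fibre n) 2"
    by (rule cech_rel_refl[OF jF_closed(1) assms(1)])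
  ultimately show ?thesis using has_trace_rel_unique assms(2) by blast
qed

lemma H2_rel:
  fixes x y :: "(complex, 'a::ab_group_add) cech"
  shows "(x, y) \<in> cech_rel (polygon n) (jF_fibre n) 2 \<longleftrightarrow>
    x \<in> cech_cocycles (polygon n) (jF_fibre n) 2 \<and> y \<in> cech_cocycles (polygon n) (jF_fibre n) 2 \<and>
    H2_value x = H2_value y" (is "?l \<longleftrightarrow> ?r")
proof
  assume l: ?l
  then have C: "x \<in> cech_cocycles (polygon n) (jF_fibre n) 2" "y \<in> cech_cocycles (polygon n) (jF_fibre n) 2"
    by (auto simp: cech_rel_def)
  then show ?r using has_trace_exists H2_value_eq has_trace_rel_unique[OF l] by metis
next
  assume r: ?r
  let ?D = "polygon n" and ?A = "jF_fibre n :: complex \<Rightarrow> 'a set"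
  obtain I N \<gamma> I' N' \<gamma>' where xy: "x = (I, N, \<gamma>)" "y = (I', N', \<gamma>')" by (cases x, cases y) auto
  have C: "\<gamma> \<in> cocycles ?A I N 2" "\<gamma>' \<in> cocycles ?A I' N' 2"
    using r unfolding xy cech_cocycles_def by auto
  then have gc: "\<gamma> \<in> cochains ?A I N 2" "\<gamma>' \<in> cochains ?A I' N' 2" by (auto simp: cocycles_def)
  obtain \<mu> where \<mu>: "has_trace x \<mu>" "has_trace y \<mu>" using r has_trace_exists H2_value_eq by metis
  obtain J M \<tau> \<beta> F \<kappa> where 1: "open_cover ?D J M" "refines J M I N \<tau>"
    "trace_data n J M (pullback J M \<tau> \<gamma>) \<beta> F \<kappa>" "\<mu> = (\<Sum>i\<in>{0..<int n}. \<kappa> i)"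
    using \<mu>(1) unfolding has_trace_def xy by auto
  obtain J' M' \<tau>' \<beta>' F' \<kappa>' where 2: "open_cover ?D J' M'" "refines J' M' I' N' \<tau>'"
    "trace_data n J' M' (pullback J' M' \<tau>' \<gamma>') \<beta>' F' \<kappa>'" "\<mu> = (\<Sum>i\<in>{0..<int n}. \<kappa>' i)"
    using \<mu>(2) unfolding has_trace_def xy by auto
  obtain L a a' where L: "open_cover ?D ?D L" "refines ?D L J M a" "refines ?D L J' M' a'"
    by (rule common_refinement[OF 1(1) 2(1)])
  have rI: "refines ?D L I N (\<tau> \<circ> a)" "refines ?D L I' N' (\<tau>' \<circ> a')"
    using refines_trans L 1 2 by blast+
  let ?p = "pullback ?D L (\<tau> \<circ> a) \<gamma>" and ?p' = "pullback ?D L (\<tau>' \<circ> a') \<gamma>'"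
  have t: "trace_data n ?D L ?p (\<lambda>x y. \<beta> (a x) (a y)) (\<lambda>i x. F i (a x)) \<kappa>"
    using trace_data_pullback[OF 1(3) L(2)] by (simp only: pullback_pullback[OF L(2)])
  have t': "trace_data n ?D L ?p' (\<lambda>x y. \<beta>' (a' x) (a' y)) (\<lambda>i x. F' i (a' x)) \<kappa>'"
    using trace_data_pullback[OF 2(3) L(3)] by (simp only: pullback_pullback[OF L(3)])
  have eq: "?p + (\<lambda>xs p. - ?p' xs p) = ?p - ?p'" by (intro ext) simp
  note td = trace_data_add[OF t trace_data_map[OF _ t', of uminus], unfolded eq, simplified]
  have sum0: "(\<Sum>i\<in>{0..<int n}. \<kappa> i - \<kappa>' i) = 0" using 1(4) 2(4) by (simp add: sum_subtractf)
  have ch: "?p - ?p' \<in> cochains ?A ?D L 2"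
    by (rule cochain_diff[OF jF_closed_diff pullback_cochain[OF rI(1) gc(1)] pullback_cochain[OF rI(2) gc(2)]])
  obtain K s where K: "open_cover ?D ?D K" "refines ?D K ?D L s"
    "pullback ?D K s (?p - ?p') \<in> coboundaries ?A ?D K 2"
    using coboundary_if_trace_zero[OF L(1) ch td sum0] by blast
  have "pullback ?D K (\<tau> \<circ> a \<circ> s) \<gamma> - pullback ?D K (\<tau>' \<circ> a' \<circ> s) \<gamma>' \<in> coboundaries ?A ?D K 2"
    using K(3) by (simp only: pullback_diff pullback_pullback[OF K(2)])
  then show ?l unfolding xy
    using r K(1) refines_trans[OF K(2) rI(1)] refines_trans[OF K(2) rI(2)] xy
    by (intro cech_relI[of _ _ _ _ _ _ _ _ _ ?D K "\<tau> \<circ> a \<circ> s" "\<tau>' \<circ> a' \<circ> s"]) simp_all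
qed

lemma H2_value_pullback:
  assumes "(I, N, \<gamma>) \<in> cech_cocycles (polygon n) (jF_fibre n) 2" "open_cover (polygon n) J M" "refines J M I N \<tau>"
  shows "H2_value (J, M, pullback J M \<tau> \<gamma>) = H2_value (I, N, \<gamma>)"
  using cech_rel_pullback[where A = "jF_fibre n", OF jF_closed(1) assms] unfolding H2_rel by simp

lemma H2_value_add:
  fixes \<gamma> \<gamma>' :: "(complex, 'a::ab_group_add) cochain"
  assumes C: "(I, N, \<gamma>) \<in> cech_cocycles (polygon n) (jF_fibre n) 2" "(I, N, \<gamma>') \<in> cech_cocycles (polygon n) (jF_fibre n) 2"
  shows "H2_value (I, N, \<gamma> + \<gamma>') = H2_value (I, N, \<gamma>) + H2_value (I, N, \<gamma>')"
proof -
  let ?D = "polygon n" and ?A = "jF_fibre n :: complex \<Rightarrow> 'a set"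
  have g: "open_cover ?D I N" "\<gamma> \<in> cocycles ?A I N 2" "\<gamma>' \<in> cocycles ?A I N 2"
    using C by (auto simp: cech_cocycles_def)
  obtain M \<tau> \<beta> F \<kappa> where 1: "open_cover ?D ?D M" "refines ?D M I N \<tau>"
    "trace_data n ?D M (pullback ?D M \<tau> \<gamma>) \<beta> F \<kappa>" by (rule trace_data_refined[OF g(1,2)])
  obtain L \<tau>' \<beta>' F' \<kappa>' where 2: "open_cover ?D ?D L" "refines ?D L ?D M \<tau>'"
    "trace_data n ?D L (pullback ?D L \<tau>' (pullback ?D M \<tau> \<gamma>')) \<beta>' F' \<kappa>'"
    by (rule trace_data_refined[OF 1(1) pullback_cocycle[OF 1(2) g(3)]])
  let ?p = "pullback ?D L (\<tau> \<circ> \<tau>')"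
  have r: "refines ?D L I N (\<tau> \<circ> \<tau>')" by (rule refines_trans[OF 2(2) 1(2)])
  note t = trace_data_pullback[OF 1(3) 2(2), unfolded pullback_pullback[OF 2(2)]]
  note t' = 2(3)[unfolded pullback_pullback[OF 2(2)]]
  have sum: "?p (\<gamma> + \<gamma>') = ?p \<gamma> + ?p \<gamma>'" by (intro ext) (simp add: pullback_apply)
  have CC: "(?D, L, ?p \<gamma>) \<in> cech_cocycles ?D ?A 2" "(?D, L, ?p \<gamma>') \<in> cech_cocycles ?D ?A 2"
    "(?D, L, ?p \<gamma> + ?p \<gamma>') \<in> cech_cocycles ?D ?A 2" "(I, N, \<gamma> + \<gamma>') \<in> cech_cocycles ?D ?A 2"
    using g 2(1) pullback_cocycle[OF r g(2)] pullback_cocycle[OF r g(3)]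
      cocycle_add[of ?A, OF jF_closed(2) g(2,3)]
      cocycle_add[of ?A, OF jF_closed(2) pullback_cocycle[OF r g(2)] pullback_cocycle[OF r g(3)]]
    by (auto simp: cech_cocycles_def)
  have v: "H2_value (?D, L, \<delta>) = (\<Sum>i\<in>{0..<int n}. k i)"
    if "(?D, L, \<delta>) \<in> cech_cocycles ?D ?A 2" "trace_data n ?D L \<delta> b f k" for \<delta> b f k
    by (rule H2_value_eq[OF that(1) has_traceI[OF 2(1) _ that(2)]])
      (use that(1) in \<open>simp add: cech_cocycles_def cocycles_def\<close>)
  have "H2_value (?D, L, ?p \<gamma> + ?p \<gamma>') = H2_value (?D, L, ?p \<gamma>) + H2_value (?D, L, ?p \<gamma>')"
    unfolding v[OF CC(1) t] v[OF CC(2) t'] v[OF CC(3) trace_data_add[OF t t']] by (rule sum.distrib)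
  then show ?thesis
    unfolding sum[symmetric] H2_value_pullback[OF C(1) 2(1) r] H2_value_pullback[OF C(2) 2(1) r]
      H2_value_pullback[OF CC(4) 2(1) r] .
qed

lemma H2_value_scale:
  fixes \<gamma> :: "(complex, 'a::field) cochain"
  assumes C: "(I, N, \<gamma>) \<in> cech_cocycles (polygon n) (jF_fibre n) 2"
  shows "H2_value (I, N, \<lambda>xs p. a * \<gamma> xs p) = a * H2_value (I, N, \<gamma>)"
proof -
  let ?D = "polygon n" and ?A = "jF_fibre n :: complex \<Rightarrow> 'a set"
  have g: "open_cover ?D I N" "\<gamma> \<in> cocycles ?A I N 2"
    using C by (auto simp: cech_cocycles_def)
  obtain M \<tau> \<beta> F \<kappa> where 1: "open_cover ?D ?D M" "refines ?D M I N \<tau>"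
    "trace_data n ?D M (pullback ?D M \<tau> \<gamma>) \<beta> F \<kappa>" by (rule trace_data_refined[OF g])
  have "has_trace (I, N, \<gamma>) (\<Sum>i\<in>{0..<int n}. \<kappa> i)"
    unfolding has_trace_def prod.case using 1 by blast
  then have v: "H2_value (I, N, \<gamma>) = (\<Sum>i\<in>{0..<int n}. \<kappa> i)" by (rule H2_value_eq[OF C])
  have eq: "(\<lambda>xs p. a * pullback ?D M \<tau> \<gamma> xs p) = pullback ?D M \<tau> (\<lambda>xs p. a * \<gamma> xs p)"
    by (intro ext) (simp add: pullback_apply)
  have "trace_data n ?D M (pullback ?D M \<tau> (\<lambda>xs p. a * \<gamma> xs p))
      (\<lambda>x y p. a * \<beta> x y p) (\<lambda>i x p. a * F i x p) (\<lambda>i. a * \<kappa> i)"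
    using trace_data_map[OF _ 1(3), of "(*) a"] unfolding eq by (simp add: distrib_left)
  then have "has_trace (I, N, \<lambda>xs p. a * \<gamma> xs p) (\<Sum>i\<in>{0..<int n}. a * \<kappa> i)"
    unfolding has_trace_def prod.case using 1(1,2) by blast
  moreover have "(I, N, \<lambda>xs p. a * \<gamma> xs p) \<in> cech_cocycles ?D ?A 2"
    using g cocycle_map[of "(*) a" ?A \<gamma> I N 2] by (auto simp: cech_cocycles_def distrib_left jF_fibre_iff)
  ultimately have "H2_value (I, N, \<lambda>xs p. a * \<gamma> xs p) = (\<Sum>i\<in>{0..<int n}. a * \<kappa> i)" by (intro H2_value_eq)
  then show ?thesis by (simp add: v sum_distrib_left)
qed

end

section \<open>Traces on the star cover and the cup product\<close>

lemma loc_const_compose: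
  fixes s :: "'q::metric_space \<Rightarrow> 'a" and g :: "'p::metric_space \<Rightarrow> 'q"
  assumes "loc_const s W'" "continuous_on W g" "g ` W \<subseteq> W'"
  shows "loc_const (\<lambda>p. s (g p)) W"
  unfolding loc_const_metric
proof
  fix p assume p: "p \<in> W"
  then obtain e where e: "e > 0" "\<And>r. r \<in> W' \<Longrightarrow> dist r (g p) < e \<Longrightarrow> s r = s (g p)"
    using assms(1,3) unfolding loc_const_metric by blast
  obtain d where d: "d > 0" "\<And>r. r \<in> W \<Longrightarrow> dist r p < d \<Longrightarrow> dist (g r) (g p) < e"
    using assms(2) p e(1) unfolding continuous_on_iff by metis
  show "\<exists>e>0. \<forall>r\<in>W. dist r p < e \<longrightarrow> s (g r) = s (g p)"
    using d e(2) assms(3) by (intro exI[of _ d]) blast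
qed

context ngon
begin

lemma tri_vertices_mem: "0 \<in> tri_vertices n" "vertex n i \<in> tri_vertices n"
  by (auto simp: tri_vertices_def)

lemma star_half:
  assumes "x \<in> tri_vertices n" "p \<in> star n x"
  shows "(1 / 2) *\<^sub>R p \<in> star n x \<inter> star n 0"
  using star_scale[OF assms, of "1 / 2"] scale_in_interior[of p "1 / 2"] star_subset_polygon[OF assms(1)] assms(2)
  by (auto simp: star_zero)

lemma star_segment:
  assumes "x \<in> tri_vertices n" "p \<in> star n x"
  shows "closed_segment ((1 / 2) *\<^sub>R p) p \<subseteq> star n x"
proof
  fix q assume "q \<in> closed_segment ((1 / 2) *\<^sub>R p) p"
  then obtain u where u: "0 \<le> u" "u \<le> 1" "q = (1 - u) *\<^sub>R (1 / 2) *\<^sub>R p + u *\<^sub>R p"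
    by (auto simp: closed_segment_def)
  have "q = ((1 - u) / 2 + u) *\<^sub>R p" unfolding u(3) by (simp add: scaleR_add_left)
  moreover have "((1 - u) / 2 + u) *\<^sub>R p \<in> star n x"
    by (rule star_scale[OF assms]) (use u in \<open>auto simp: field_simps\<close>)
  ultimately show "q \<in> star n x" by simp
qed

text \<open>Cone construction with apex at the central vertex \<open>0\<close>. The section
  \<open>\<gamma> [0, x, y]\<close> is only defined in the interior; evaluation at \<open>p /
  2\<close> extends it to the boundary, because the stars are stable under scaling.\<close>

lemma trace_data_star:
  fixes \<gamma> :: "(complex, 'a::ab_group_add) cochain"
  assumes \<gamma>: "\<gamma> \<in> cocycles (jF_fibre n) (tri_vertices n) (star n) 2"
  shows "\<exists>\<beta> F \<kappa>. trace_data n (tri_vertices n) (star n) \<gamma> \<beta> F \<kappa>"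
proof -
  let ?T = "tri_vertices n" and ?S = "star n"
  have gc: "\<gamma> \<in> cochains (jF_fibre n) ?T ?S 2" using \<gamma> by (simp add: cocycles_def)
  define \<beta> where "\<beta> x y p = \<gamma> [0, x, y] ((1 / 2) *\<^sub>R p)" for x y p
  have "\<exists>F \<kappa>. trace_data n ?T ?S \<gamma> \<beta> F \<kappa>"
  proof (rule trace_data_exists[OF open_cover_star gc])
    fix x y assume "x \<in> ?T" "y \<in> ?T"
    then show "loc_const (\<beta> x y) (?S x \<inter> ?S y)"
      unfolding \<beta>_def using star_half
      by (intro loc_const_compose[OF cochain_2_loc_const(1)[OF gc tri_vertices_mem(1)]] continuous_intros) auto
  next
    fix x y z p assume x: "x \<in> ?T" "y \<in> ?T" "z \<in> ?T" "p \<in> ?S x" "p \<in> ?S y" "p \<in> ?S z"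
    let ?q = "(1 / 2) *\<^sub>R p"
    have q: "?q \<in> ?S 0" "?q \<in> ?S x" "?q \<in> ?S y" "?q \<in> ?S z"
      using star_half x by blast+
    have "\<gamma> [x, y, z] ?q - \<gamma> [0, y, z] ?q + \<gamma> [0, x, z] ?q - \<gamma> [0, x, y] ?q = 0"
      by (rule cocycle_2_apply[OF jF_closed(1) \<gamma> tri_vertices_mem(1) x(1-3) q])
    moreover have "\<gamma> [x, y, z] ?q = \<gamma> [x, y, z] p"
      by (rule loc_const_convex_eq[OF cochain_2_loc_const(1)[OF gc x(1-3)] convex_closed_segment])
        (use star_segment x in auto)
    ultimately show "\<gamma> [x, y, z] p = \<beta> y z p - \<beta> x z p + \<beta> x y p"
      unfolding \<beta>_def by (simp add: algebra_simps)
  qed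
  then show ?thesis by blast
qed

lemma triangle_in_stars:
  assumes "0 < a" "0 < b" "a + b < 1"
  shows "a *\<^sub>R vertex n i + b *\<^sub>R vertex n (i + 1) \<in> star n (vertex n i) \<inter> star n (vertex n (i + 1)) \<inter> star n 0"
  using combination_in_star[of a b i] combination_in_star[of b a i] interior_combination[of a b i "i + 1"]
    assms by (auto simp: star_zero)

text \<open>The values of \<open>\<beta>\<close> on the edges to the central vertex cancel
  between adjacent triangles, and so do the values of \<open>F\<close> at the vertices up to the
  mismatches \<open>\<kappa> i\<close>. What has to be checked is that the sections involved are
  constant along segments that join the points of evaluation.\<close>

lemma trace_on_star_cover:
  fixes \<gamma> :: "(complex, 'a::ab_group_add) cochain"
  assumes T: "trace_data n (tri_vertices n) (star n) \<gamma> \<beta> F \<kappa>"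
  shows "(\<Sum>i\<in>{0..<int n}. \<kappa> i) = (\<Sum>i\<in>{0..<int n}. triangle_value n \<gamma> i)"
proof -
  note D = trace_dataD[OF T]
  have n_gt0: "n > 0" using n3 by simp
  define m where "m i = midpoint (vertex n i) (vertex n (i + 1))" for i
  define h where "h i = (1 / 2) *\<^sub>R vertex n i" for i
  define t where "t i = (vertex n i + vertex n (i + 1)) / 3" for i
  have m_eq: "m i = (1 / 2) *\<^sub>R vertex n i + (1 / 2) *\<^sub>R vertex n (i + 1)" for i
    by (simp add: m_def midpoint_def scaleR_add_right inverse_eq_divide)
  have t_eq: "t i = (1 / 3) *\<^sub>R vertex n i + (1 / 3) *\<^sub>R vertex n (i + 1)" for i
    by (simp add: t_def scaleR_conv_of_real add_divide_distrib)
  have along: "F i (vertex n (i + 1)) (vertex n (i + 1)) - F i (vertex n i) (vertex n i)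
      = \<beta> (vertex n i) (vertex n (i + 1)) (m i)" for i
  proof -
    have seg: "closed_segment (vertex n i) (m i) \<subseteq> edge n i" "closed_segment (vertex n (i + 1)) (m i) \<subseteq> edge n i"
      unfolding m_def by (auto intro!: subset_closed_segment[THEN iffD2])
    have st: "closed_segment (vertex n i) (m i) \<subseteq> star n (vertex n i)"
      "closed_segment (vertex n (i + 1)) (m i) \<subseteq> star n (vertex n (i + 1))"
      using half_edge_in_star[of i] by (simp_all add: m_def midpoint_sym)
    have "F i (vertex n i) (vertex n i) = F i (vertex n i) (m i)"
      by (rule loc_const_convex_eq[OF D(3)[OF tri_vertices_mem(2)] convex_closed_segment]) (use seg st in auto)
    moreover have "F i (vertex n (i + 1)) (vertex n (i + 1)) = F i (vertex n (i + 1)) (m i)"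
      by (rule loc_const_convex_eq[OF D(3)[OF tri_vertices_mem(2)] convex_closed_segment]) (use seg st in auto)
    moreover have "F i (vertex n (i + 1)) (m i) - F i (vertex n i) (m i) = \<beta> (vertex n i) (vertex n (i + 1)) (m i)"
      using seg st by (intro D(4) tri_vertices_mem) auto
    ultimately show ?thesis by simp
  qed
  have edge_const: "\<beta> (vertex n i) (vertex n (i + 1)) (t i) = \<beta> (vertex n i) (vertex n (i + 1)) (m i)" for i
  proof (rule loc_const_convex_eq[OF D(1)[OF tri_vertices_mem(2) tri_vertices_mem(2)] convex_closed_segment])
    show "closed_segment (t i) (m i) \<subseteq> star n (vertex n i) \<inter> star n (vertex n (i + 1))"
    proof
      fix q assume "q \<in> closed_segment (t i) (m i)"
      then obtain u where u: "0 \<le> u" "u \<le> 1" "q = (1 - u) *\<^sub>R t i + u *\<^sub>R m i"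
        by (auto simp: closed_segment_def)
      define a where "a = (1 - u) / 3 + u / 2"
      have "q = a *\<^sub>R vertex n i + a *\<^sub>R vertex n (i + 1)"
        unfolding u(3) t_eq m_eq a_def by (simp add: scaleR_add_right scaleR_add_left)
      moreover have "a > 0" "a + a \<le> 1" using u by (auto simp: a_def field_simps)
      ultimately show "q \<in> star n (vertex n i) \<inter> star n (vertex n (i + 1))"
        using combination_in_star[of a a i] by auto
    qed
  qed auto
  have right: "\<beta> (vertex n (i + 1)) 0 (t i) = \<beta> (vertex n (i + 1)) 0 (h (i + 1))" for i
  proof (rule loc_const_convex_eq[OF D(1)[OF tri_vertices_mem(2) tri_vertices_mem(1)] convex_closed_segment])
    show "closed_segment (t i) (h (i + 1)) \<subseteq> star n (vertex n (i + 1)) \<inter> star n 0"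
    proof
      fix q assume "q \<in> closed_segment (t i) (h (i + 1))"
      then obtain u where u: "0 \<le> u" "u \<le> 1" "q = (1 - u) *\<^sub>R t i + u *\<^sub>R h (i + 1)"
        by (auto simp: closed_segment_def)
      define a b where "a = (1 - u) / 3 + u / 2" and "b = (1 - u) / 3"
      have "q = b *\<^sub>R vertex n i + a *\<^sub>R vertex n (i + 1)"
        unfolding u(3) t_eq h_def a_def b_def by (simp add: scaleR_add_right scaleR_add_left)
      moreover have "a > 0" "b \<ge> 0" "a + b < 1" using u by (auto simp: a_def b_def field_simps)
      ultimately show "q \<in> star n (vertex n (i + 1)) \<inter> star n 0"
        using combination_in_star(2)[of a b i] interior_combination[of b a i "i + 1"]
        by (auto simp: star_zero)
    qed
  qed auto
  have left: "\<beta> (vertex n i) 0 (t i) = \<beta> (vertex n i) 0 (h i)" for i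
  proof (rule loc_const_convex_eq[OF D(1)[OF tri_vertices_mem(2) tri_vertices_mem(1)] convex_closed_segment])
    show "closed_segment (t i) (h i) \<subseteq> star n (vertex n i) \<inter> star n 0"
    proof
      fix q assume "q \<in> closed_segment (t i) (h i)"
      then obtain u where u: "0 \<le> u" "u \<le> 1" "q = (1 - u) *\<^sub>R t i + u *\<^sub>R h i"
        by (auto simp: closed_segment_def)
      define a b where "a = (1 - u) / 3 + u / 2" and "b = (1 - u) / 3"
      have "q = a *\<^sub>R vertex n i + b *\<^sub>R vertex n (i + 1)"
        unfolding u(3) t_eq h_def a_def b_def by (simp add: scaleR_add_right scaleR_add_left)
      moreover have "a > 0" "b \<ge> 0" "a + b < 1" using u by (auto simp: a_def b_def field_simps)
      ultimately show "q \<in> star n (vertex n i) \<inter> star n 0"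
        using combination_in_star(1)[of a b i] interior_combination[of a b i "i + 1"]
        by (auto simp: star_zero)
    qed
  qed auto
  have tri: "triangle_value n \<gamma> i = \<beta> (vertex n (i + 1)) 0 (h (i + 1)) - \<beta> (vertex n i) 0 (h i)
      + (F i (vertex n (i + 1)) (vertex n (i + 1)) - F i (vertex n i) (vertex n i))" for i
  proof -
    have "t i \<in> star n (vertex n i) \<inter> star n (vertex n (i + 1)) \<inter> star n 0"
      unfolding t_eq by (rule triangle_in_stars) auto
    then have "\<gamma> [vertex n i, vertex n (i + 1), 0] (t i)
        = \<beta> (vertex n (i + 1)) 0 (t i) - \<beta> (vertex n i) 0 (t i) + \<beta> (vertex n i) (vertex n (i + 1)) (t i)"
      by (intro D(2) tri_vertices_mem) auto
    then show ?thesis unfolding right left edge_const along by (simp add: triangle_value_def t_def)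
  qed
  define G where "G i = F (i - 1) (vertex n i) (vertex n i)" for i
  have pv: "vertex n (i + int n) = vertex n i" for i using periodic_vertex by (simp add: periodic_def)
  have "F (i + int n - 1) = F (i - 1)" for i
    using D(5)[unfolded periodic_def, rule_format, of "i - 1"] by (simp add: algebra_simps)
  then have Gp: "periodic n G" by (simp add: periodic_def G_def pv)
  have \<kappa>: "\<kappa> i = G i - F i (vertex n i) (vertex n i)" for i
    using D(7)[OF tri_vertices_mem(2) vertex_in_star, of i] by (simp add: G_def)
  have bp: "periodic n (\<lambda>i. \<beta> (vertex n i) 0 (h i))"
    by (simp add: periodic_def pv h_def)
  have "(\<Sum>i\<in>{0..<int n}. triangle_value n \<gamma> i)
      = (\<Sum>i\<in>{0..<int n}. \<beta> (vertex n (i + 1)) 0 (h (i + 1)) - \<beta> (vertex n i) 0 (h i))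
      + (\<Sum>i\<in>{0..<int n}. G (i + 1) - G i) + (\<Sum>i\<in>{0..<int n}. \<kappa> i)"
    unfolding sum.distrib[symmetric] by (intro sum.cong refl) (simp add: tri \<kappa> G_def)
  then show ?thesis
    using sum_periodic_difference(1)[OF bp n_gt0] sum_periodic_difference(1)[OF Gp n_gt0] by simp
qed

lemma H2_value_star:
  assumes "\<gamma> \<in> cocycles (jF_fibre n) (tri_vertices n) (star n) 2"
  shows "H2_value (tri_vertices n, star n, \<gamma>) = (\<Sum>i\<in>{0..<int n}. triangle_value n \<gamma> i)"
proof -
  obtain \<beta> F \<kappa> where T: "trace_data n (tri_vertices n) (star n) \<gamma> \<beta> F \<kappa>" using trace_data_star[OF assms] by blast
  have "(tri_vertices n, star n, \<gamma>) \<in> cech_cocycles (polygon n) (jF_fibre n) 2"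
    using assms open_cover_star by (simp add: cech_cocycles_def)
  moreover have "has_trace (tri_vertices n, star n, \<gamma>) (\<Sum>i\<in>{0..<int n}. \<kappa> i)"
    by (rule has_traceI[OF open_cover_star _ T]) (use assms in \<open>simp add: cocycles_def\<close>)
  ultimately show ?thesis using H2_value_eq trace_on_star_cover[OF T] by metis
qed

text \<open>The coboundary of a 1-cochain of the constant sheaf that is supported on the edge
  from vertex \<open>0\<close> to vertex \<open>1\<close> takes values in the extension by zero,
  since at a boundary point at most two different stars meet.\<close>

lemma H2_value_range:
  "H2_value ` cech_cocycles (polygon n) (jF_fibre n :: complex \<Rightarrow> 'a::ab_group_add set) 2 = UNIV"
proof (intro equalityI subsetI)
  fix t :: 'a
  let ?T = "tri_vertices n" and ?S = "star n" and ?v = "vertex n"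
  define \<beta> where "\<beta> x y = (if x = ?v 0 \<and> y = ?v 1 then t else if x = ?v 1 \<and> y = ?v 0 then - t else 0)" for x y
  have v01: "?v 0 \<noteq> ?v 1" using vertex_neq_next(1)[of 0] by simp
  have \<beta>: "\<beta> x x = 0" "\<beta> x y + \<beta> y x = 0" for x y using v01 by (auto simp: \<beta>_def)
  define \<gamma> where "\<gamma> = make_cochain ?T ?S 2 (\<lambda>xs p. \<beta> (xs ! 1) (xs ! 2) - \<beta> (xs ! 0) (xs ! 2) + \<beta> (xs ! 0) (xs ! 1))"
  have \<gamma>_apply: "\<gamma> [x, y, z] p = \<beta> y z - \<beta> x z + \<beta> x y"
    if "x \<in> ?T" "y \<in> ?T" "z \<in> ?T" "p \<in> ?S x" "p \<in> ?S y" "p \<in> ?S z" for x y z p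
    using that by (simp add: \<gamma>_def make_cochain_apply)
  have val: "\<beta> y z - \<beta> x z + \<beta> x y \<in> jF_fibre n p"
    if x: "x \<in> ?T" "y \<in> ?T" "z \<in> ?T" "p \<in> ?S x" "p \<in> ?S y" "p \<in> ?S z" for x y z p
  proof (cases "p \<in> interior (polygon n)")
    case False
    have "p \<in> polygon n" using star_subset_polygon[OF x(1)] x(4) by blast
    then obtain i where "p \<in> edge n i" using boundary_in_edge False by blast
    then have "x = ?v i \<or> x = ?v (i + 1)" "y = ?v i \<or> y = ?v (i + 1)" "z = ?v i \<or> z = ?v (i + 1)"
      using edge_star x by blast+
    then have "x = y \<or> y = z \<or> x = z" by blast
    then have "\<beta> y z - \<beta> x z + \<beta> x y = 0" using \<beta>(2)[of x y] by (auto simp: \<beta>(1) add.commute)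
    then show ?thesis by (simp add: jF_fibre_iff)
  qed (simp add: jF_fibre_iff)
  have gc: "\<gamma> \<in> cochains (jF_fibre n) ?T ?S 2"
    unfolding \<gamma>_def
  proof (rule make_cochain_in)
    fix xs p assume "length xs = Suc 2" "set xs \<subseteq> ?T" "p \<in> (\<Inter>x\<in>set xs. ?S x)"
    then show "\<beta> (xs ! 1) (xs ! 2) - \<beta> (xs ! 0) (xs ! 2) + \<beta> (xs ! 0) (xs ! 1) \<in> jF_fibre n p"
      by (intro val) (auto simp: numeral_2_eq_2 length_Suc_conv)
  qed auto
  have g: "\<gamma> \<in> cocycles (jF_fibre n) ?T ?S 2"
    unfolding cocycles_2_iff[of "jF_fibre n :: complex \<Rightarrow> 'a set", OF jF_closed(1)] using gc by (auto simp: \<gamma>_apply)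
  have tri: "triangle_value n \<gamma> i = \<beta> (?v i) (?v (i + 1))" for i
  proof -
    have eq: "(?v i + ?v (i + 1)) / 3 = (1 / 3) *\<^sub>R ?v i + (1 / 3) *\<^sub>R ?v (i + 1)"
      by (simp add: scaleR_conv_of_real add_divide_distrib)
    have "(?v i + ?v (i + 1)) / 3 \<in> ?S (?v i) \<inter> ?S (?v (i + 1)) \<inter> ?S 0"
      unfolding eq by (rule triangle_in_stars) auto
    then have "triangle_value n \<gamma> i = \<beta> (?v (i + 1)) 0 - \<beta> (?v i) 0 + \<beta> (?v i) (?v (i + 1))"
      unfolding triangle_value_def by (intro \<gamma>_apply tri_vertices_mem) auto
    moreover have "\<beta> x 0 = 0" for x using vertex_nonzero by (simp add: \<beta>_def)
    ultimately show ?thesis by simp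
  qed
  have "\<beta> (?v i) (?v (i + 1)) = (if i = 0 then t else 0)" if i: "i \<in> {0..<int n}" for i
  proof -
    have "?v i = ?v 0 \<longleftrightarrow> i = 0" using i zdvd_not_zless[of i "int n"] by (force simp: vertex_eq_iff)
    moreover have "\<not> (?v i = ?v 1 \<and> ?v (i + 1) = ?v 0)"
    proof
      assume "?v i = ?v 1 \<and> ?v (i + 1) = ?v 0"
      then have h: "int n dvd i - 1" "int n dvd i + 1 - 0" unfolding vertex_eq_iff by auto
      have "int n dvd 2" using dvd_diff[OF h(2,1)] by simp
      then show False using n3 by (auto dest: zdvd_imp_le)
    qed
    ultimately show ?thesis by (auto simp: \<beta>_def)
  qed
  then have "(\<Sum>i\<in>{0..<int n}. triangle_value n \<gamma> i) = (\<Sum>i\<in>{0..<int n}. if i = 0 then t else 0)"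
    unfolding tri by (intro sum.cong) auto
  also have "\<dots> = t" using n3 by simp
  finally have "H2_value (?T, ?S, \<gamma>) = t" using H2_value_star[OF g] by simp
  moreover have "(?T, ?S, \<gamma>) \<in> cech_cocycles (polygon n) (jF_fibre n) 2"
    using g open_cover_star by (simp add: cech_cocycles_def)
  ultimately show "t \<in> H2_value ` cech_cocycles (polygon n) (jF_fibre n) 2" by blast
qed simp

end

context lagrangian_ngon
begin

lemma cup_apply: "cup_cochain B 1 c c' [x, y, z] p = B (c [x, y] p) (c' [y, z] p)"
  by (simp add: cup_cochain_def numeral_2_eq_2)

lemma cup_cocycle:
  assumes cov: "open_cover (polygon n) I N"
    and c: "c \<in> cocycles (P_fibre n l) I N 1" "c' \<in> cocycles (P_fibre n l) I N 1"
  shows "cup_cochain B 1 c c' \<in> cocycles (jF_fibre n) I N 2"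
proof -
  have cc: "c \<in> cochains (P_fibre n l) I N 1" "c' \<in> cochains (P_fibre n l) I N 1"
    using c by (auto simp: cocycles_def)
  have c1: "c [y, z] p - c [x, z] p + c [x, y] p = 0" "c' [y, z] p - c' [x, z] p + c' [x, y] p = 0"
    if "x \<in> I" "y \<in> I" "z \<in> I" "p \<in> N x" "p \<in> N y" "p \<in> N z" for x y z p
    using c that unfolding cocycles_1_iff[of "P_fibre n l", OF P_closed(1)] by blast+
  have "cup_cochain B 1 c c' \<in> cochains (jF_fibre n) I N 2"
    unfolding cochains_iff
  proof (intro conjI allI impI ballI)
    fix xs assume xs: "length xs = Suc 2" "set xs \<subseteq> I"
    then obtain x y z where x: "xs = [x, y, z]" "x \<in> I" "y \<in> I" "z \<in> I"
      by (auto simp: numeral_2_eq_2 length_Suc_conv)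
    have lc: "loc_const (c [x, y]) (N x \<inter> N y \<inter> N z)" "loc_const (c' [y, z]) (N x \<inter> N y \<inter> N z)"
      by (rule loc_const_mono[OF cochain_1_loc_const(1)[OF cc(1) x(2,3)]], blast)
        (rule loc_const_mono[OF cochain_1_loc_const(1)[OF cc(2) x(3,4)]], blast)
    have "cup_cochain B 1 c c' [x, y, z] = (\<lambda>p. B (c [x, y] p) (c' [y, z] p))"
      by (intro ext) (rule cup_apply)
    moreover have "(\<Inter>x\<in>set xs. N x) = N x \<inter> N y \<inter> N z" using x(1) by auto
    ultimately show "loc_const (cup_cochain B 1 c c' xs) (\<Inter>x\<in>set xs. N x)"
      using loc_const_comp2[OF lc, of B] unfolding x(1) by simp
    fix p assume "p \<in> (\<Inter>x\<in>set xs. N x)"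
    then have p: "p \<in> N x" "p \<in> N y" "p \<in> N z" using x(1) by auto
    show "cup_cochain B 1 c c' xs p \<in> jF_fibre n p"
    proof (cases "p \<in> interior (polygon n)")
      case False
      have "p \<in> polygon n" using p(1) open_coverD(2)[OF cov x(2)] by blast
      then obtain i where i: "p \<in> edge n i" using boundary_in_edge False by blast
      have "c [x, y] p \<in> P_fibre n l p" "c' [y, z] p \<in> P_fibre n l p"
        using cochain_1_loc_const(2)[OF cc(1) x(2,3) p(1,2)] cochain_1_loc_const(2)[OF cc(2) x(3,4) p(2,3)] .
      then have "c [x, y] p \<in> l i" "c' [y, z] p \<in> l i" using i unfolding P_fibre_iff by blast+
      then have "B (c [x, y] p) (c' [y, z] p) = 0" by (rule lagrangian_isotropic)
      then show ?thesis unfolding x(1) cup_apply by (simp add: jF_fibre_iff)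
    qed (simp add: jF_fibre_iff)
  next
    fix xs p assume no: "\<not> (length xs = Suc 2 \<and> set xs \<subseteq> I \<and> p \<in> (\<Inter>x\<in>set xs. N x))"
    have "c (take (Suc 1) xs) p = 0 \<or> c' (drop 1 xs) p = 0"
    proof (rule ccontr)
      assume "\<not> ?thesis"
      then have 1: "length (take (Suc 1) xs) = Suc 1" "set (take (Suc 1) xs) \<subseteq> I" "p \<in> (\<Inter>x\<in>set (take (Suc 1) xs). N x)"
        and 2: "length (drop 1 xs) = Suc 1" "set (drop 1 xs) \<subseteq> I" "p \<in> (\<Inter>x\<in>set (drop 1 xs). N x)"
        using cochain_outside[OF cc(1)] cochain_outside[OF cc(2)] by blast+
      then have "length xs = Suc (Suc (Suc 0))" by simp
      then obtain x y z where "xs = [x, y, z]" by (auto simp: length_Suc_conv)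
      then show False using no 1 2 by simp
    qed
    then show "cup_cochain B 1 c c' xs p = 0" by (auto simp: cup_cochain_def symplectic_zero)
  qed
  moreover have "B (c [y, z] p) (c' [z, w] p) - B (c [x, z] p) (c' [z, w] p)
      + B (c [x, y] p) (c' [y, w] p) - B (c [x, y] p) (c' [y, z] p) = 0"
    if x: "x \<in> I" "y \<in> I" "z \<in> I" "w \<in> I" "p \<in> N x" "p \<in> N y" "p \<in> N z" "p \<in> N w" for x y z w p
  proof -
    have e: "c [x, z] p = c [x, y] p + c [y, z] p" "c' [y, w] p = c' [y, z] p + c' [z, w] p"
      using c1(1)[OF x(1-3,5-7)] c1(2)[OF x(2-4,6-8)] by (simp_all add: algebra_simps add_eq_0_iff)
    show ?thesis unfolding e symplectic_linear by simp
  qed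
  ultimately show ?thesis
    unfolding cocycles_2_iff[of "jF_fibre n :: complex \<Rightarrow> 'f set", OF jF_closed(1)] by (auto simp: cup_apply[unfolded One_nat_def])
qed

text \<open>If \<open>c = \<delta>b\<close> then the cup product of \<open>c\<close> and
  \<open>c'\<close> is the coboundary of \<open>\<beta> = B b c'\<close>. On edge \<open>i\<close>
  the primitive \<open>b\<close> may be replaced in \<open>\<beta>\<close> by its value \<open>g
  i\<close> at vertex \<open>i\<close>, because the difference and \<open>c'\<close> lie in the
  isotropic subspace \<open>l i\<close>. Hence \<open>B (g i) b'\<close> is a primitive of
  \<open>\<beta>\<close> on edge \<open>i\<close>, and its mismatch at vertex \<open>i\<close> is
  \<open>B (g (i - 1) - g i) (g' i)\<close>. As \<open>g' (i + 1)\<close> is an antiderivative of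
  the jumps of \<open>b'\<close>, these add up to \<open>- q\<close>.\<close>

lemma H2_value_cup:
  assumes cov: "open_cover (polygon n) I N"
    and c: "c \<in> cocycles (P_fibre n l) I N 1" "c' \<in> cocycles (P_fibre n l) I N 1"
    and b: "primitive I N c b" "primitive I N c' b'" and \<xi>: "vertex_index n I N \<xi>"
  shows "H2_value (I, N, cup_cochain B 1 c c') = - q_form n B (vertex_jumps n b \<xi>) (vertex_jumps n b' \<xi>)"
proof -
  have cc: "c \<in> cochains (P_fibre n l) I N 1" "c' \<in> cochains (P_fibre n l) I N 1"
    using c by (auto simp: cocycles_def)
  have b1: "\<And>x. x \<in> I \<Longrightarrow> loc_const (b x) (N x)"
    "\<And>x y p. x \<in> I \<Longrightarrow> y \<in> I \<Longrightarrow> p \<in> N x \<Longrightarrow> p \<in> N y \<Longrightarrow> c [x, y] p = b y p - b x p"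
    and b2: "\<And>x. x \<in> I \<Longrightarrow> loc_const (b' x) (N x)"
    "\<And>x y p. x \<in> I \<Longrightarrow> y \<in> I \<Longrightarrow> p \<in> N x \<Longrightarrow> p \<in> N y \<Longrightarrow> c' [x, y] p = b' y p - b' x p"
    using b by (auto simp: primitive_def)
  have \<xi>': "\<And>i. \<xi> i \<in> I" "\<And>i. vertex n i \<in> N (\<xi> i)" "periodic n \<xi>" using \<xi> by (auto simp: vertex_index_def)
  have P_l: "v \<in> P_fibre n l p \<Longrightarrow> p \<in> edge n i \<Longrightarrow> v \<in> l i" for v p i unfolding P_fibre_iff by blast
  define g where "g i = b (\<xi> i) (vertex n i)" for i
  define g' where "g' i = b' (\<xi> i) (vertex n i)" for i
  have pg: "periodic n g" "periodic n g'"
    using \<xi>'(3) periodic_vertex by (auto simp: g_def g'_def periodic_def)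
  define \<beta> where "\<beta> x y p = B (b x p) (c' [x, y] p)" for x y p
  define F where "F i x p = B (g i) (b' x p)" for i x p
  define \<kappa> where "\<kappa> i = B (g (i - 1) - g i) (g' i)" for i
  have gshift: "g (i + int n - 1) = g (i - 1)" for i
    using pg(1)[unfolded periodic_def, rule_format, of "i - 1"] by (simp add: algebra_simps)
  have T: "trace_data n I N (cup_cochain B 1 c c') \<beta> F \<kappa>"
    unfolding trace_data_def
  proof (intro conjI ballI allI impI)
    fix x y assume x: "x \<in> I" "y \<in> I"
    show "loc_const (\<beta> x y) (N x \<inter> N y)" unfolding \<beta>_def
      by (rule loc_const_comp2[OF loc_const_mono[OF b1(1)[OF x(1)]] cochain_1_loc_const(1)[OF cc(2) x]]) blast
  next
    fix x y z p assume x: "x \<in> I" "y \<in> I" "z \<in> I" "p \<in> N x \<inter> N y \<inter> N z"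
    have e: "c [x, y] p = b y p - b x p" "c' [y, z] p = b' z p - b' y p" "c' [x, z] p = b' z p - b' x p"
      "c' [x, y] p = b' y p - b' x p"
      using x b1(2) b2(2) by auto
    show "cup_cochain B 1 c c' [x, y, z] p = \<beta> y z p - \<beta> x z p + \<beta> x y p"
      unfolding cup_apply \<beta>_def e symplectic_diff by (simp add: algebra_simps)
  next
    fix i x assume x: "x \<in> I"
    show "loc_const (F i x) (N x \<inter> edge n i)" unfolding F_def
      by (rule loc_const_comp[OF loc_const_mono[OF b2(1)[OF x]]]) blast
  next
    fix i x y p assume x: "x \<in> I" "y \<in> I" "p \<in> N x \<inter> N y \<inter> edge n i"
    have "g i - b x p \<in> l i" unfolding g_def
      by (rule primitive_on_edge[OF cov c(1) b(1)]) (use x \<xi>' in auto)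
    moreover have "c' [x, y] p \<in> l i"
      using P_l cochain_1_loc_const(2)[OF cc(2) x(1,2)] x(3) by blast
    ultimately have "B (g i - b x p) (c' [x, y] p) = 0" by (rule lagrangian_isotropic)
    moreover have "c' [x, y] p = b' y p - b' x p" using b2(2) x by auto
    ultimately show "F i y p - F i x p = \<beta> x y p"
      by (simp add: F_def \<beta>_def symplectic_diff(2) flip: symplectic_diff(1))
  next
    show "periodic n F" using pg(1) by (simp add: periodic_def F_def[abs_def])
    show "periodic n \<kappa>" using pg by (simp add: periodic_def \<kappa>_def gshift)
  next
    fix i x assume x: "x \<in> I" "vertex n i \<in> N x"
    have e: "vertex n i \<in> edge n (i - 1)" by (rule vertex_in_edges(2))
    have "g (i - 1) - g i \<in> l (i - 1)" unfolding g_def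
      by (rule primitive_on_edge[OF cov c(1) b(1)])
        (use \<xi>' e vertex_in_edges(1)[of "i - 1"] in blast)+
    moreover have "c' [\<xi> i, x] (vertex n i) \<in> l (i - 1)"
      using P_l[OF _ e] cochain_1_loc_const(2)[OF cc(2) \<xi>'(1) x(1) \<xi>'(2) x(2)] by blast
    ultimately have "B (g (i - 1) - g i) (c' [\<xi> i, x] (vertex n i)) = 0" by (rule lagrangian_isotropic)
    moreover have "c' [\<xi> i, x] (vertex n i) = b' x (vertex n i) - g' i"
      unfolding g'_def by (rule b2(2)[OF \<xi>'(1) x(1) \<xi>'(2) x(2)])
    ultimately show "F (i - 1) x (vertex n i) - F i x (vertex n i) = \<kappa> i"
      by (simp add: F_def \<kappa>_def symplectic_diff)
  qed
  let ?w = "vertex_jumps n b \<xi>" and ?w' = "vertex_jumps n b' \<xi>"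
  have w: "?w i = g (i + 1) - g i" "?w' i = g' (i + 1) - g' i" for i
    by (simp_all add: vertex_jumps_def g_def g'_def)
  have "g' (i + int n + 1) = g' (i + 1)" for i
    using pg(2)[unfolded periodic_def, rule_format, of "i + 1"] by (simp add: algebra_simps)
  then have h: "antiderivative n ?w' (\<lambda>i. g' (i + 1))"
    by (simp add: antiderivative_def periodic_def w)
  have "q_form n B ?w ?w' = (\<Sum>i\<in>{0..<int n}. B (?w i) (g' (i + 1)))"
    by (rule q_form_eq[OF vertex_jumps_in_K[OF cov c(1) b(1) \<xi>] h])
  also have "\<dots> = (\<Sum>i\<in>{0..<int n}. (\<lambda>i. - \<kappa> i) (i + 1))"
    by (intro sum.cong) (simp_all add: \<kappa>_def w symplectic_diff)
  also have "\<dots> = (\<Sum>i\<in>{0..<int n}. - \<kappa> i)"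
    by (rule sum_periodic_shift) (use trace_dataD(6)[OF T] n_gt0 in \<open>auto simp: periodic_def\<close>)
  finally have q: "(\<Sum>i\<in>{0..<int n}. \<kappa> i) = - q_form n B ?w ?w'" by (simp add: sum_negf)
  have cyc: "cup_cochain B 1 c c' \<in> cocycles (jF_fibre n) I N 2" by (rule cup_cocycle[OF cov c])
  have "has_trace (I, N, cup_cochain B 1 c c') (\<Sum>i\<in>{0..<int n}. \<kappa> i)"
    by (rule has_traceI[OF cov _ T]) (use cyc in \<open>simp add: cocycles_def\<close>)
  then show ?thesis unfolding q by (intro H2_value_eq) (use cyc cov in \<open>auto simp: cech_cocycles_def\<close>)
qed

abbreviation "H1_poly \<equiv> cohomology (polygon n) (P_fibre n l) 1"
abbreviation "H2_poly \<equiv> cohomology (polygon n) (jF_fibre n :: complex \<Rightarrow> 'f set) 2"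
abbreviation "\<Phi>_poly \<equiv> class_value (H1_value)"
abbreviation "tr_poly \<equiv> class_value (H2_value :: (complex, 'f) cech \<Rightarrow> 'f)"

lemma cup_in_H2_and_trace:
  assumes X: "X \<in> H1_poly" and Y: "Y \<in> H1_poly"
  shows "cup B (polygon n) (jF_fibre n) 1 1 X Y \<in> H2_poly"
    and "tr_poly (cup B (polygon n) (jF_fibre n) 1 1 X Y) = - T_form n B (\<Phi>_poly X) (\<Phi>_poly Y)"
proof -
  have rep: "(I, N, cup_cochain B 1 c c') \<in> cech_cocycles (polygon n) (jF_fibre n) 2 \<and>
      H2_value (I, N, cup_cochain B 1 c c') = - T_form n B (\<Phi>_poly X) (\<Phi>_poly Y)"
    if r: "(I, N, c) \<in> X" "(I, N, c') \<in> Y" for I N c c'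
  proof -
    note VX = class_valueI[OF H1_rel P_closed(1) X r(1)] and VY = class_valueI[OF H1_rel P_closed(1) Y r(2)]
    obtain b \<xi> where 1: "open_cover (polygon n) I N" "c \<in> cocycles (P_fibre n l) I N 1"
      "primitive I N c b" "vertex_index n I N \<xi>" "vertex_jumps n b \<xi> \<in> K_space n l"
      "H1_value (I, N, c) = T_class n B l (vertex_jumps n b \<xi>)"
      using cech_cocycle_1E[OF VX(1)] by blast
    obtain b' where 2: "c' \<in> cocycles (P_fibre n l) I N 1" "primitive I N c' b'"
      using cech_cocycle_1E[OF VY(1)] by blast
    have "H1_value (I, N, c') = T_class n B l (vertex_jumps n b' \<xi>)"
      by (rule H1_value_eq[OF 1(1) 2 1(4)])
    then have "T_form n B (\<Phi>_poly X) (\<Phi>_poly Y) = q_form n B (vertex_jumps n b \<xi>) (vertex_jumps n b' \<xi>)"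
      unfolding VX(2) VY(2) 1(6)
      using T_form_class[OF 1(5) vertex_jumps_in_K[OF 1(1) 2 1(4)]] by simp
    then show ?thesis
      using H2_value_cup[OF 1(1,2) 2(1) 1(3) 2(2) 1(4)] cup_cocycle[OF 1(1,2) 2(1)] 1(1) by (simp add: cech_cocycles_def)
  qed
  obtain I N c c' where r: "(I, N, c) \<in> X" "(I, N, c') \<in> Y" by (rule common_representatives[OF H1_rel P_closed(1) X Y])
  have "coh_class (polygon n) (jF_fibre n) 2 I' N' (cup_cochain B 1 d d')
      = coh_class (polygon n) (jF_fibre n) 2 I N (cup_cochain B 1 c c')"
    if "(I', N', d) \<in> X" "(I', N', d') \<in> Y" for I' N' d d'
    unfolding coh_class_eq[OF H2_rel jF_closed(1) conjunct1[OF rep[OF that]]] coh_class_eq[OF H2_rel jF_closed(1) conjunct1[OF rep[OF r]]]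
      conjunct2[OF rep[OF that]] conjunct2[OF rep[OF r]] ..
  then have eq: "cup B (polygon n) (jF_fibre n) 1 1 X Y = coh_class (polygon n) (jF_fibre n) 2 I N (cup_cochain B 1 c c')"
    unfolding cup_def one_add_one using r by blast
  show "cup B (polygon n) (jF_fibre n) 1 1 X Y \<in> H2_poly"
    and "tr_poly (cup B (polygon n) (jF_fibre n) 1 1 X Y) = - T_form n B (\<Phi>_poly X) (\<Phi>_poly Y)"
    unfolding eq class_value_coh_class[OF H2_rel jF_closed(1) conjunct1[OF rep[OF r]]]
    using rep[OF r] coh_class_in_cohomology[OF H2_rel jF_closed(1) conjunct1[OF rep[OF r]]] by blast+
qed

lemma H1_class_has_K_representative: "X \<in> H1_poly \<Longrightarrow> \<exists>w\<in>K_space n l. \<Phi>_poly X = T_class n B l w"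
proof -
  assume X: "X \<in> H1_poly"
  obtain I N c where r: "(I, N, c) \<in> X" using cohomology_nonempty[OF H1_rel P_closed(1) X] by blast
  show ?thesis
    using cech_cocycle_1E[OF class_valueI(1)[OF H1_rel P_closed(1) X r]] class_valueI(2)[OF H1_rel P_closed(1) X r] by metis
qed

lemma H1_linear_iso: "linear_iso H1_poly (coh_add (polygon n) (P_fibre n l) 1) (coh_scale smul (polygon n) (P_fibre n l) 1)
         (T_space n B l) (T_add n B l) (T_scale n smul B l) \<Phi>_poly"
proof -
  interpret V: vector_space smul by (rule symplectic_vector_space)
  show ?thesis
    by (rule linear_iso_class_value[OF H1_rel P_closed(1) H1_value_range])
      (use P_closed H1_value_add H1_value_scale
        in \<open>simp_all add: V.scale_right_distrib\<close>)
qed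

lemma H2_linear_iso: "linear_iso H2_poly (coh_add (polygon n) (jF_fibre n) 2) (coh_scale (*) (polygon n) (jF_fibre n) 2)
         UNIV (+) (*) tr_poly"
  by (rule linear_iso_class_value[OF H2_rel jF_closed(1) H2_value_range])
    (use H2_value_add H2_value_scale in \<open>auto simp: distrib_left jF_fibre_iff\<close>)

lemma zero_classes:
  "coh_zero (polygon n) (P_fibre n l) 1 \<in> H1_poly" "\<Phi>_poly (coh_zero (polygon n) (P_fibre n l) 1) = T_class n B l (\<lambda>_. 0)"
  "coh_zero (polygon n) (jF_fibre n) 2 \<in> H2_poly" "tr_poly (coh_zero (polygon n) (jF_fibre n) 2) = 0"
proof -
  let ?D = "polygon n"
  have cov: "open_cover ?D ?D (\<lambda>_. ?D)"
    using zero_in_polygon by (auto simp: open_cover_def)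
  have z1: "0 \<in> cocycles (P_fibre n l) ?D (\<lambda>_. ?D) 1" by (rule zero_cocycle[OF P_closed(1)])
  have z2: "0 \<in> cocycles (jF_fibre n :: complex \<Rightarrow> 'f set) ?D (\<lambda>_. ?D) 2" by (rule zero_cocycle[OF jF_closed(1)])
  have C1: "(?D, \<lambda>_. ?D, 0) \<in> cech_cocycles ?D (P_fibre n l) 1"
    and C2: "(?D, \<lambda>_. ?D, 0) \<in> cech_cocycles ?D (jF_fibre n :: complex \<Rightarrow> 'f set) 2"
    using cov z1 z2 by (auto simp: cech_cocycles_def)
  show "coh_zero ?D (P_fibre n l) 1 \<in> H1_poly" unfolding coh_zero_def by (rule coh_class_in_cohomology[OF H1_rel P_closed(1) C1])
  show "coh_zero ?D (jF_fibre n) 2 \<in> H2_poly" unfolding coh_zero_def by (rule coh_class_in_cohomology[OF H2_rel jF_closed(1) C2])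
  obtain \<xi> where \<xi>: "vertex_index n ?D (\<lambda>_. ?D) \<xi>" using vertex_index_exists[OF cov] by blast
  have "primitive ?D (\<lambda>_. ?D) 0 (\<lambda>_ _. 0 :: 'v)" by (auto simp: primitive_def)
  from H1_value_eq[OF cov z1 this \<xi>]
  show "\<Phi>_poly (coh_zero ?D (P_fibre n l) 1) = T_class n B l (\<lambda>_. 0)"
    unfolding coh_zero_def class_value_coh_class[OF H1_rel P_closed(1) C1] by (simp add: vertex_jumps_def[abs_def])
  have "trace_data n ?D (\<lambda>_. ?D) 0 (\<lambda>_ _ _. 0 :: 'f) (\<lambda>_ _ _. 0) (\<lambda>_. 0)"
    by (auto simp: trace_data_def periodic_def)
  then have "has_trace (?D, \<lambda>_. ?D, 0) (\<Sum>i\<in>{0..<int n}. 0 :: 'f)"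
    by (intro has_traceI[OF cov]) (use z2 in \<open>auto simp: cocycles_def\<close>)
  then show "tr_poly (coh_zero ?D (jF_fibre n) 2) = 0"
    unfolding coh_zero_def class_value_coh_class[OF H2_rel jF_closed(1) C2] using H2_value_eq[OF C2] by simp
qed

lemma cup_symmetric:
  assumes X: "X \<in> H1_poly" and Y: "Y \<in> H1_poly"
  shows "cup B (polygon n) (jF_fibre n) 1 1 X Y = cup B (polygon n) (jF_fibre n) 1 1 Y X"
proof -
  obtain v w where v: "v \<in> K_space n l" "\<Phi>_poly X = T_class n B l v" and w: "w \<in> K_space n l" "\<Phi>_poly Y = T_class n B l w"
    using H1_class_has_K_representative X Y by metis
  have "T_form n B (\<Phi>_poly X) (\<Phi>_poly Y) = T_form n B (\<Phi>_poly Y) (\<Phi>_poly X)"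
    unfolding v(2) w(2) T_form_class[OF v(1) w(1)] T_form_class[OF w(1) v(1)]
    by (rule q_form_sym[OF v(1) w(1)])
  then show ?thesis
    using cohomology_eq_iff[OF H2_rel jF_closed(1) cup_in_H2_and_trace(1)[OF X Y] cup_in_H2_and_trace(1)[OF Y X]] cup_in_H2_and_trace(2)[OF X Y] cup_in_H2_and_trace(2)[OF Y X]
    by simp
qed

text \<open>Every element of \<open>T\<close> is the value of some class \<open>Y\<close>, so
  the jumps of a class orthogonal to all others lie in the kernel of \<open>q\<close>.\<close>

lemma cup_nondegenerate:
  assumes X: "X \<in> H1_poly" and zero: "\<And>Y. Y \<in> H1_poly \<Longrightarrow>
      cup B (polygon n) (jF_fibre n) 1 1 X Y = coh_zero (polygon n) (jF_fibre n) 2"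
  shows "X = coh_zero (polygon n) (P_fibre n l) 1"
proof -
  obtain w where w: "w \<in> K_space n l" "\<Phi>_poly X = T_class n B l w" using H1_class_has_K_representative X by metis
  have "q_form n B v w = 0" if v: "v \<in> K_space n l" for v
  proof -
    have "T_class n B l v \<in> \<Phi>_poly ` H1_poly"
      using H1_linear_iso v T_space_eq unfolding linear_iso_def bij_betw_def by blast
    then obtain Y where Y: "Y \<in> H1_poly" "T_class n B l v = \<Phi>_poly Y" by blast
    have "T_form n B (\<Phi>_poly X) (\<Phi>_poly Y) = 0" using zero[OF Y(1)] cup_in_H2_and_trace(2)[OF X Y(1)] zero_classes(4) by simp
    then show ?thesis
      unfolding w(2) Y(2)[symmetric] T_form_class[OF w(1) v] q_form_sym[OF v w(1)] .
  qed
  then have k: "w \<in> q_kernel n B l" using w(1) by (simp add: q_kernel_def)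
  have z: "(\<lambda>_. 0) \<in> K_space n l" using q_kernel_zero q_kernel_in_K by blast
  have "T_class n B l w = T_class n B l (\<lambda>_. 0)"
    unfolding T_class_eq_iff[OF w(1) z] using k by simp
  then show ?thesis using cohomology_eq_iff[OF H1_rel P_closed(1) X zero_classes(1)] w(2) zero_classes(2) by simp
qed

end

theorem mainTheorem9:
  fixes smul :: "'f::field \<Rightarrow> 'v::ab_group_add \<Rightarrow> 'v"
    and B :: "'v \<Rightarrow> 'v \<Rightarrow> 'f"
    and l :: "int \<Rightarrow> 'v set"
    and n :: nat
  assumes "CHAR('f) \<noteq> 2"
    and "symplectic_space smul B"
    and "n \<ge> 3"
    and "periodic n l"
    and "\<And>i. lagrangian smul B (l i)"
  defines "D \<equiv> polygon n"
    and "P \<equiv> P_fibre n l"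
    and "JF \<equiv> (jF_fibre n :: complex \<Rightarrow> 'f set)"
  defines "H1 \<equiv> cohomology D P 1"
    and "H2 \<equiv> cohomology D JF 2"
    and "cupP \<equiv> cup B D JF 1 1"
  shows "(\<forall>X\<in>H1. \<forall>Y\<in>H1. cupP X Y \<in> H2 \<and> cupP X Y = cupP Y X) \<and>
    (\<forall>X\<in>H1. (\<forall>Y\<in>H1. cupP X Y = coh_zero D JF 2) \<longrightarrow> X = coh_zero D P 1) \<and>
    (\<exists>\<Phi> tr.
       linear_iso H1 (coh_add D P 1) (coh_scale smul D P 1)
         (T_space n B l) (T_add n B l) (T_scale n smul B l) \<Phi> \<and>
       (\<forall>\<alpha>\<in>cocycles P (tri_vertices n) (star n) 1.
          edge_value n \<alpha> \<in> K_space n l \<and>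
          \<Phi> (coh_class D P 1 (tri_vertices n) (star n) \<alpha>) = T_class n B l (edge_value n \<alpha>)) \<and>
       linear_iso H2 (coh_add D JF 2) (coh_scale (*) D JF 2) UNIV (+) (*) tr \<and>
       (\<forall>\<gamma>\<in>cocycles JF (tri_vertices n) (star n) 2.
          tr (coh_class D JF 2 (tri_vertices n) (star n) \<gamma>) =
            (\<Sum>i\<in>{0..<int n}. triangle_value n \<gamma> i)) \<and>
       (\<forall>X\<in>H1. \<forall>Y\<in>H1. tr (cupP X Y) = - T_form n B (\<Phi> X) (\<Phi> Y)))"
proof -
  interpret lagrangian_ngon smul B n l
    by unfold_locales (use assms(2-5) in auto)
  note star_cover = open_cover_star
  show ?thesis
    unfolding H1_def H2_def cupP_def D_def P_def JF_def
  proof (intro conjI ballI impI exI[of _ "class_value (H1_value)"] exI[of _ "class_value (H2_value)"])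
    fix X Y assume X: "X \<in> cohomology (polygon n) (P_fibre n l) 1" and Y: "Y \<in> cohomology (polygon n) (P_fibre n l) 1"
    show "cup B (polygon n) (jF_fibre n) 1 1 X Y \<in> cohomology (polygon n) (jF_fibre n) 2"
      "class_value (H2_value) (cup B (polygon n) (jF_fibre n) 1 1 X Y)
        = - T_form n B (class_value (H1_value) X) (class_value (H1_value) Y)"
      by (rule cup_in_H2_and_trace[OF X Y])+
    show "cup B (polygon n) (jF_fibre n) 1 1 X Y = cup B (polygon n) (jF_fibre n) 1 1 Y X"
      by (rule cup_symmetric[OF X Y])
  next
    fix X assume "X \<in> cohomology (polygon n) (P_fibre n l) 1"
      "\<forall>Y\<in>cohomology (polygon n) (P_fibre n l) 1.
         cup B (polygon n) (jF_fibre n) 1 1 X Y = coh_zero (polygon n) (jF_fibre n) 2"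
    then show "X = coh_zero (polygon n) (P_fibre n l) 1" by (intro cup_nondegenerate) blast+
  next
    fix \<alpha> assume \<alpha>: "\<alpha> \<in> cocycles (P_fibre n l) (tri_vertices n) (star n) 1"
    show "edge_value n \<alpha> \<in> K_space n l" by (rule H1_value_star(1)[OF \<alpha>])
    have "(tri_vertices n, star n, \<alpha>) \<in> cech_cocycles (polygon n) (P_fibre n l) 1"
      using \<alpha> star_cover by (simp add: cech_cocycles_def)
    then show "class_value (H1_value) (coh_class (polygon n) (P_fibre n l) 1 (tri_vertices n) (star n) \<alpha>)
        = T_class n B l (edge_value n \<alpha>)"
      using class_value_coh_class[OF H1_rel P_closed(1)] H1_value_star(2)[OF \<alpha>] by simp
  next
    fix \<gamma> :: "(complex, 'f) cochain" assume \<gamma>: "\<gamma> \<in> cocycles (jF_fibre n) (tri_vertices n) (star n) 2"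
    have C: "(tri_vertices n, star n, \<gamma>) \<in> cech_cocycles (polygon n) (jF_fibre n) 2"
      using \<gamma> star_cover by (simp add: cech_cocycles_def)
    show "class_value (H2_value) (coh_class (polygon n) (jF_fibre n) 2 (tri_vertices n) (star n) \<gamma>)
        = (\<Sum>i\<in>{0..<int n}. triangle_value n \<gamma> i)"
      unfolding class_value_coh_class[OF H2_rel jF_closed(1) C]
      by (rule H2_value_star[OF \<gamma>])
  qed (rule H1_linear_iso H2_linear_iso)+
qed

end
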